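(* Let $n\ge4$ and let $Q$ be a Dynkin quiver of type $D_n$. For every maximal swing $\varrho$ in $\Gamma_Q$ there exists $1\le k\le n-2$ such that all roots in $\varrho$ contain $\varepsilon_k$ as a summand. Moreover, $\varrho$ contains the simple root $\alpha_k$, and $\varrho$ is of one of the following two forms (where $S_l$ and $N_l$ denote roots of level $l$): (1) $S_k\to S_{k+1}\to\cdots\to S_{n-2}$ with $S_k=\underline{\dim}\,P(k)$, then arrows from $S_{n-2}$ to both $\varepsilon_k+\varepsilon_{\mathtt t}$ and $\varepsilon_k-\varepsilon_{\mathtt t}$ (the two roots of $\varrho$ at levels $n-1$ and $n$, in some order), arrows from both of these to $N_{n-2}$, and then $N_{n-2}\to N_{n-3}\to\cdots\to N_1$; (2) $S_1\to S_2\to\cdots\to S_{n-2}$, then arrows from $S_{n-2}$ to both $\varepsilon_k+\varepsilon_{\mathtt t}$ and $\varepsilon_k-\varepsilon_{\mathtt t}$ (the two roots of $\varrho$ at levels $n-1$ and $n$, in some order), arrows from both of these to $N_{n-2}$, and then $N_{n-2}\to N_{n-3}\to\cdots\to N_k$ with $N_k=\underline{\dim}\,I(k)$.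
   Context: Type $D_n$ and the AR-quiver. $\Delta_n$ ($n\ge4$) is the Dynkin diagram of type $D_n$ with vertex set $I_0=\{1,\dots,n\}$ and edges $i - (i+1)$ for $1\le i\le n-2$ and $(n-2) - n$. With $\varepsilon_1,\dots,\varepsilon_n$ orthonormal, $\alpha_i=\varepsilon_i-\varepsilon_{i+1}$ ($i\le n-1$), $\alpha_n=\varepsilon_{n-1}+\varepsilon_n$, and $\Phi_n^+=\{\varepsilon_a\pm\varepsilon_b : 1\le a<b\le n\}$; $\varepsilon_a$ and $\pm\varepsilon_b$ are called the summands of $\varepsilon_a\pm\varepsilon_b$. A Dynkin quiver $Q$ of type $D_n$ is an orientation of $\Delta_n$. Fix a height function $\xi:I_0\to\mathbb Z$, i.e. $\xi_j=\xi_i-1$ whenever $i\to j$ in $Q$. For $i\in I_0$ let $\eta_i=\sum_j\alpha_j$, the sum over all $j$ admitting a (possibly trivial) path from $j$ to $i$ in $Q$, and $\zeta_i=\sum_j\alpha_j$, the sum over all $j$ admitting a path from $i$ to $j$. Let $P(i)$ and $I(i)$ be the projective cover and injective envelope of the simple $\mathbb CQ$-module at $i$ (representations being covariant: an arrow $i\to j$ acts by a map $M_i\to M_j$), so $\underline{\dim}\,P(i)=\zeta_i$, $\underline{\dim}\,I(i)=\eta_i$. Let $s_iQ$ be $Q$ with all arrows at $i$ reversed, and let $\tau=s_{i_1}\cdots s_{i_n}$ be the Coxeter element adapted to $Q$: $\{i_1,\dots,i_n\}=I_0$ and $i_k$ is a source of $s_{i_{k-1}}\cdots s_{i_1}Q$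 for all $k$. Put $m_i=\max\{k\ge 0:\tau^k(\eta_i)\in\Phi_n^+\}$. The Auslander-Reiten quiver $\Gamma_Q$ has vertices $(i,\xi_i-2k)$ with $i\in I_0$, $0\le k\le m_i$, and arrows $(i,p)\to(j,p+1)$ for $i,j$ adjacent in $\Delta_n$. Its vertices are identified with $\Phi_n^+$ by $(i,\xi_i-2k)\leftrightarrow\tau^k(\eta_i)$. If $\beta\leftrightarrow(i,p)$, the level of $\beta$ is $i$. One always has $|\xi_{n-1}-\xi_n|\in\{0,2\}$; put $\mathtt t=n-1$ if $|\xi_{n-1}-\xi_n|=2$ and $\mathtt t=n$ if $\xi_{n-1}=\xi_n$. Swings. An $S$-sectional path is a connected subquiver of $\Gamma_Q$ that is a concatenation of arrows of the form $(i,p)\to(i+1,p+1)$ ($1\le i\le n-2$) or $(n-2,p)\to(n,p+1)$. An $N$-sectional path is a connected concatenation of arrows of the form $(i,p)\to(i-1,p+1)$ ($2\le i\le n-1$) or $(n,p)\to(n-2,p+1)$. (Such a path may contain both arrows joining a level-$(n-2)$ vertex to levels $n-1$ and $n$.) A swing is a connected subquiver consisting of: an $S$-sectional path $S_r\to S_{r+1}\to\cdots\to S_{n-2}$ (with $S_l$ at level $l$, $r\le n-2$) together with arrows from $S_{n-2}$ to two roots $\beta$ at $(n-1,u)$ and $\alpha$ at $(n,u)$ for some $u\in\mathbb Z$; and arrows from $\alpha$ and $\beta$ to $N_{n-2}$ together with an $N$-sectional path $N_{n-2}\to N_{n-3}\to\cdots\to N_s$ (with $N_l$ at level $l$, $s\le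 n-2$). A swing is maximal if no bigger swing contains all of its roots.
   Formalization: The maximum defining m_i does not exist literally, since τ has finite order and τ^k(η_i) is a positive root for infinitely many k; m_i is taken as the largest k such that τ^0(η_i),…,τ^k(η_i) are all positive roots. *)

theory Defs
  imports
    Complex_Main
    "HOL-Library.Function_Algebras"
    "Jordan_Normal_Form.Matrix"
begin

subsection \<open>The root system of type D\<close>

text \<open>Vectors of \<open>n\<close>-dimensional Euclidean space are functions \<open>nat \<Rightarrow> real\<close>, of which only
  the coordinates \<open>1, \<dots>, n\<close> matter; all vectors constructed below vanish elsewhere. Addition,
  subtraction and negation are the pointwise ones of \<open>Function_Algebras\<close>.\<close>

type_synonym vect = "nat \<Rightarrow> real"

definition eps :: "nat \<Rightarrow> vect" where
  "eps a = (\<lambda>x. if x = a then 1 else 0)"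

definition inner_prod :: "nat \<Rightarrow> vect \<Rightarrow> vect \<Rightarrow> real" where
  "inner_prod n v w = (\<Sum>x\<in>{1..n}. v x * w x)"

definition simple_root :: "nat \<Rightarrow> nat \<Rightarrow> vect" where
  "simple_root n i = (if i = n then eps (n - 1) + eps n else eps i - eps (i + 1))"

definition pos_roots :: "nat \<Rightarrow> vect set" where
  "pos_roots n = {eps a + eps b | a b. 1 \<le> a \<and> a < b \<and> b \<le> n}
               \<union> {eps a - eps b | a b. 1 \<le> a \<and> a < b \<and> b \<le> n}"

definition summands :: "nat \<Rightarrow> vect \<Rightarrow> vect set" where
  "summands n \<beta> = {v. \<exists>a b. 1 \<le> a \<and> a < b \<and> b \<le> n \<and>
      (\<beta> = eps a + eps b \<and> v \<in> {eps a, eps b} \<or>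
       \<beta> = eps a - eps b \<and> v \<in> {eps a, - eps b})}"

definition simple_reflection :: "nat \<Rightarrow> nat \<Rightarrow> vect \<Rightarrow> vect" where
  "simple_reflection n i v =
     (let \<alpha> = simple_root n i
      in (\<lambda>x. v x - 2 * inner_prod n v \<alpha> / inner_prod n \<alpha> \<alpha> * \<alpha> x))"

subsection \<open>Dynkin quivers\<close>

definition dynkin_edges :: "nat \<Rightarrow> nat set set" where
  "dynkin_edges n = {{i, i + 1} | i. 1 \<le> i \<and> i \<le> n - 2} \<union> {{n - 2, n}}"

text \<open>A quiver is its set of arrows: \<open>(i, j) \<in> Q\<close> is the arrow from \<open>i\<close> to \<open>j\<close>.\<close>

type_synonym quiver = "(nat \<times> nat) set"

definition dynkin_quiver :: "nat \<Rightarrow> quiver \<Rightarrow> bool" where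
  "dynkin_quiver n Q \<longleftrightarrow>
     (\<forall>(i, j)\<in>Q. {i, j} \<in> dynkin_edges n) \<and>
     (\<forall>i j. {i, j} \<in> dynkin_edges n \<longrightarrow> ((i, j) \<in> Q \<longleftrightarrow> (j, i) \<notin> Q))"

definition height_function :: "quiver \<Rightarrow> (nat \<Rightarrow> int) \<Rightarrow> bool" where
  "height_function Q \<xi> \<longleftrightarrow> (\<forall>(i, j)\<in>Q. \<xi> j = \<xi> i - 1)"

definition reverse_at :: "nat \<Rightarrow> quiver \<Rightarrow> quiver" where
  "reverse_at i Q = {(a, b). if a = i \<or> b = i then (b, a) \<in> Q else (a, b) \<in> Q}"

definition is_source :: "nat \<Rightarrow> quiver \<Rightarrow> bool" where
  "is_source i Q \<longleftrightarrow> (\<forall>j. (j, i) \<notin> Q)"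

text \<open>The word \<open>w = [i\<^sub>1, \<dots>, i\<^sub>n]\<close> is adapted to \<open>Q\<close>; \<open>fold\<close> applies \<open>reverse_at i\<^sub>1\<close> first.\<close>

definition adapted_word :: "nat \<Rightarrow> quiver \<Rightarrow> nat list \<Rightarrow> bool" where
  "adapted_word n Q w \<longleftrightarrow> distinct w \<and> set w = {1..n} \<and>
     (\<forall>k<length w. is_source (w ! k) (fold reverse_at (take k w) Q))"

definition coxeter_element :: "nat \<Rightarrow> nat list \<Rightarrow> vect \<Rightarrow> vect" where
  "coxeter_element n w = foldr (\<circ>) (map (simple_reflection n) w) id"

subsection \<open>Representations of a quiver\<close>

text \<open>A finite-dimensional covariant complex representation with vertex set \<open>{1..n}\<close>, given in
  coordinates: the space at \<open>i\<close> is complex \<open>rep_dim M i\<close>-space and an arrow \<open>(i, j)\<close> acts by the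
  matrix \<open>rep_map M (i, j)\<close>.\<close>

record quiver_rep =
  rep_dim :: "nat \<Rightarrow> nat"
  rep_map :: "nat \<times> nat \<Rightarrow> complex mat"

definition is_rep :: "quiver \<Rightarrow> quiver_rep \<Rightarrow> bool" where
  "is_rep Q M \<longleftrightarrow> (\<forall>(i, j)\<in>Q. rep_map M (i, j) \<in> carrier_mat (rep_dim M j) (rep_dim M i))"

definition rep_hom ::
    "nat \<Rightarrow> quiver \<Rightarrow> quiver_rep \<Rightarrow> quiver_rep \<Rightarrow> (nat \<Rightarrow> complex mat) \<Rightarrow> bool" where
  "rep_hom n Q M N f \<longleftrightarrow>
     (\<forall>i\<in>{1..n}. f i \<in> carrier_mat (rep_dim N i) (rep_dim M i)) \<and>
     (\<forall>(i, j)\<in>Q. f j * rep_map M (i, j) = rep_map N (i, j) * f i)"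

definition rep_comp ::
    "(nat \<Rightarrow> complex mat) \<Rightarrow> (nat \<Rightarrow> complex mat) \<Rightarrow> nat \<Rightarrow> complex mat" where
  "rep_comp g f = (\<lambda>i. g i * f i)"

definition rep_surj ::
    "nat \<Rightarrow> quiver_rep \<Rightarrow> quiver_rep \<Rightarrow> (nat \<Rightarrow> complex mat) \<Rightarrow> bool" where
  "rep_surj n M N f \<longleftrightarrow>
     (\<forall>i\<in>{1..n}. \<forall>v\<in>carrier_vec (rep_dim N i). \<exists>u\<in>carrier_vec (rep_dim M i). f i *\<^sub>v u = v)"

definition rep_inj ::
    "nat \<Rightarrow> quiver_rep \<Rightarrow> (nat \<Rightarrow> complex mat) \<Rightarrow> bool" where
  "rep_inj n M f \<longleftrightarrow> (\<forall>i\<in>{1..n}. inj_on (\<lambda>u. f i *\<^sub>v u) (carrier_vec (rep_dim M i)))"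

definition projective_rep :: "nat \<Rightarrow> quiver \<Rightarrow> quiver_rep \<Rightarrow> bool" where
  "projective_rep n Q P \<longleftrightarrow> is_rep Q P \<and>
     (\<forall>M N g f. is_rep Q M \<and> is_rep Q N \<and> rep_hom n Q M N g \<and> rep_surj n M N g
         \<and> rep_hom n Q P N f
       \<longrightarrow> (\<exists>h. rep_hom n Q P M h \<and> (\<forall>i\<in>{1..n}. rep_comp g h i = f i)))"

definition injective_rep :: "nat \<Rightarrow> quiver \<Rightarrow> quiver_rep \<Rightarrow> bool" where
  "injective_rep n Q I \<longleftrightarrow> is_rep Q I \<and>
     (\<forall>M N g f. is_rep Q M \<and> is_rep Q N \<and> rep_hom n Q M N g \<and> rep_inj n M g
         \<and> rep_hom n Q M I f
       \<longrightarrow> (\<exists>h. rep_hom n Q N I h \<and> (\<forall>i\<in>{1..n}. rep_comp h g i = f i)))"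

text \<open>A projective cover is a projective with an essential epimorphism \<open>\<pi>\<close>: a morphism \<open>g\<close> into it
  is surjective as soon as \<open>\<pi> g\<close> is. Injective envelopes are the dual notion. Both are unique up
  to isomorphism, so their dimension vectors are well defined.\<close>

definition projective_cover :: "nat \<Rightarrow> quiver \<Rightarrow> quiver_rep \<Rightarrow> quiver_rep \<Rightarrow> bool" where
  "projective_cover n Q S P \<longleftrightarrow> projective_rep n Q P \<and>
     (\<exists>\<pi>. rep_hom n Q P S \<pi> \<and> rep_surj n P S \<pi> \<and>
       (\<forall>X g. is_rep Q X \<and> rep_hom n Q X P g \<and> rep_surj n X S (rep_comp \<pi> g)
          \<longrightarrow> rep_surj n X P g))"

definition injective_envelope :: "nat \<Rightarrow> quiver \<Rightarrow> quiver_rep \<Rightarrow> quiver_rep \<Rightarrow> bool" where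
  "injective_envelope n Q S I \<longleftrightarrow> injective_rep n Q I \<and>
     (\<exists>\<iota>. rep_hom n Q S I \<iota> \<and> rep_inj n S \<iota> \<and>
       (\<forall>X g. is_rep Q X \<and> rep_hom n Q I X g \<and> rep_inj n S (rep_comp g \<iota>)
          \<longrightarrow> rep_inj n I g))"

definition simple_rep :: "nat \<Rightarrow> quiver_rep" where
  "simple_rep i =
     (let d = (\<lambda>j. if j = i then 1 else 0)
      in \<lparr>rep_dim = d, rep_map = (\<lambda>(a, b). 0\<^sub>m (d b) (d a))\<rparr>)"

text \<open>The dimension vector as an element of the root lattice.\<close>

definition dimension_vector :: "nat \<Rightarrow> quiver_rep \<Rightarrow> vect" where
  "dimension_vector n M = (\<Sum>j\<in>{1..n}. (\<lambda>x. real (rep_dim M j) * simple_root n j x))"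

definition is_dim_P :: "nat \<Rightarrow> quiver \<Rightarrow> nat \<Rightarrow> vect \<Rightarrow> bool" where
  "is_dim_P n Q i \<beta> \<longleftrightarrow> (\<exists>P. projective_cover n Q (simple_rep i) P \<and> \<beta> = dimension_vector n P)"

definition is_dim_I :: "nat \<Rightarrow> quiver \<Rightarrow> nat \<Rightarrow> vect \<Rightarrow> bool" where
  "is_dim_I n Q i \<beta> \<longleftrightarrow> (\<exists>I. injective_envelope n Q (simple_rep i) I \<and> \<beta> = dimension_vector n I)"

subsection \<open>The Auslander-Reiten quiver\<close>

definition eta :: "nat \<Rightarrow> quiver \<Rightarrow> nat \<Rightarrow> vect" where
  "eta n Q i = (\<Sum>j\<in>{j\<in>{1..n}. (j, i) \<in> Q\<^sup>*}. simple_root n j)"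

text \<open>Since the Coxeter element \<open>\<tau>\<close> has finite order, \<open>\<tau>\<^sup>k(\<eta>\<^sub>i)\<close> is a positive root for infinitely
  many \<open>k\<close>. The maximum \<open>m\<^sub>i\<close> therefore refers to the initial run of positive roots.\<close>

definition m_ind :: "nat \<Rightarrow> quiver \<Rightarrow> nat list \<Rightarrow> nat \<Rightarrow> nat" where
  "m_ind n Q w i = Max {k. \<forall>j\<le>k. (coxeter_element n w ^^ j) (eta n Q i) \<in> pos_roots n}"

type_synonym vertex = "nat \<times> int"

definition AR_vertices :: "nat \<Rightarrow> quiver \<Rightarrow> (nat \<Rightarrow> int) \<Rightarrow> nat list \<Rightarrow> vertex set" where
  "AR_vertices n Q \<xi> w = {(i, \<xi> i - 2 * int k) | i k. i \<in> {1..n} \<and> k \<le> m_ind n Q w i}"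

definition AR_arrows :: "nat \<Rightarrow> quiver \<Rightarrow> (nat \<Rightarrow> int) \<Rightarrow> nat list \<Rightarrow> (vertex \<times> vertex) set" where
  "AR_arrows n Q \<xi> w = {((i, p), (j, p + 1)) | i j p. {i, j} \<in> dynkin_edges n
      \<and> (i, p) \<in> AR_vertices n Q \<xi> w \<and> (j, p + 1) \<in> AR_vertices n Q \<xi> w}"

text \<open>The root identified with a vertex: \<open>(i, \<xi>\<^sub>i - 2k)\<close> corresponds to \<open>\<tau>\<^sup>k(\<eta>\<^sub>i)\<close>.\<close>

definition root_at :: "nat \<Rightarrow> quiver \<Rightarrow> (nat \<Rightarrow> int) \<Rightarrow> nat list \<Rightarrow> vertex \<Rightarrow> vect" where
  "root_at n Q \<xi> w =
     (\<lambda>(i, p). (coxeter_element n w ^^ nat ((\<xi> i - p) div 2)) (eta n Q i))"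

definition t_index :: "nat \<Rightarrow> (nat \<Rightarrow> int) \<Rightarrow> nat" where
  "t_index n \<xi> = (if \<bar>\<xi> (n - 1) - \<xi> n\<bar> = 2 then n - 1 else n)"

subsection \<open>Swings\<close>

definition S_arrows :: "nat \<Rightarrow> quiver \<Rightarrow> (nat \<Rightarrow> int) \<Rightarrow> nat list \<Rightarrow> (vertex \<times> vertex) set" where
  "S_arrows n Q \<xi> w = {((i, p), (j, q)) | i p j q. ((i, p), (j, q)) \<in> AR_arrows n Q \<xi> w
      \<and> (1 \<le> i \<and> i \<le> n - 2 \<and> j = i + 1 \<or> i = n - 2 \<and> j = n)}"

definition N_arrows :: "nat \<Rightarrow> quiver \<Rightarrow> (nat \<Rightarrow> int) \<Rightarrow> nat list \<Rightarrow> (vertex \<times> vertex) set" where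
  "N_arrows n Q \<xi> w = {((i, p), (j, q)) | i p j q. ((i, p), (j, q)) \<in> AR_arrows n Q \<xi> w
      \<and> (2 \<le> i \<and> i \<le> n - 1 \<and> j = i - 1 \<or> i = n \<and> j = n - 2)}"

text \<open>A subquiver is the pair of its vertex set and its arrow set.\<close>

type_synonym subquiver = "vertex set \<times> (vertex \<times> vertex) set"

text \<open>\<open>swing_with n Q \<xi> w r S u s N \<rho>\<close>: the subquiver \<open>\<rho>\<close> is the swing
  \<open>S r \<rightarrow> \<dots> \<rightarrow> S (n-2) \<rightarrow> {(n-1, u), (n, u)} \<rightarrow> N (n-2) \<rightarrow> \<dots> \<rightarrow> N s\<close>.\<close>

definition swing_with ::
    "nat \<Rightarrow> quiver \<Rightarrow> (nat \<Rightarrow> int) \<Rightarrow> nat list \<Rightarrow>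
     nat \<Rightarrow> (nat \<Rightarrow> vertex) \<Rightarrow> int \<Rightarrow> nat \<Rightarrow> (nat \<Rightarrow> vertex) \<Rightarrow> subquiver \<Rightarrow> bool" where
  "swing_with n Q \<xi> w r S u s N \<rho> \<longleftrightarrow>
     (let down = {(S l, S (l + 1)) | l. r \<le> l \<and> l < n - 2}
                 \<union> {(S (n - 2), (n - 1, u)), (S (n - 2), (n, u))};
          up   = {((n - 1, u), N (n - 2)), ((n, u), N (n - 2))}
                 \<union> {(N (l + 1), N l) | l. s \<le> l \<and> l < n - 2}
      in 1 \<le> r \<and> r \<le> n - 2 \<and> 1 \<le> s \<and> s \<le> n - 2 \<and>
         (\<forall>l\<in>{r..n - 2}. fst (S l) = l) \<and> (\<forall>l\<in>{s..n - 2}. fst (N l) = l) \<and>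
         down \<subseteq> S_arrows n Q \<xi> w \<and> up \<subseteq> N_arrows n Q \<xi> w \<and>
         \<rho> = (S ` {r..n - 2} \<union> {(n - 1, u), (n, u)} \<union> N ` {s..n - 2}, down \<union> up))"

definition is_swing :: "nat \<Rightarrow> quiver \<Rightarrow> (nat \<Rightarrow> int) \<Rightarrow> nat list \<Rightarrow> subquiver \<Rightarrow> bool" where
  "is_swing n Q \<xi> w \<rho> \<longleftrightarrow> (\<exists>r S u s N. swing_with n Q \<xi> w r S u s N \<rho>)"

definition maximal_swing :: "nat \<Rightarrow> quiver \<Rightarrow> (nat \<Rightarrow> int) \<Rightarrow> nat list \<Rightarrow> subquiver \<Rightarrow> bool" where
  "maximal_swing n Q \<xi> w \<rho> \<longleftrightarrow>
     is_swing n Q \<xi> w \<rho> \<and> \<not> (\<exists>\<rho>'. is_swing n Q \<xi> w \<rho>' \<and> fst \<rho> \<subset> fst \<rho>')"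

definition swing_roots ::
    "nat \<Rightarrow> quiver \<Rightarrow> (nat \<Rightarrow> int) \<Rightarrow> nat list \<Rightarrow> subquiver \<Rightarrow> vect set" where
  "swing_roots n Q \<xi> w \<rho> = root_at n Q \<xi> w ` fst \<rho>"

end

theory Submission
  imports Defs "Jordan_Normal_Form.Determinant"
begin

text \<open>Let \<open>\<tau>\<close> be the Coxeter element and \<open>t\<close> the index \<open>t_index n \<xi>\<close>. It maps \<open>\<epsilon>\<^sub>t\<close> to
\<open>-\<epsilon>\<^sub>t\<close> and permutes the other coordinate vectors, up to sign, in a single negative cycle of
length \<open>n - 1\<close>. There is thus a function \<open>g\<close> from the integers to signed coordinate vectors (and
zero, for the wrong parity) with \<open>\<tau> g(m) = g(m - 2)\<close> and \<open>g(m + 2n - 2) = -g(m)\<close>; below it is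
\<open>orbit n \<xi>\<close>. In terms of \<open>g\<close> the whole Auslander-Reiten quiver is explicit: a vertex \<open>(i, p)\<close> with
\<open>i \<le> n - 2\<close> carries the root \<open>g(p + i) - g(p - i)\<close>, and \<open>(n - 1, u)\<close>, \<open>(n, u)\<close> carry
\<open>g(u + n - 1) \<plusminus> \<epsilon>\<^sub>t\<close> in some order (\<open>root_trunk\<close>, \<open>roots_fork\<close>).

Along an S-sectional path \<open>p - i\<close> is constant and along an N-sectional path \<open>p + i\<close> is constant.
In a swing turning at height \<open>u\<close> these constants are \<open>u - (n - 1)\<close> and \<open>u + (n - 1)\<close>. They differ
by the antiperiod, so the first term of every root of the swing, or the second one negated, is the
vector \<open>g(u + n - 1)\<close>. It remains to see that it is some \<open>\<epsilon>\<^sub>k\<close> with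
\<open>k \<le> n - 2\<close>.

This is read off from the boundary of the quiver. On level \<open>i \<le> n - 2\<close> the heights \<open>p\<close>
run through \<open>\<xi> i, \<xi> i - 2, \<dots>, \<xi> i - 2(n - 2)\<close>. Going down from level \<open>n - 2\<close>, the S-branch can
only be stopped by the left boundary and the N-branch only by the right one, and either happens at
a level \<open>k\<close> at which \<open>g(u + n - 1) = \<epsilon>\<^sub>k\<close>, by the rule \<open>position\<close> that locates \<open>\<epsilon>\<^sub>k\<close> in the orbit.
The two branches cannot both be stopped above level 1, because positions are distinct
(\<open>maximal_swing_turning_point\<close>). The vertex where a branch stops is the extreme left or right vertex
of level \<open>k\<close>. On the right it carries \<open>\<eta>\<^sub>k\<close>, the dimension vector of \<open>I(k)\<close>
(\<open>is_dim_I_eta\<close>); on the left it carries that of \<open>P(k)\<close>, by the same computation for the opposite quiver, whose height function is \<open>-\<xi>\<close>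
(\<open>orbit_uminus\<close>). Finally \<open>\<epsilon>\<^sub>k - \<epsilon>\<^sub>k\<^sub>+\<^sub>1\<close> is found at one end of one branch, depending on the
direction of the arrow between \<open>k\<close> and \<open>k + 1\<close>, or at the fork if \<open>k + 1 = t\<close>.

The relation \<open>\<tau> g(m) = g(m - 2)\<close> is proved without multiplying out the reflections. If \<open>i\<close> is a
source, then lowering \<open>\<xi> i\<close> by 2 gives a height function of \<open>s\<^sub>i Q\<close>, and the function \<open>g\<close> of the
new height function is obtained from the old one by applying the reflection at \<open>i\<close>
(\<open>reflect_orbit\<close>). After all letters of an adapted word, \<open>\<xi>\<close> has dropped by 2 everywhere, which just
shifts \<open>m\<close> by 2.\<close>

section \<open>Positions along a path with unit steps\<close>

definition unit_steps :: "nat \<Rightarrow> (nat \<Rightarrow> int) \<Rightarrow> bool" where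
  "unit_steps N \<xi> \<longleftrightarrow> (\<forall>x. 1 \<le> x \<and> x < N \<longrightarrow> \<bar>\<xi> (Suc x) - \<xi> x\<bar> = 1)"

text \<open>The place of the coordinate vector \<open>\<epsilon>\<^sub>x\<close> in the orbit of the Coxeter element. It is the upper or
the lower end of the window \<open>[\<xi> x - x + 2, \<xi> x + x]\<close>, according as \<open>\<xi>\<close> rises or falls from
\<open>x - 1\<close> to \<open>x\<close>; for \<open>x = 1\<close> the two ends coincide.\<close>

definition position :: "(nat \<Rightarrow> int) \<Rightarrow> nat \<Rightarrow> int" where
  "position \<xi> x = (if x = 1 \<or> \<xi> x > \<xi> (x - 1) then \<xi> x + int x else \<xi> x - int x + 2)"

lemma unit_steps_lipschitz:
  assumes "unit_steps N \<xi>" "1 \<le> x" "x \<le> y" "y \<le> N"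
  shows "\<bar>\<xi> y - \<xi> x\<bar> \<le> int y - int x"
  using \<open>x \<le> y\<close> \<open>y \<le> N\<close>
proof (induction y rule: dec_induct)
  case (step y)
  have "\<bar>\<xi> (Suc y) - \<xi> y\<bar> = 1"
    using assms step unfolding unit_steps_def by auto
  then show ?case using step by linarith
qed simp

lemma unit_steps_parity:
  assumes "unit_steps N \<xi>" "1 \<le> x" "x \<le> N" "1 \<le> y" "y \<le> N"
  shows "even (\<xi> x + int x - (\<xi> y + int y))"
proof -
  have "even (\<xi> x + int x - (\<xi> 1 + 1))" if "1 \<le> x" "x \<le> N" for x
    using that
  proof (induction x rule: dec_induct)
    case (step x)
    have "\<bar>\<xi> (Suc x) - \<xi> x\<bar> = 1"
      using assms step unfolding unit_steps_def by auto
    then have "\<xi> (Suc x) = \<xi> x + 1 \<or> \<xi> (Suc x) = \<xi> x - 1" by linarith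
    then have "even (\<xi> (Suc x) + int (Suc x) - (\<xi> x + int x))" by auto
    then show ?case using step by presburger
  qed simp
  from this[OF assms(2,3)] this[OF assms(4,5)] show ?thesis by presburger
qed

lemma position_cases: "position \<xi> x = \<xi> x + int x \<or> position \<xi> x = \<xi> x - int x + 2"
  unfolding position_def by auto

lemma position_in_window:
  assumes "1 \<le> x"
  shows "\<xi> x - int x + 2 \<le> position \<xi> x" "position \<xi> x \<le> \<xi> x + int x"
  using assms unfolding position_def by auto

text \<open>The windows \<open>[\<xi> x - x + 2, \<xi> x + x]\<close> increase with \<open>x\<close>, and each step enlarges the window by one
admissible point, either at its upper or at its lower end. That new point is the position of \<open>x\<close>.
All statements about positions below rest on this picture: it gives injectivity, a bound on
distances, and it describes which positions lie in a given window.\<close>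

lemma position_outside_window:
  assumes "unit_steps N \<xi>" "1 \<le> x" "x < y" "y \<le> N"
  shows "position \<xi> y < \<xi> x - int x + 2 \<or> position \<xi> y > \<xi> x + int x"
proof -
  have "\<bar>\<xi> (Suc (y - 1)) - \<xi> (y - 1)\<bar> = 1"
  proof -
    have "1 \<le> y - 1" "y - 1 < N" using assms by auto
    then show ?thesis using assms(1) unfolding unit_steps_def by blast
  qed
  moreover have "\<bar>\<xi> (y - 1) - \<xi> x\<bar> \<le> int (y - 1) - int x"
    by (rule unit_steps_lipschitz[OF assms(1)]) (use assms in auto)
  ultimately show ?thesis using assms unfolding position_def by (auto simp: of_nat_diff)
qed

lemma position_window_iff:
  assumes "unit_steps N \<xi>" "1 \<le> x" "x \<le> N" "1 \<le> y" "y \<le> N"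
  shows "\<xi> x - int x + 2 \<le> position \<xi> y \<and> position \<xi> y \<le> \<xi> x + int x \<longleftrightarrow> y \<le> x"
proof (cases "y \<le> x")
  case True
  then show ?thesis
    using unit_steps_lipschitz[OF assms(1,4) True assms(3)] position_in_window[OF assms(4), of \<xi>] by auto
next
  case False
  then show ?thesis using position_outside_window[OF assms(1,2) _ assms(5)] by auto
qed

lemma position_inj:
  assumes "unit_steps N \<xi>" "1 \<le> x" "x \<le> N" "1 \<le> y" "y \<le> N" "position \<xi> x = position \<xi> y"
  shows "x = y"
  using position_window_iff[OF assms(1,2,3,4,5)] position_window_iff[OF assms(1,4,5,2,3)]
    position_in_window[OF assms(2), of \<xi>] position_in_window[OF assms(4), of \<xi>] assms(6) by auto

text \<open>The converse: a window contains \<open>x\<close> points of the right parity, one for each \<open>y \<le> x\<close>.\<close>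

lemma position_surj:
  assumes "unit_steps N \<xi>" "1 \<le> x" "x \<le> N"
    and "even (m - (\<xi> x + int x))" "\<xi> x - int x + 2 \<le> m" "m \<le> \<xi> x + int x"
  shows "\<exists>y. 1 \<le> y \<and> y \<le> x \<and> position \<xi> y = m"
  using assms(2-)
proof (induction x rule: dec_induct)
  case base
  then have "m = \<xi> 1 + 1" by auto
  then show ?case by (intro exI[of _ 1]) (auto simp: position_def)
next
  case (step x)
  have d: "\<bar>\<xi> (Suc x) - \<xi> x\<bar> = 1"
    using assms(1) step unfolding unit_steps_def by auto
  show ?case
  proof (cases "position \<xi> (Suc x) = m")
    case True
    then show ?thesis by (intro exI[of _ "Suc x"]) auto
  next
    case False
    have "even (m - (\<xi> x + int x))" 
      using step.prems(2) d by presburger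
    moreover have "\<xi> x - int x + 2 \<le> m \<and> m \<le> \<xi> x + int x"
    proof (cases "\<xi> (Suc x) > \<xi> x")
      case True
      then have "\<xi> (Suc x) = \<xi> x + 1" using d by linarith
      moreover have "position \<xi> (Suc x) = \<xi> x + int x + 2" using calculation step
        by (simp add: position_def)
      moreover have "m \<noteq> \<xi> x + int x + 1" using calculation step.prems(2) by auto
      ultimately show ?thesis using step False by auto
    next
      case False
      then have e: "\<xi> (Suc x) = \<xi> x - 1" using d by linarith
      have "position \<xi> (Suc x) = \<xi> x - int x" using e step(1) by (simp add: position_def)
      moreover have "m \<noteq> \<xi> x - int x + 1" using e step.prems(2) by auto
      ultimately show ?thesis using e step \<open>position \<xi> (Suc x) \<noteq> m\<close> by auto
    qed
    ultimately obtain y where "1 \<le> y" "y \<le> x" "position \<xi> y = m" using step by auto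
    then show ?thesis by auto
  qed
qed

lemma position_dist:
  assumes "unit_steps N \<xi>" "1 \<le> x" "x \<le> N" "1 \<le> y" "y \<le> N"
  shows "\<bar>position \<xi> x - position \<xi> y\<bar> < 2 * int N"
  using position_window_iff[OF assms(1) _ _ assms(2,3), of N] position_window_iff[OF assms(1) _ _ assms(4,5), of N]
    assms by auto

text \<open>The indicator of the multiples of \<open>h\<close>, with alternating signs.\<close>

definition antiperiodic_sign :: "int \<Rightarrow> int \<Rightarrow> real" where
  "antiperiodic_sign h d = (if h dvd d then (if even (d div h) then 1 else -1) else 0)"

lemma antiperiodic_sign_0 [simp]: "antiperiodic_sign h 0 = 1"
  by (simp add: antiperiodic_sign_def)

lemma antiperiodic_sign_small: "\<bar>d\<bar> < h \<Longrightarrow> d \<noteq> 0 \<Longrightarrow> antiperiodic_sign h d = 0"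
  using dvd_imp_le_int[of d h] by (auto simp: antiperiodic_sign_def)

lemma antiperiodic_sign_minus: "antiperiodic_sign h (- d) = antiperiodic_sign h d"
proof (cases "h dvd d")
  case True
  then obtain q where "d = h * q" by (elim dvdE)
  then show ?thesis
    using nonzero_mult_div_cancel_left[of h "- q"] by (cases "h = 0") (auto simp: antiperiodic_sign_def)
qed (auto simp: antiperiodic_sign_def)

lemma antiperiodic_sign_add: "h > 0 \<Longrightarrow> antiperiodic_sign h (d + h) = - antiperiodic_sign h d"
  by (auto simp: antiperiodic_sign_def)

section \<open>Height functions and simple reflections\<close>

definition heights :: "nat \<Rightarrow> (nat \<Rightarrow> int) \<Rightarrow> bool" where
  "heights n \<xi> \<longleftrightarrow> (\<forall>i j. {i, j} \<in> dynkin_edges n \<longrightarrow> \<bar>\<xi> j - \<xi> i\<bar> = 1)"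

text \<open>Of the two fork vertices only one matters for the positions. When \<open>\<xi> (n - 1) = \<xi> n\<close> the coordinate
missing from the orbit is \<open>n\<close>; otherwise it is \<open>n - 1\<close>, and the coordinate \<open>n\<close> of height \<open>\<xi> n\<close>
takes its slot on the path. Overwriting the value at \<open>n - 1\<close> by \<open>\<xi> n\<close> treats both cases at once.\<close>

definition trunk :: "nat \<Rightarrow> (nat \<Rightarrow> int) \<Rightarrow> nat \<Rightarrow> int" where
  "trunk n \<xi> = \<xi>(n - 1 := \<xi> n)"

text \<open>The vector \<open>g(m)\<close>: it is \<open>\<epsilon>\<^sub>c\<close> when \<open>m\<close> is the position of \<open>c\<close>, and it changes sign whenever \<open>m\<close>
moves by the Coxeter number \<open>2n - 2\<close>. Both fork coordinates are sent to the slot \<open>n - 1\<close>; one of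
them is \<open>t_index n \<xi>\<close>, which does not occur in the orbit.\<close>

definition orbit :: "nat \<Rightarrow> (nat \<Rightarrow> int) \<Rightarrow> int \<Rightarrow> vect" where
  "orbit n \<xi> m = (\<lambda>c. if 1 \<le> c \<and> c \<le> n \<and> c \<noteq> t_index n \<xi>
     then antiperiodic_sign (2 * int n - 2) (m - position (trunk n \<xi>) (min c (n - 1))) else 0)"

lemma edge_iff:
  assumes "n \<ge> 4"
  shows "{i, j} \<in> dynkin_edges n \<longleftrightarrow>
    (1 \<le> i \<and> i \<le> n - 2 \<and> j = i + 1) \<or> (1 \<le> j \<and> j \<le> n - 2 \<and> i = j + 1)
    \<or> (i = n - 2 \<and> j = n) \<or> (i = n \<and> j = n - 2)"
  using assms unfolding dynkin_edges_def by (auto simp: doubleton_eq_iff)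

lemma heights_step:
  assumes "n \<ge> 4" "heights n \<xi>" "1 \<le> i" "i \<le> n - 2"
  shows "\<bar>\<xi> (Suc i) - \<xi> i\<bar> = 1"
  using assms edge_iff[of n i "Suc i"] unfolding heights_def by auto

lemma heights_fork:
  assumes "n \<ge> 4" "heights n \<xi>"
  shows "\<bar>\<xi> n - \<xi> (n - 2)\<bar> = 1" "\<bar>\<xi> (n - 1) - \<xi> (n - 2)\<bar> = 1"
  using assms edge_iff[of n "n - 2" n] edge_iff[of n "n - 2" "n - 1"]
  unfolding heights_def by auto

lemma heights_unit_steps:
  assumes "n \<ge> 4" "heights n \<xi>"
  shows "unit_steps (n - 1) \<xi>"
  using heights_step[OF assms] unfolding unit_steps_def by auto

lemma trunk_unit_steps:
  assumes "n \<ge> 4" "heights n \<xi>"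
  shows "unit_steps (n - 1) (trunk n \<xi>)"
  unfolding unit_steps_def
proof (intro allI impI, elim conjE)
  fix x assume x: "1 \<le> x" "x < n - 1"
  have "Suc x = n - 1 \<longleftrightarrow> x = n - 2" using assms x by auto
  then show "\<bar>trunk n \<xi> (Suc x) - trunk n \<xi> x\<bar> = 1"
    using heights_step[OF assms x(1)] heights_fork(1)[OF assms] x unfolding trunk_def
    by (cases "x = n - 2") auto
qed

lemma t_index_cases:
  assumes "n \<ge> 4" "heights n \<xi>"
  shows "(t_index n \<xi> = n - 1 \<and> \<bar>\<xi> (n - 1) - \<xi> n\<bar> = 2) \<or> (t_index n \<xi> = n \<and> \<xi> (n - 1) = \<xi> n)"
proof -
  have "\<bar>\<xi> (n - 1) - \<xi> n\<bar> = 2 \<or> \<xi> (n - 1) = \<xi> n"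
    using heights_fork[OF assms] by linarith
  then show ?thesis unfolding t_index_def by (elim disjE) simp_all
qed

lemma orbit_trunk:
  assumes "n \<ge> 4" "heights n \<xi>" "1 \<le> c" "c \<le> n - 2"
  shows "orbit n \<xi> m c = antiperiodic_sign (2 * int n - 2) (m - position (trunk n \<xi>) c)"
proof -
  have "c \<noteq> n - 1" "c \<noteq> n" "c \<le> n - 1" "c \<le> n" using assms(1,4) by simp_all
  then have "c \<noteq> t_index n \<xi>" using t_index_cases[OF assms(1,2)] by metis
  then show ?thesis using \<open>c \<le> n - 1\<close> \<open>c \<le> n\<close> assms(3)
    by (simp add: orbit_def min_absorb1)
qed

lemma orbit_fork:
  assumes "n \<ge> 4" "c = n - 1 \<or> c = n"
  shows "orbit n \<xi> m c =
    (if c = t_index n \<xi> then 0 else antiperiodic_sign (2 * int n - 2) (m - position (trunk n \<xi>) (n - 1)))"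
  using assms by (auto simp: orbit_def)

lemma orbit_outside: "c = 0 \<or> c > n \<Longrightarrow> orbit n \<xi> m c = 0"
  by (auto simp: orbit_def)

lemma orbit_fork_eq:
  assumes "n \<ge> 4" "heights n \<xi>"
  shows "orbit n \<xi> m n = (if t_index n \<xi> = n then 0
      else antiperiodic_sign (2 * int n - 2) (m - position (trunk n \<xi>) (n - 1)))"
    and "orbit n \<xi> m (n - 1) = (if t_index n \<xi> = n
      then antiperiodic_sign (2 * int n - 2) (m - position (trunk n \<xi>) (n - 1)) else 0)"
proof -
  have "n - 1 \<noteq> n" using assms by simp
  then show "orbit n \<xi> m n = (if t_index n \<xi> = n then 0
      else antiperiodic_sign (2 * int n - 2) (m - position (trunk n \<xi>) (n - 1)))"
    and "orbit n \<xi> m (n - 1) = (if t_index n \<xi> = n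
      then antiperiodic_sign (2 * int n - 2) (m - position (trunk n \<xi>) (n - 1)) else 0)"
    using t_index_cases[OF assms] by (metis orbit_fork[OF assms(1)])+
qed

lemma coordinate_cases [case_names trunk fork1 fork2 outside]:
  fixes c n :: nat
  obtains "1 \<le> c" "c \<le> n - 2" | "c = n - 1" | "c = n" | "c = 0 \<or> c > n"
  by linarith

lemma simple_reflection_swap:
  assumes "1 \<le> i" "i < n"
  shows "simple_reflection n i v = v(i := v (Suc i), Suc i := v i)"
proof -
  have *: "(\<Sum>x\<in>{1..n}. f x) = f i + f (Suc i)"
    if "\<And>x. x \<noteq> i \<Longrightarrow> x \<noteq> Suc i \<Longrightarrow> f x = 0" for f :: "nat \<Rightarrow> real"
  proof -
    have "(\<Sum>x\<in>{1..n}. f x) = (\<Sum>x\<in>{i, Suc i}. f x)"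
      by (rule sum.mono_neutral_right) (use that assms in auto)
    then show ?thesis by simp
  qed
  have "simple_root n i = (\<lambda>x. if x = i then 1 else if x = Suc i then -1 else 0)"
    using assms by (auto simp: simple_root_def eps_def fun_eq_iff)
  then show ?thesis
    unfolding simple_reflection_def inner_prod_def Let_def
      by (subst (1 2) *) (auto simp: fun_eq_iff field_simps)
qed

lemma simple_reflection_last:
  assumes "n \<ge> 4"
  shows "simple_reflection n n v = v(n - 1 := - v n, n := - v (n - 1))"
proof -
  have *: "(\<Sum>x\<in>{1..n}. f x) = f (n - 1) + f n"
    if "\<And>x. x \<noteq> n - 1 \<Longrightarrow> x \<noteq> n \<Longrightarrow> f x = 0" for f :: "nat \<Rightarrow> real"
  proof -
    have "(\<Sum>x\<in>{1..n}. f x) = (\<Sum>x\<in>{n - 1, n}. f x)"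
      by (rule sum.mono_neutral_right) (use that assms in auto)
    then show ?thesis using assms by simp
  qed
  have "simple_root n n = (\<lambda>x. if x = n - 1 then 1 else if x = n then 1 else 0)"
    using assms by (auto simp: simple_root_def eps_def fun_eq_iff)
  then show ?thesis
    unfolding simple_reflection_def inner_prod_def Let_def using assms
      by (subst (1 2) *) (auto simp: fun_eq_iff field_simps)
qed

lemma simple_reflection_involutive:
  assumes "n \<ge> 4" "1 \<le> i" "i \<le> n"
  shows "simple_reflection n i (simple_reflection n i v) = v"
proof (cases "i = n")
  case True
  then show ?thesis using assms by (auto simp: simple_reflection_last)
next
  case False
  then show ?thesis using assms by (auto simp: simple_reflection_swap)
qed

lemma simple_reflection_diff:
  "simple_reflection n i (v - w) = simple_reflection n i v - simple_reflection n i w"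
proof -
  have "inner_prod n (v - w) a = inner_prod n v a - inner_prod n w a" for a
    by (simp add: inner_prod_def sum_subtractf left_diff_distrib)
  then show ?thesis
    unfolding simple_reflection_def Let_def
    by (simp only:) (simp add: fun_eq_iff algebra_simps diff_divide_distrib)
qed

lemma simple_reflection_scale:
  "simple_reflection n i (\<lambda>x. c * v x) = (\<lambda>x. c * simple_reflection n i v x)"
proof -
  have "inner_prod n (\<lambda>x. c * v x) a = c * inner_prod n v a" for a
    by (simp add: inner_prod_def sum_distrib_left mult.assoc)
  then show ?thesis
    by (simp add: simple_reflection_def Let_def fun_eq_iff algebra_simps)
qed

text \<open>A source of the quiver, seen from the height function.\<close>

definition local_peak :: "nat \<Rightarrow> nat \<Rightarrow> (nat \<Rightarrow> int) \<Rightarrow> bool" where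
  "local_peak n i \<xi> \<longleftrightarrow> 1 \<le> i \<and> i \<le> n \<and> (\<forall>j. {i, j} \<in> dynkin_edges n \<longrightarrow> \<xi> j = \<xi> i - 1)"

lemma local_peakD:
  assumes n: "n \<ge> 4" and d: "local_peak n i \<xi>"
  shows "i \<le> n - 2 \<Longrightarrow> \<xi> (Suc i) = \<xi> i - 1"
    and "2 \<le> i \<Longrightarrow> i \<le> n - 1 \<Longrightarrow> \<xi> (i - 1) = \<xi> i - 1"
    and "i = n - 2 \<Longrightarrow> \<xi> n = \<xi> i - 1"
    and "i = n \<Longrightarrow> \<xi> (n - 2) = \<xi> i - 1"
proof -
  have i: "1 \<le> i" and e: "\<And>j. {i, j} \<in> dynkin_edges n \<Longrightarrow> \<xi> j = \<xi> i - 1"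
    using d unfolding local_peak_def by auto
  show "\<xi> (Suc i) = \<xi> i - 1" if "i \<le> n - 2"
    by (rule e) (use that i edge_iff[OF n] in simp)
  show "\<xi> (i - 1) = \<xi> i - 1" if "2 \<le> i" "i \<le> n - 1"
  proof (rule e)
    have "i = i - 1 + 1" "i - 1 \<le> n - 2" "1 \<le> i - 1" using that by linarith+
    then show "{i, i - 1} \<in> dynkin_edges n" using edge_iff[OF n] by blast
  qed
  show "\<xi> n = \<xi> i - 1" if "i = n - 2"
    by (rule e) (use that edge_iff[OF n] in simp)
  show "\<xi> (n - 2) = \<xi> i - 1" if "i = n"
    by (rule e) (use that edge_iff[OF n] in simp)
qed

lemma heights_lower_peak:
  assumes n: "n \<ge> 4" and "heights n \<xi>" and "local_peak n i \<xi>"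
  shows "heights n (\<xi>(i := \<xi> i - 2))"
proof -
  have "\<bar>(\<xi>(i := \<xi> i - 2)) b - (\<xi>(i := \<xi> i - 2)) a\<bar> = 1"
    if "{a, b} \<in> dynkin_edges n" for a b
  proof -
    have "a \<noteq> b" using that edge_iff[OF n] n by auto
    moreover have "\<bar>\<xi> b - \<xi> a\<bar> = 1" using assms(2) that unfolding heights_def by blast
    moreover have "\<xi> b = \<xi> a - 1" if "a = i"
      using assms(3) that \<open>{a, b} \<in> _\<close> unfolding local_peak_def by blast
    moreover have "\<xi> a = \<xi> b - 1" if "b = i"
      using assms(3) that \<open>{a, b} \<in> _\<close> unfolding local_peak_def by (metis insert_commute)
    ultimately show ?thesis by auto
  qed
  then show ?thesis unfolding heights_def by blast
qed

text \<open>At a fork vertex that is a source, \<open>\<xi> (n - 1)\<close> and \<open>\<xi> n\<close> are equal or differ by 2, and lowering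
the source interchanges the two situations.\<close>

lemma t_index_toggle:
  assumes n: "n \<ge> 4" and h: "heights n \<xi>" and d: "local_peak n i \<xi>" and i: "i = n - 1 \<or> i = n"
  shows "t_index n (\<xi>(i := \<xi> i - 2)) = (if t_index n \<xi> = n then n - 1 else n)"
proof -
  have "\<xi> (n - 2) = \<xi> i - 1"
    using local_peakD(2,4)[OF n d] i n by (auto simp: numeral_2_eq_2)
  then have "\<xi> (n - 1) = \<xi> n \<or> (i = n \<and> \<xi> (n - 1) = \<xi> n - 2) \<or> (i = n - 1 \<and> \<xi> n = \<xi> (n - 1) - 2)"
  proof -
    have f: "\<xi> n = \<xi> (n - 2) + 1 \<or> \<xi> n = \<xi> (n - 2) - 1"
      "\<xi> (n - 1) = \<xi> (n - 2) + 1 \<or> \<xi> (n - 1) = \<xi> (n - 2) - 1"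
      using heights_fork[OF n h] by linarith+
    assume "\<xi> (n - 2) = \<xi> i - 1"
    then show ?thesis using i f by (elim disjE) simp_all
  qed
  moreover have "n - 1 \<noteq> n" using n by simp
  ultimately show ?thesis using i by (elim disjE conjE) (simp_all add: t_index_def)
qed

text \<open>At a local peak on the trunk the position of \<open>i\<close> is \<open>\<xi> i + i\<close> and that of \<open>i + 1\<close>
is \<open>\<xi> i - i\<close>. Lowering the peak interchanges them, which is what the reflection does to the
coordinates. For \<open>i = n - 2\<close> both fork vertices lie below the peak, so the coordinate \<open>n\<close> is the
missing one.\<close>

lemma reflect_orbit_trunk:
  assumes n: "n \<ge> 4" and h: "heights n \<xi>" and i: "1 \<le> i" "i \<le> n - 2"
    and d: "local_peak n i \<xi>"
  shows "simple_reflection n i (orbit n \<xi> m) = orbit n (\<xi>(i := \<xi> i - 2)) m"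
proof -
  let ?\<xi> = "\<xi>(i := \<xi> i - 2)"
  have tr: "trunk n ?\<xi> = (trunk n \<xi>)(i := trunk n \<xi> i - 2)"
    using i n by (auto simp: trunk_def)
  have "n \<noteq> i" "n - 1 \<noteq> i" using i n by linarith+
  then have t: "t_index n ?\<xi> = t_index n \<xi>"
    by (simp add: t_index_def del: One_nat_def)
  have up: "trunk n \<xi> (Suc i) = trunk n \<xi> i - 1"
  proof (cases "i = n - 2")
    case True
    then have "Suc i = n - 1" using n by linarith
    then show ?thesis using local_peakD(3)[OF n d True] True n by (simp add: trunk_def)
  next
    case False
    then have "Suc i \<noteq> n - 1" "i \<noteq> n - 1" using n i by linarith+
    then show ?thesis using local_peakD(1)[OF n d i(2)] by (simp add: trunk_def)
  qed
  have down: "i = 1 \<or> trunk n \<xi> (i - 1) = trunk n \<xi> i - 1"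
    using local_peakD(2)[OF n d] i n unfolding trunk_def by (cases "i = 1") auto
  have tn: "Suc i \<noteq> t_index n \<xi>" "i \<noteq> t_index n \<xi>"
  proof -
    have "Suc i = n - 1 \<longleftrightarrow> i = n - 2" using n i by auto
    then show "Suc i \<noteq> t_index n \<xi>"
      using t_index_cases[OF n h] i local_peakD(1,3)[OF n d] n by (cases "i = n - 2") auto
    show "i \<noteq> t_index n \<xi>" using t_index_cases[OF n h] i n by auto
  qed
  have i': "i < n" "Suc i \<le> n - 1" "i \<le> n - 1" "n - 1 \<noteq> i" using n i by linarith+
  have pi: "position (trunk n ?\<xi>) i = position (trunk n \<xi>) (Suc i)"
    using i down up unfolding tr position_def by auto
  have ps: "position (trunk n ?\<xi>) (Suc i) = position (trunk n \<xi>) i"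
    using i down up unfolding tr position_def by auto
  have po: "position (trunk n ?\<xi>) x = position (trunk n \<xi>) x"
    if "x \<noteq> i" "x \<noteq> Suc i" for x
    using that unfolding tr position_def by auto
  show ?thesis
  proof
    fix c
    consider "c = i" | "c = Suc i" | "c \<noteq> i" "c \<noteq> Suc i" by auto
    then show "simple_reflection n i (orbit n \<xi> m) c = orbit n ?\<xi> m c"
    proof cases
      case 3
      have "simple_reflection n i (orbit n \<xi> m) c = orbit n \<xi> m c"
        using 3 by (simp add: simple_reflection_swap[OF i(1) i'(1)])
      also have "\<dots> = orbit n ?\<xi> m c"
      proof (cases "c \<le> n - 2")
        case True
        then have "min c (n - 1) = c" using n by linarith
        then show ?thesis using po 3 by (simp add: orbit_def t)
      next
        case False
        then have c: "c = n - 1 \<or> c = n \<or> c > n" by linarith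
        show ?thesis
        proof (cases "n - 1 = Suc i")
          case True
          then show ?thesis using c 3 tn(1) t_index_cases[OF n h] by (auto simp: orbit_def t)
        next
          case False
          then have "position (trunk n ?\<xi>) (n - 1) = position (trunk n \<xi>) (n - 1)"
            using po i' by metis
          moreover have "min c (n - 1) = n - 1" using c by linarith
          ultimately show ?thesis by (simp add: orbit_def t)
        qed
      qed
      finally show ?thesis .
    next
      case 1
      then show ?thesis
        using i tn i' pi by (simp add: simple_reflection_swap[OF i(1) i'(1)] orbit_def min_absorb1 t del: One_nat_def)
    next
      case 2
      then show ?thesis
        using i tn i' ps by (simp add: simple_reflection_swap[OF i(1) i'(1)] orbit_def min_absorb1 t del: One_nat_def)
    qed
  qed
qed

text \<open>Lowering \<open>\<xi> (n - 1)\<close> leaves all positions unchanged and only renames the coordinate in the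
last slot.\<close>

lemma reflect_orbit_fork1:
  assumes n: "n \<ge> 4" and h: "heights n \<xi>" and d: "local_peak n (n - 1) \<xi>"
  shows "simple_reflection n (n - 1) (orbit n \<xi> m) = orbit n (\<xi>(n - 1 := \<xi> (n - 1) - 2)) m"
proof -
  let ?\<xi> = "\<xi>(n - 1 := \<xi> (n - 1) - 2)"
  have tr: "trunk n ?\<xi> = trunk n \<xi>"
    using n by (auto simp: trunk_def)
  have t: "t_index n ?\<xi> = (if t_index n \<xi> = n then n - 1 else n)"
    by (rule t_index_toggle[OF n h d]) simp
  have h': "heights n ?\<xi>" by (rule heights_lower_peak[OF n h d])
  have sn: "Suc (n - 1) = n" "n - 1 \<noteq> n" "1 \<le> n - 1" "n - 1 < n" using n by auto
  show ?thesis
  proof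
    fix c
    show "simple_reflection n (n - 1) (orbit n \<xi> m) c = orbit n ?\<xi> m c"
    proof (cases c n rule: coordinate_cases)
      case trunk
      then have "c \<noteq> n" "c \<noteq> n - 1" using n by auto
      then show ?thesis using trunk
        by (simp add: simple_reflection_swap[OF sn(3,4)] sn(1) orbit_trunk[OF n h] orbit_trunk[OF n h'] tr
          del: One_nat_def)
    next
      case fork1
      then show ?thesis
        by (simp add: fork1 simple_reflection_swap[OF sn(3,4)] sn orbit_fork_eq[OF n h] orbit_fork_eq[OF n h'] tr t
            del: One_nat_def)
    next
      case fork2
      then show ?thesis
        by (simp add: fork2 simple_reflection_swap[OF sn(3,4)] sn orbit_fork_eq[OF n h] orbit_fork_eq[OF n h'] tr t
            del: One_nat_def)
    next
      case outside
      then show ?thesis using n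
        by (auto simp: simple_reflection_swap[OF sn(3,4)] orbit_outside simp del: One_nat_def)
    qed
  qed
qed

text \<open>Lowering \<open>\<xi> n\<close> moves the last position from the top of the last window to the bottom of the
new one, that is, by one antiperiod. This produces the sign in the reflection at \<open>n\<close>.\<close>

lemma reflect_orbit_fork2:
  assumes n: "n \<ge> 4" and h: "heights n \<xi>" and d: "local_peak n n \<xi>"
  shows "simple_reflection n n (orbit n \<xi> m) = orbit n (\<xi>(n := \<xi> n - 2)) m"
proof -
  let ?\<xi> = "\<xi>(n := \<xi> n - 2)" and ?h = "2 * int n - 2"
  have "n - 1 \<noteq> n" using n by linarith
  then have tr: "trunk n ?\<xi> = (trunk n \<xi>)(n - 1 := trunk n \<xi> (n - 1) - 2, n := \<xi> n - 2)"
    by (simp add: trunk_def fun_eq_iff del: One_nat_def)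
  have e: "\<xi> (n - 2) = \<xi> n - 1"
    using local_peakD(4)[OF n d] by simp
  have t: "t_index n ?\<xi> = (if t_index n \<xi> = n then n - 1 else n)"
    by (rule t_index_toggle[OF n h d]) simp
  have pl: "position (trunk n ?\<xi>) (n - 1) = position (trunk n \<xi>) (n - 1) - ?h"
  proof -
    have "n - 1 - 1 = n - 2" "n - 2 \<noteq> n - 1" "n - 1 \<noteq> n" "n - 1 \<noteq> 1" "int (n - 1) = int n - 1"
      using n by linarith+
    then show ?thesis using e unfolding position_def trunk_def by (simp del: One_nat_def)
  qed
  have "?h > 0" using n by simp
  moreover have "m - (position (trunk n \<xi>) (n - 1) - ?h) = m - position (trunk n \<xi>) (n - 1) + ?h" by simp
  ultimately have al: "antiperiodic_sign ?h (m - position (trunk n ?\<xi>) (n - 1)) = - antiperiodic_sign ?h (m - position (trunk n \<xi>) (n - 1))"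
    unfolding pl by (simp only: antiperiodic_sign_add)
  have po: "position (trunk n ?\<xi>) x = position (trunk n \<xi>) x" if "x < n - 1" for x
  proof -
    have "x \<noteq> n - 1" "x \<noteq> n" "x - 1 \<noteq> n - 1" "x - 1 \<noteq> n" using that n by linarith+
    then show ?thesis unfolding tr position_def by (simp del: One_nat_def)
  qed
  have h': "heights n ?\<xi>" by (rule heights_lower_peak[OF n h d])
  show ?thesis
  proof
    fix c
    show "simple_reflection n n (orbit n \<xi> m) c = orbit n ?\<xi> m c"
    proof (cases c n rule: coordinate_cases)
      case trunk
      then have "c < n - 1" "c \<noteq> n" "c \<noteq> n - 1" using n by auto
      then show ?thesis using trunk po
        by (simp add: simple_reflection_last[OF n] orbit_trunk[OF n h] orbit_trunk[OF n h'])
    next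
      case fork1
      have "n - 1 \<noteq> n" using n by simp
      then show ?thesis
        by (simp add: fork1 simple_reflection_last[OF n] orbit_fork_eq[OF n h] orbit_fork_eq[OF n h'] al t
            del: One_nat_def)
    next
      case fork2
      have "n - 1 \<noteq> n" using n by simp
      then show ?thesis
        by (simp add: fork2 simple_reflection_last[OF n] orbit_fork_eq[OF n h] orbit_fork_eq[OF n h'] al t
            del: One_nat_def)
    next
      case outside
      then show ?thesis using n
        by (auto simp: simple_reflection_last[OF n] orbit_outside)
    qed
  qed
qed

text \<open>The orbit vectors are natural under reflections at sources. Iterating this along an adapted
word determines the Coxeter element.\<close>

lemma reflect_orbit:
  assumes n: "n \<ge> 4" and h: "heights n \<xi>" and d: "local_peak n i \<xi>"
  shows "simple_reflection n i (orbit n \<xi> m) = orbit n (\<xi>(i := \<xi> i - 2)) m"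
proof -
  consider "i \<le> n - 2" | "i = n - 1" | "i = n" using d unfolding local_peak_def by linarith
  then show ?thesis
  proof cases
    case 1
    then show ?thesis using reflect_orbit_trunk[OF n h _ _ d] d unfolding local_peak_def by blast
  next
    case 2
    then show ?thesis using reflect_orbit_fork1[OF n h] d by blast
  next
    case 3
    then show ?thesis using reflect_orbit_fork2[OF n h] d by blast
  qed
qed

lemma reflect_eps_t:
  assumes n: "n \<ge> 4" and h: "heights n \<xi>" and d: "local_peak n i \<xi>"
  shows "simple_reflection n i (eps (t_index n \<xi>))
    = (\<lambda>x. (if i = n then -1 else 1) * eps (t_index n (\<xi>(i := \<xi> i - 2))) x)"
proof -
  define t t' where "t = t_index n \<xi>" and "t' = t_index n (\<xi>(i := \<xi> i - 2))"
  have tt: "t = n \<or> t = n - 1"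
    using t_index_cases[OF n h] unfolding t_def by auto
  have i: "1 \<le> i" using d unfolding local_peak_def by auto
  consider "i \<le> n - 2" | "i = n - 1" | "i = n" using d unfolding local_peak_def by linarith
  then have "simple_reflection n i (eps t) = (\<lambda>x. (if i = n then -1 else 1) * eps t' x)"
  proof cases
    case 1
    have "n \<noteq> i" "n - 1 \<noteq> i" using 1 n by linarith+
    then have "t' = t"
      by (simp add: t_index_def t_def t'_def del: One_nat_def)
    moreover have "Suc i = n - 1 \<longleftrightarrow> i = n - 2" using n i by auto
    then have "Suc i \<noteq> t"
      using t_index_cases[OF n h] 1 local_peakD(1,3)[OF n d] n unfolding t_def by (cases "i = n - 2") auto
    moreover have "i \<noteq> t" "i \<noteq> n" "i < n" using tt 1 n by auto
    ultimately show ?thesis using i by (auto simp: simple_reflection_swap eps_def fun_eq_iff)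
  next
    case 2
    have "t' = (if t = n then n - 1 else n)"
      unfolding t_def t'_def by (rule t_index_toggle[OF n h d]) (simp add: 2)
    moreover have sn: "Suc (n - 1) = n" "n - 1 \<noteq> n" "1 \<le> n - 1" "n - 1 < n" using n by auto
    ultimately show ?thesis using tt
      by (elim disjE)
        (simp_all add: 2 simple_reflection_swap[OF sn(3,4)] sn eps_def fun_eq_iff del: One_nat_def)
  next
    case 3
    have "t' = (if t = n then n - 1 else n)"
      unfolding t_def t'_def by (rule t_index_toggle[OF n h d]) (simp add: 3)
    moreover have "n - 1 \<noteq> n" using n by auto
    ultimately show ?thesis using tt
      by (elim disjE)
        (simp_all add: 3 simple_reflection_last[OF n] eps_def fun_eq_iff del: One_nat_def)
  qed
  then show ?thesis unfolding t_def t'_def .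
qed

section \<open>The Coxeter element on orbit vectors\<close>

definition quiver_of :: "nat \<Rightarrow> (nat \<Rightarrow> int) \<Rightarrow> quiver" where
  "quiver_of n \<xi> = {(i, j). {i, j} \<in> dynkin_edges n \<and> \<xi> j = \<xi> i - 1}"

lemma dynkin_quiver_heights:
  assumes "dynkin_quiver n Q" "height_function Q \<xi>"
  shows "heights n \<xi>" "Q = quiver_of n \<xi>"
proof -
  have e: "{i, j} \<in> dynkin_edges n" if "(i, j) \<in> Q" for i j
    using assms(1) that unfolding dynkin_quiver_def by auto
  have h: "\<xi> j = \<xi> i - 1" if "(i, j) \<in> Q" for i j
    using assms(2) that unfolding height_function_def by auto
  have o: "(i, j) \<in> Q \<or> (j, i) \<in> Q" if "{i, j} \<in> dynkin_edges n" for i j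
    using assms(1) that unfolding dynkin_quiver_def by auto
  show "heights n \<xi>"
    unfolding heights_def using o h by fastforce
  show "Q = quiver_of n \<xi>"
  proof -
    have "(i, j) \<in> Q" if "{i, j} \<in> dynkin_edges n" "\<xi> j = \<xi> i - 1" for i j
      using o[OF that(1)] h[of j i] that(2) by auto
    then show ?thesis unfolding quiver_of_def using e h by auto
  qed
qed

lemma source_local_peak:
  assumes "heights n \<xi>" "is_source i (quiver_of n \<xi>)" "1 \<le> i" "i \<le> n"
  shows "local_peak n i \<xi>"
  unfolding local_peak_def
proof (intro conjI allI impI)
  fix j assume e: "{i, j} \<in> dynkin_edges n"
  have "\<bar>\<xi> j - \<xi> i\<bar> = 1" using assms(1) e unfolding heights_def by blast
  moreover have "\<xi> i \<noteq> \<xi> j - 1"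
    using assms(2) e unfolding is_source_def quiver_of_def by (auto simp: insert_commute)
  ultimately show "\<xi> j = \<xi> i - 1" by linarith
qed (use assms in auto)

lemma reverse_at_quiver_of:
  assumes n: "n \<ge> 4" and d: "local_peak n i \<xi>"
  shows "reverse_at i (quiver_of n \<xi>) = quiver_of n (\<xi>(i := \<xi> i - 2))"
proof -
  have ne: "a \<noteq> b" if "{a, b} \<in> dynkin_edges n" for a b
    using that edge_iff[OF n] n by auto
  have 1: "\<xi> b = \<xi> i - 1" if "{i, b} \<in> dynkin_edges n" for b
    using d that unfolding local_peak_def by blast
  have "(a, b) \<in> reverse_at i (quiver_of n \<xi>) \<longleftrightarrow> (a, b) \<in> quiver_of n (\<xi>(i := \<xi> i - 2))" for a b
  proof (cases "{a, b} \<in> dynkin_edges n")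
    case True
    then have T: "{b, a} \<in> dynkin_edges n" by (simp add: insert_commute)
    consider "a = i" | "b = i" | "a \<noteq> i" "b \<noteq> i" by blast
    then show ?thesis
    proof cases
      case 1
      then have "b \<noteq> i" "\<xi> b = \<xi> i - 1"
        using ne[OF True] \<open>\<And>b. {i, b} \<in> dynkin_edges n \<Longrightarrow> \<xi> b = \<xi> i - 1\<close> True by auto
      then show ?thesis using 1 T True by (simp add: reverse_at_def quiver_of_def)
    next
      case 2
      then have "a \<noteq> i" "\<xi> a = \<xi> i - 1"
        using ne[OF True] \<open>\<And>b. {i, b} \<in> dynkin_edges n \<Longrightarrow> \<xi> b = \<xi> i - 1\<close> T by auto
      then show ?thesis using 2 T True by (simp add: reverse_at_def quiver_of_def)
    next
      case 3
      then show ?thesis by (simp add: reverse_at_def quiver_of_def)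
    qed
  next
    case False
    then have "{b, a} \<notin> dynkin_edges n" by (simp add: insert_commute)
    then show ?thesis using False by (simp add: reverse_at_def quiver_of_def)
  qed
  then show ?thesis by auto
qed

lemma fold_reflection_scale:
  "fold (simple_reflection n) w (\<lambda>x. c * v x) = (\<lambda>x. c * fold (simple_reflection n) w v x)"
  by (induction w arbitrary: v) (auto simp: simple_reflection_scale)

text \<open>Along an adapted word every letter is a local peak of the current height function. The vector
\<open>\<epsilon>\<^sub>t\<close> picks up its sign at the single letter \<open>n\<close>.\<close>

lemma fold_reflections:
  assumes n: "n \<ge> 4" and "heights n \<xi>" and "distinct w" and "set w \<subseteq> {1..n}"
    and "\<forall>k<length w. is_source (w ! k) (fold reverse_at (take k w) (quiver_of n \<xi>))"
  defines "\<xi>' \<equiv> \<lambda>i. if i \<in> set w then \<xi> i - 2 else \<xi> i"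
  shows "fold (simple_reflection n) w (orbit n \<xi> m) = orbit n \<xi>' m"
    and "fold (simple_reflection n) w (eps (t_index n \<xi>))
      = (\<lambda>x. (if n \<in> set w then -1 else 1) * eps (t_index n \<xi>') x)"
proof -
  have "fold (simple_reflection n) w (orbit n \<xi> m) = orbit n (\<lambda>i. if i \<in> set w then \<xi> i - 2 else \<xi> i) m \<and>
    fold (simple_reflection n) w (eps (t_index n \<xi>))
      = (\<lambda>x. (if n \<in> set w then -1 else 1) * eps (t_index n (\<lambda>i. if i \<in> set w then \<xi> i - 2 else \<xi> i)) x)"
    using assms(2-5)
  proof (induction w arbitrary: \<xi>)
    case (Cons i w)
    have "is_source i (quiver_of n \<xi>)" using Cons.prems(4) by (auto dest: spec[of _ 0])
    then have d: "local_peak n i \<xi>"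
      using source_local_peak Cons.prems by auto
    let ?\<xi> = "\<xi>(i := \<xi> i - 2)"
    have "\<forall>k<length w. is_source (w ! k) (fold reverse_at (take k w) (quiver_of n ?\<xi>))"
    proof (intro allI impI)
      fix k assume "k < length w"
      then show "is_source (w ! k) (fold reverse_at (take k w) (quiver_of n ?\<xi>))"
        using Cons.prems(4)[rule_format, of "Suc k"] by (simp add: reverse_at_quiver_of[OF n d])
    qed
    moreover have "distinct w" "set w \<subseteq> {1..n}" using Cons.prems by auto
    ultimately have *: "fold (simple_reflection n) w (orbit n ?\<xi> m)
        = orbit n (\<lambda>i. if i \<in> set w then ?\<xi> i - 2 else ?\<xi> i) m"
      "fold (simple_reflection n) w (eps (t_index n ?\<xi>))
      = (\<lambda>x. (if n \<in> set w then -1 else 1) * eps (t_index n (\<lambda>i. if i \<in> set w then ?\<xi> i - 2 else ?\<xi> i)) x)"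
      using Cons.IH[OF heights_lower_peak[OF n Cons.prems(1) d]] by blast+
    have **: "(\<lambda>j. if j \<in> set w then ?\<xi> j - 2 else ?\<xi> j) = (\<lambda>j. if j \<in> set (i # w) then \<xi> j - 2 else \<xi> j)"
      using Cons.prems(2) by auto
    show ?case
    proof
      show "fold (simple_reflection n) (i # w) (orbit n \<xi> m)
        = orbit n (\<lambda>j. if j \<in> set (i # w) then \<xi> j - 2 else \<xi> j) m"
        using *(1) unfolding ** by (simp add: reflect_orbit[OF n Cons.prems(1) d])
      have "fold (simple_reflection n) (i # w) (eps (t_index n \<xi>)) =
         (\<lambda>x. (if i = n then -1 else 1) * fold (simple_reflection n) w (eps (t_index n ?\<xi>)) x)"
        by (simp add: reflect_eps_t[OF n Cons.prems(1) d] fold_reflection_scale)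
      also have "\<dots> = (\<lambda>x. (if n \<in> set (i # w) then -1 else 1)
          * eps (t_index n (\<lambda>j. if j \<in> set (i # w) then \<xi> j - 2 else \<xi> j)) x)"
        using Cons.prems(2) unfolding *(2) ** by auto
      finally show "fold (simple_reflection n) (i # w) (eps (t_index n \<xi>)) = \<dots>" .
    qed
  qed (auto simp: fun_eq_iff)
  note both = this
  show "fold (simple_reflection n) w (orbit n \<xi> m) = orbit n \<xi>' m"
    unfolding \<xi>'_def by (rule both[THEN conjunct1])
  show "fold (simple_reflection n) w (eps (t_index n \<xi>))
      = (\<lambda>x. (if n \<in> set w then -1 else 1) * eps (t_index n \<xi>') x)"
    unfolding \<xi>'_def by (rule both[THEN conjunct2])
qed

lemma coxeter_element_Cons:
  "coxeter_element n (i # w) v = simple_reflection n i (coxeter_element n w v)"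
  "coxeter_element n [] v = v"
  by (simp_all add: coxeter_element_def)

text \<open>Applying the reflections in the order of the letters gives the inverse of the Coxeter element.\<close>

lemma coxeter_element_fold:
  assumes "n \<ge> 4" "set w \<subseteq> {1..n}"
  shows "coxeter_element n w (fold (simple_reflection n) w v) = v"
  using assms(2)
  by (induction w arbitrary: v)
    (auto simp: coxeter_element_Cons simple_reflection_involutive[OF assms(1)])

lemma coxeter_element_diff:
  "coxeter_element n w (u - v) = coxeter_element n w u - coxeter_element n w v"
  by (induction w) (simp_all only: coxeter_element_Cons simple_reflection_diff)

lemma coxeter_element_scale:
  "coxeter_element n w (\<lambda>x. c * v x) = (\<lambda>x. c * coxeter_element n w v x)"
  by (induction w) (auto simp: coxeter_element_Cons simple_reflection_scale)

lemma orbit_shift: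
  assumes n: "n \<ge> 4" and w: "\<And>i. 1 \<le> i \<Longrightarrow> i \<le> n \<Longrightarrow> \<xi>' i = \<xi> i - 2"
  shows "orbit n \<xi>' m = orbit n \<xi> (m + 2)" "t_index n \<xi>' = t_index n \<xi>"
proof -
  show t: "t_index n \<xi>' = t_index n \<xi>"
    using w[of n] w[of "n - 1"] n by (simp add: t_index_def)
  have tr: "trunk n \<xi>' i = trunk n \<xi> i - 2" if "1 \<le> i" "i \<le> n" for i
    using w[OF that] w[of n] n by (simp add: trunk_def)
  have "position (trunk n \<xi>') x = position (trunk n \<xi>) x - 2" if "1 \<le> x" "x \<le> n" for x
    using tr[of x] tr[of "x - 1"] that by (cases "x = 1") (auto simp: position_def)
  then have px: "position (trunk n \<xi>') x = position (trunk n \<xi>) x - 2"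
    if "1 \<le> x" "x \<le> n" for x using that .
  show "orbit n \<xi>' m = orbit n \<xi> (m + 2)"
  proof
    fix c
    show "orbit n \<xi>' m c = orbit n \<xi> (m + 2) c"
    proof (cases "1 \<le> c \<and> c \<le> n")
      case True
      then have "1 \<le> min c (n - 1)" "min c (n - 1) \<le> n" using n by auto
      from px[OF this]
      have "m - position (trunk n \<xi>') (min c (n - 1)) = m + 2 - position (trunk n \<xi>) (min c (n - 1))" by linarith
      then show ?thesis by (simp only: orbit_def t)
    next
      case False
      then have "c = 0 \<or> c > n" by auto
      then show ?thesis by (simp only: orbit_outside)
    qed
  qed
qed

context
  fixes n :: nat and \<xi> :: "nat \<Rightarrow> int" and w :: "nat list"
  assumes n: "n \<ge> 4" and h: "heights n \<xi>" and w: "adapted_word n (quiver_of n \<xi>) w"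
begin

lemma coxeter_orbit: "coxeter_element n w (orbit n \<xi> m) = orbit n \<xi> (m - 2)"
proof -
  have W: "distinct w" "set w = {1..n}"
    "\<forall>k<length w. is_source (w ! k) (fold reverse_at (take k w) (quiver_of n \<xi>))"
    using w unfolding adapted_word_def by auto
  have "fold (simple_reflection n) w (orbit n \<xi> (m - 2)) = orbit n \<xi> m"
    using fold_reflections(1)[OF n h W(1) _ W(3)] orbit_shift(1)[OF n, of "\<lambda>i. if i \<in> set w then \<xi> i - 2 else \<xi> i" \<xi>] W(2)
    by auto
  then show ?thesis using coxeter_element_fold[OF n, of w "orbit n \<xi> (m - 2)"] W(2) by auto
qed

lemma coxeter_eps_t: "coxeter_element n w (eps (t_index n \<xi>)) = (\<lambda>x. - eps (t_index n \<xi>) x)"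
proof -
  have W: "distinct w" "set w = {1..n}"
    "\<forall>k<length w. is_source (w ! k) (fold reverse_at (take k w) (quiver_of n \<xi>))"
    using w unfolding adapted_word_def by auto
  have "fold (simple_reflection n) w (eps (t_index n \<xi>)) = (\<lambda>x. - 1 * eps (t_index n \<xi>) x)"
    using fold_reflections(2)[OF n h W(1) _ W(3)] orbit_shift(2)[OF n, of "\<lambda>i. if i \<in> set w then \<xi> i - 2 else \<xi> i" \<xi>] W(2) n
    by auto
  then have "coxeter_element n w (\<lambda>x. - 1 * eps (t_index n \<xi>) x) = eps (t_index n \<xi>)"
    using coxeter_element_fold[OF n, of w "eps (t_index n \<xi>)"] W(2) by auto
  then have "(\<lambda>x. - coxeter_element n w (eps (t_index n \<xi>)) x) = eps (t_index n \<xi>)"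
    unfolding coxeter_element_scale by simp
  then show ?thesis by (metis add.inverse_inverse)
qed

lemma coxeter_power_orbit_diff:
  "(coxeter_element n w ^^ j) (orbit n \<xi> a - orbit n \<xi> b) = orbit n \<xi> (a - 2 * int j) - orbit n \<xi> (b - 2 * int j)"
proof (induction j)
  case (Suc j)
  have "c - 2 * int j - 2 = c - 2 * int (Suc j)" for c by simp
  then show ?case
    by (simp only: funpow.simps o_apply Suc.IH coxeter_element_diff coxeter_orbit)
qed simp

lemma coxeter_power_orbit_eps_t:
  "(coxeter_element n w ^^ j) (orbit n \<xi> a - (\<lambda>x. s * eps (t_index n \<xi>) x))
    = orbit n \<xi> (a - 2 * int j) - (\<lambda>x. (-1) ^ j * s * eps (t_index n \<xi>) x)"
proof (induction j)
  case (Suc j)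
  have "a - 2 * int j - 2 = a - 2 * int (Suc j)" by simp
  then show ?case
    by (simp only: funpow.simps o_apply Suc.IH coxeter_element_diff coxeter_element_scale coxeter_orbit coxeter_eps_t)
      (simp add: fun_eq_iff)
qed simp

end

section \<open>Paths in a Dynkin quiver\<close>

text \<open>The distance in the Dynkin diagram; \<open>min j (n - 1)\<close> places both fork vertices at distance
\<open>n - 1\<close> along the path.\<close>

definition tree_dist :: "nat \<Rightarrow> nat \<Rightarrow> nat \<Rightarrow> int" where
  "tree_dist n j i = (if {j, i} = {n - 1, n} then 2 else \<bar>int (min j (n - 1)) - int (min i (n - 1))\<bar>)"

text \<open>The neighbour of \<open>j\<close> on the geodesic to \<open>i\<close>.\<close>

definition toward :: "nat \<Rightarrow> nat \<Rightarrow> nat \<Rightarrow> nat" where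
  "toward n i j = (if j = n \<or> (j = n - 1 \<and> i = n) then n - 2 else if i < j then j - 1
     else if i = n \<and> j = n - 2 then n else j + 1)"

text \<open>Writing \<open>n = m + 2\<close> removes the truncated subtractions from the case distinctions that follow.\<close>

lemma nat_minus_two:
  assumes "n \<ge> 4"
  obtains m where "n = Suc (Suc m)" "m \<ge> 2"
  using assms by (metis add_2_eq_Suc' diff_add_inverse2 le_Suc_ex le_diff_conv2 numeral_Bit0 add_leD2 nat_add_left_cancel_le add.commute)

lemma edge_iff_Suc:
  assumes "m \<ge> 2"
  shows "{i, j} \<in> dynkin_edges (Suc (Suc m)) \<longleftrightarrow>
    (1 \<le> i \<and> i \<le> m \<and> j = Suc i) \<or> (1 \<le> j \<and> j \<le> m \<and> i = Suc j)
    \<or> (i = m \<and> j = Suc (Suc m)) \<or> (i = Suc (Suc m) \<and> j = m)"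
  using edge_iff[of "Suc (Suc m)" i j] assms by simp

lemma tree_dist_Suc:
  "i \<le> Suc m \<Longrightarrow> j \<le> Suc m \<Longrightarrow> tree_dist (Suc (Suc m)) j i = \<bar>int j - int i\<bar>"
  "i \<le> m \<Longrightarrow> tree_dist (Suc (Suc m)) (Suc (Suc m)) i = int (Suc m) - int i"
  "j \<le> m \<Longrightarrow> tree_dist (Suc (Suc m)) j (Suc (Suc m)) = int (Suc m) - int j"
  "tree_dist (Suc (Suc m)) (Suc (Suc m)) (Suc m) = 2"
  "tree_dist (Suc (Suc m)) (Suc m) (Suc (Suc m)) = 2"
  "tree_dist (Suc (Suc m)) (Suc (Suc m)) (Suc (Suc m)) = 0"
  by (auto simp: tree_dist_def doubleton_eq_iff min_def)

lemma toward_Suc: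
  "toward (Suc (Suc m)) i (Suc (Suc m)) = m"
  "toward (Suc (Suc m)) (Suc (Suc m)) (Suc m) = m"
  "i \<le> Suc m \<Longrightarrow> i < j \<Longrightarrow> j \<le> Suc m \<Longrightarrow> toward (Suc (Suc m)) i j = j - 1"
  "toward (Suc (Suc m)) (Suc (Suc m)) m = Suc (Suc m)"
  "j < m \<Longrightarrow> toward (Suc (Suc m)) (Suc (Suc m)) j = Suc j"
  "j < i \<Longrightarrow> i \<le> Suc m \<Longrightarrow> toward (Suc (Suc m)) i j = Suc j"
  by (auto simp: toward_def)

lemma node_cases:
  assumes "1 \<le> (i::nat)" "i \<le> Suc (Suc m)"
  obtains "i = Suc (Suc m)" | "i = Suc m" | "1 \<le> i" "i \<le> m"
  using assms by linarith

lemma tree_dist_toward: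
  assumes "n \<ge> 4" "1 \<le> i" "i \<le> n" "1 \<le> j" "j \<le> n" "i \<noteq> j"
  shows "{j, toward n i j} \<in> dynkin_edges n" "tree_dist n (toward n i j) i = tree_dist n j i - 1"
    "1 \<le> toward n i j" "toward n i j \<le> n"
proof -
  obtain m where n: "n = Suc (Suc m)" "m \<ge> 2" using nat_minus_two[OF assms(1)] .
  let ?g = "{j, toward n i j} \<in> dynkin_edges n \<and> tree_dist n (toward n i j) i = tree_dist n j i - 1 \<and>
    1 \<le> toward n i j \<and> toward n i j \<le> n"
  have low: ?g if "i \<le> Suc m" "j \<le> Suc m"
  proof (cases "i < j")
    case True
    then obtain k where "j = Suc k" by (cases j) auto
    then show ?thesis using that True n assms(2) by (simp add: toward_Suc edge_iff_Suc tree_dist_Suc)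
  next
    case False
    then have "j < i" using assms(6) by simp
    then show ?thesis using that n assms(4) by (simp add: toward_Suc edge_iff_Suc tree_dist_Suc)
  qed
  have ?g
  proof (cases "j = Suc (Suc m)")
    case True
    then show ?g using n assms(2,3,6)
      by (cases "i = Suc m") (simp_all add: toward_Suc edge_iff_Suc tree_dist_Suc)
  next
    case j: False
    show ?g
    proof (cases "i = Suc (Suc m)")
      case True
      consider "j = Suc m" | "j = m" | "j < m" using j assms(5) n by linarith
      then show ?g using n True assms(4) by cases (simp_all add: toward_Suc edge_iff_Suc tree_dist_Suc)
    next
      case False
      then show ?g using j low assms(3,5) n by simp
    qed
  qed
  then show "{j, toward n i j} \<in> dynkin_edges n" "tree_dist n (toward n i j) i = tree_dist n j i - 1"
    "1 \<le> toward n i j" "toward n i j \<le> n" by auto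
qed

lemma tree_dist_edge:
  assumes "n \<ge> 4" "1 \<le> i" "i \<le> n" "{a, b} \<in> dynkin_edges n"
  shows "tree_dist n a i = tree_dist n b i + 1 \<and> b = toward n i a \<or> tree_dist n b i = tree_dist n a i + 1 \<and> a = toward n i b"
proof -
  obtain m where n: "n = Suc (Suc m)" "m \<ge> 2" using nat_minus_two[OF assms(1)] .
  let ?g = "\<lambda>a b. tree_dist n a i = tree_dist n b i + 1 \<and> b = toward n i a \<or> tree_dist n b i = tree_dist n a i + 1 \<and> a = toward n i b"
  have step: "?g a (Suc a)" if "a \<le> m" for a
  proof (rule node_cases[OF assms(2)])
    show "i \<le> Suc (Suc m)" using assms n by auto
  next
    assume "i = Suc (Suc m)"
    then show ?thesis using that n by (cases "a = m") (simp_all add: toward_Suc tree_dist_Suc)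
  next
    assume "i = Suc m"
    then show ?thesis using that n by (simp add: toward_Suc tree_dist_Suc)
  next
    assume "i \<le> m"
    then show ?thesis using that n by (cases "i \<le> a") (simp_all add: toward_Suc tree_dist_Suc)
  qed
  have fork: "?g m n"
  proof (rule node_cases[OF assms(2)])
    show "i \<le> Suc (Suc m)" using assms n by auto
  qed (use n in \<open>simp_all add: toward_Suc tree_dist_Suc\<close>)
  from assms(4) show ?thesis
    unfolding n(1) edge_iff_Suc[OF n(2)] unfolding n(1)[symmetric]
    using step[of a] step[of b] fork by blast
qed

lemma edge_range:
  assumes "n \<ge> 4" "{a, b} \<in> dynkin_edges n"
  shows "1 \<le> a" "a \<le> n" "1 \<le> b" "b \<le> n"
  using assms edge_iff[OF assms(1), of a b] by auto

lemma tree_dist_nonneg: "tree_dist n j i \<ge> 0"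
  by (simp add: tree_dist_def)

lemma tree_dist_refl: "n \<ge> 4 \<Longrightarrow> tree_dist n i i = 0"
  by (auto simp: tree_dist_def doubleton_eq_iff)

lemma heights_lipschitz:
  assumes n: "n \<ge> 4" and h: "heights n \<xi>" and "1 \<le> i" "i \<le> n" "1 \<le> j" "j \<le> n"
  shows "\<bar>\<xi> j - \<xi> i\<bar> \<le> tree_dist n j i"
  using assms(5,6)
proof (induction "nat (tree_dist n j i)" arbitrary: j rule: less_induct)
  case less
  show ?case
  proof (cases "i = j")
    case False
    let ?j = "toward n i j"
    note t = tree_dist_toward[OF n assms(3,4) less.prems False]
    have "\<bar>\<xi> ?j - \<xi> i\<bar> \<le> tree_dist n ?j i"
      by (rule less.hyps) (use t tree_dist_nonneg[of n j i] tree_dist_nonneg[of n ?j i] in auto)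
    moreover have "\<bar>\<xi> ?j - \<xi> j\<bar> = 1" using h t(1) unfolding heights_def by blast
    ultimately show ?thesis using t(2) by linarith
  qed (simp add: tree_dist_nonneg)
qed

text \<open>Every arrow lowers the height by 1, so a path from \<open>j\<close> to \<open>i\<close> has length \<open>\<xi> j - \<xi> i\<close>; by the
Lipschitz bound this is possible only if the path is the geodesic and descends at each step.\<close>

lemma quiver_of_rtrancl_iff:
  assumes n: "n \<ge> 4" and h: "heights n \<xi>" and i: "1 \<le> i" "i \<le> n" and j: "1 \<le> j" "j \<le> n"
  shows "(j, i) \<in> (quiver_of n \<xi>)\<^sup>* \<longleftrightarrow> \<xi> j - \<xi> i = tree_dist n j i"
proof
  assume "(j, i) \<in> (quiver_of n \<xi>)\<^sup>*"
  then have "1 \<le> j \<and> j \<le> n \<longrightarrow> \<xi> j - \<xi> i = tree_dist n j i"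
  proof (induction rule: converse_rtrancl_induct)
    case (step j k)
    then have e: "{j, k} \<in> dynkin_edges n" "\<xi> k = \<xi> j - 1" by (auto simp: quiver_of_def)
    then have "\<xi> k - \<xi> i = tree_dist n k i" using step edge_range[OF n e(1)] by auto
    then show ?case using tree_dist_edge[OF n i e(1)] heights_lipschitz[OF n h i, of j] e(2) by auto
  qed (simp add: tree_dist_refl[OF n])
  then show "\<xi> j - \<xi> i = tree_dist n j i" using j by blast
next
  assume "\<xi> j - \<xi> i = tree_dist n j i"
  then show "(j, i) \<in> (quiver_of n \<xi>)\<^sup>*" using j
  proof (induction "nat (tree_dist n j i)" arbitrary: j rule: less_induct)
    case less
    show ?case
    proof (cases "i = j")
      case False
      let ?j = "toward n i j"
      note t = tree_dist_toward[OF n i less.prems(2,3) False]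
      have a: "\<bar>\<xi> ?j - \<xi> j\<bar> = 1" using h t(1) unfolding heights_def by blast
      have "\<bar>\<xi> ?j - \<xi> i\<bar> \<le> tree_dist n ?j i"
        by (rule heights_lipschitz[OF n h i t(3,4)])
      then have *: "\<xi> ?j = \<xi> j - 1" using a t(2) less.prems(1) by linarith
      then have "(j, ?j) \<in> quiver_of n \<xi>" using t(1) by (simp add: quiver_of_def)
      moreover have "(?j, i) \<in> (quiver_of n \<xi>)\<^sup>*"
        by (rule less.hyps) (use t tree_dist_nonneg[of n ?j i] * less.prems(1) in auto)
      ultimately show ?thesis by (rule converse_rtrancl_into_rtrancl)
    qed simp
  qed
qed

lemma eta_quiver_of:
  assumes "n \<ge> 4" "heights n \<xi>" "1 \<le> i" "i \<le> n"
  shows "eta n (quiver_of n \<xi>) i = (\<Sum>j\<in>{j\<in>{1..n}. \<xi> j - \<xi> i = tree_dist n j i}. simple_root n j)"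
  unfolding eta_def by (rule sum.cong) (use quiver_of_rtrancl_iff[OF assms] in auto)

section \<open>The sums eta in terms of the orbit\<close>

definition slot_coordinate :: "nat \<Rightarrow> (nat \<Rightarrow> int) \<Rightarrow> nat \<Rightarrow> nat" where
  "slot_coordinate n \<xi> x = (if x = n - 1 then (if t_index n \<xi> = n then n - 1 else n) else x)"

lemma orbit_antiperiodic:
  assumes "n \<ge> 4"
  shows "orbit n \<xi> (m + (2 * int n - 2)) = - orbit n \<xi> m"
proof
  fix c
  have "m + (2 * int n - 2) - p = (m - p) + (2 * int n - 2)" for p by simp
  moreover have "2 * int n - 2 > 0" using assms by simp
  ultimately show "orbit n \<xi> (m + (2 * int n - 2)) c = (- orbit n \<xi> m) c"
    unfolding orbit_def by (simp only: antiperiodic_sign_add uminus_apply if_distrib[of uminus] minus_zero)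
qed

lemma orbit_antiperiodic':
  assumes "n \<ge> 4"
  shows "orbit n \<xi> (m - (2 * int n - 2)) = - orbit n \<xi> m"
  using orbit_antiperiodic[OF assms, of \<xi> "m - (2 * int n - 2)"]
    by (simp only: diff_add_cancel minus_minus)

lemma antiperiodic_sign_position:
  assumes n: "n \<ge> 4" and h: "heights n \<xi>" and xy: "1 \<le> x" "x \<le> n - 1" "1 \<le> y" "y \<le> n - 1"
  shows "antiperiodic_sign (2 * int n - 2) (position (trunk n \<xi>) x - position (trunk n \<xi>) y) = (if x = y then 1 else 0)"
proof (cases "x = y")
  case False
  note u = trunk_unit_steps[OF n h]
  have "2 * int (n - 1) = 2 * int n - 2" using n by simp
  then have "\<bar>position (trunk n \<xi>) x - position (trunk n \<xi>) y\<bar> < 2 * int n - 2"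
    using position_dist[OF u xy] by simp
  moreover have "position (trunk n \<xi>) x - position (trunk n \<xi>) y \<noteq> 0"
    using position_inj[OF u xy] False by auto
  ultimately show ?thesis using False by (simp add: antiperiodic_sign_small)
qed simp

text \<open>Distinct positions are closer to each other than one antiperiod, so exactly one coordinate
survives.\<close>

lemma orbit_position:
  assumes n: "n \<ge> 4" and h: "heights n \<xi>" and x: "1 \<le> x" "x \<le> n - 1"
  shows "orbit n \<xi> (position (trunk n \<xi>) x) = eps (slot_coordinate n \<xi> x)"
proof
  fix c
  have n1: "n - 1 \<noteq> n" "1 \<le> n - 1" "n - 1 \<le> n - 1" using n by linarith+
  have xn: "x \<noteq> n" using n x by linarith
  show "orbit n \<xi> (position (trunk n \<xi>) x) c = eps (slot_coordinate n \<xi> x) c"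
  proof (cases c n rule: coordinate_cases)
    case trunk
    then have c: "c \<le> n - 1" "c \<noteq> n - 1" "c \<noteq> n" using n by linarith+
    then have "c = slot_coordinate n \<xi> x \<longleftrightarrow> x = c"
      unfolding slot_coordinate_def by (cases "x = n - 1") auto
    then show ?thesis using antiperiodic_sign_position[OF n h x trunk(1) c(1)]
      by (simp add: orbit_trunk[OF n h trunk] eps_def)
  next
    case fork1
    then show ?thesis using antiperiodic_sign_position[OF n h x n1(2,3)] n1 xn
      by (simp add: orbit_fork_eq[OF n h] eps_def slot_coordinate_def del: One_nat_def)
  next
    case fork2
    then show ?thesis using antiperiodic_sign_position[OF n h x n1(2,3)] n1 xn
      by (simp add: orbit_fork_eq[OF n h] eps_def slot_coordinate_def del: One_nat_def)
  next
    case outside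
    have "slot_coordinate n \<xi> x \<noteq> 0" "slot_coordinate n \<xi> x \<le> n" using n x
      unfolding slot_coordinate_def by auto
    then show ?thesis using outside by (auto simp: orbit_outside eps_def)
  qed
qed

lemma position_trunk: "n \<ge> 4 \<Longrightarrow> x \<le> n - 2 \<Longrightarrow> position (trunk n \<xi>) x = position \<xi> x"
proof -
  assume "n \<ge> 4" "x \<le> n - 2"
  then have "x \<noteq> n - 1" "x - 1 \<noteq> n - 1" by linarith+
  then show ?thesis by (simp add: position_def trunk_def del: One_nat_def)
qed

lemma position_last:
  assumes "n \<ge> 4" "heights n \<xi>"
  shows "position (trunk n \<xi>) (n - 1) = (if \<xi> n > \<xi> (n - 2) then \<xi> (n - 2) + int n else \<xi> (n - 2) - int n + 2)"
proof -
  have *: "n - 1 - 1 = n - 2" "n - 2 \<noteq> n - 1" "n - 1 \<noteq> 1" "int (n - 1) = int n - 1"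
    using assms(1) by auto
  have "\<xi> n = \<xi> (n - 2) + 1 \<or> \<xi> n = \<xi> (n - 2) - 1"
    using heights_fork(1)[OF assms] by linarith
  then show ?thesis by (elim disjE) (simp_all only: position_def trunk_def * fun_upd_apply if_True if_False simp_thms, simp_all)
qed

lemma orbit_position_trunk:
  assumes n: "n \<ge> 4" and h: "heights n \<xi>" and x: "1 \<le> x" "x \<le> n - 2"
  shows "orbit n \<xi> (position \<xi> x) = eps x"
proof -
  have "x \<le> n - 1" "x \<noteq> n - 1" using n x by linarith+
  then show ?thesis using orbit_position[OF n h x(1)] position_trunk[OF n x(2), of \<xi>]
    by (simp add: slot_coordinate_def)
qed

text \<open>The vertices \<open>j \<le> i\<close> with a path to \<open>i\<close> form an interval ending at \<open>i\<close>, so the sum telescopes. Its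
left end is the vertex at which \<open>\<xi> j + j\<close> first takes the value \<open>\<xi> i + i\<close>, which is its position.\<close>

lemma eta_left:
  assumes n: "n \<ge> 4" and h: "heights n \<xi>" and i: "1 \<le> i" "i \<le> n - 2"
  shows "(\<Sum>j\<in>{j\<in>{1..i}. \<xi> j + int j = \<xi> i + int i}. simple_root n j)
    = orbit n \<xi> (\<xi> i + int i) - eps (Suc i)"
  using i
proof (induction i rule: dec_induct)
  case base
  have s: "{j\<in>{1..1::nat}. \<xi> j + int j = \<xi> 1 + int 1} = {1}" by auto
  have p: "\<xi> 1 + int 1 = position \<xi> 1" by (simp add: position_def)
  have "simple_root n 1 = eps 1 - eps (Suc 1)" using n by (simp add: simple_root_def)
  moreover have "orbit n \<xi> (\<xi> 1 + int 1) = eps 1"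
    unfolding p by (rule orbit_position_trunk[OF n h]) (use n in auto)
  ultimately show ?case unfolding s by simp
next
  case (step i)
  have "Suc i \<noteq> n" using n step.prems by linarith
  then have r: "simple_root n (Suc i) = eps (Suc i) - eps (Suc (Suc i))"
    by (simp add: simple_root_def)
  have "\<bar>\<xi> (Suc i) - \<xi> i\<bar> = 1" by (rule heights_step[OF n h]) (use step in auto)
  then consider "\<xi> (Suc i) = \<xi> i - 1" | "\<xi> (Suc i) = \<xi> i + 1" by linarith
  then show ?case
  proof cases
    case 1
    then have e: "\<xi> (Suc i) + int (Suc i) = \<xi> i + int i" by simp
    have s: "{j\<in>{1..Suc i}. \<xi> j + int j = \<xi> i + int i} = insert (Suc i) {j\<in>{1..i}. \<xi> j + int j = \<xi> i + int i}"
      using e by (auto simp: le_Suc_eq)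
    have "(\<Sum>j\<in>{j\<in>{1..i}. \<xi> j + int j = \<xi> i + int i}. simple_root n j)
        = orbit n \<xi> (\<xi> i + int i) - eps (Suc i)"
      by (rule step.IH) (use step.prems in simp)
    then show ?thesis unfolding e s by (subst sum.insert) (simp_all add: r)
  next
    case 2
    have "\<xi> j + int j < \<xi> (Suc i) + int (Suc i)" if "1 \<le> j" "j \<le> i" for j
    proof -
      have "i \<le> n - 1" using step.prems n by linarith
      then show ?thesis
        using unit_steps_lipschitz[OF heights_unit_steps[OF n h] that] 2 by simp
    qed
    then have s: "{j\<in>{1..Suc i}. \<xi> j + int j = \<xi> (Suc i) + int (Suc i)} = {Suc i}"
      by (fastforce simp: le_Suc_eq)
    have "\<xi> (Suc i) + int (Suc i) = position \<xi> (Suc i)" using 2 by (simp add: position_def)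
    then have "orbit n \<xi> (\<xi> (Suc i) + int (Suc i)) = eps (Suc i)"
      using orbit_position_trunk[OF n h, of "Suc i"] step.prems by simp
    then show ?thesis unfolding s by (simp add: r)
  qed
qed

text \<open>The index is the first point of the right parity below the window of \<open>n - 2\<close>. If the trunk rises
at its last step, the last position lies one antiperiod above this point, hence the sign.\<close>

lemma orbit_fork_value:
  assumes n: "n \<ge> 4" and h: "heights n \<xi>"
  shows "orbit n \<xi> (\<xi> (n - 2) - int n + 2) =
    (if \<xi> n > \<xi> (n - 2) then - eps (slot_coordinate n \<xi> (n - 1)) else eps (slot_coordinate n \<xi> (n - 1)))"
proof -
  have "1 \<le> n - 1" "n - 1 \<le> n - 1" using n by linarith+
  from orbit_position[OF n h this]
  have o: "orbit n \<xi> (position (trunk n \<xi>) (n - 1)) = eps (slot_coordinate n \<xi> (n - 1))" .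
  have "\<xi> (n - 2) - int n + 2 = \<xi> (n - 2) + int n - (2 * int n - 2)" by simp
  then have e: "orbit n \<xi> (\<xi> (n - 2) - int n + 2) = - orbit n \<xi> (\<xi> (n - 2) + int n)"
    using orbit_antiperiodic'[OF n, of \<xi> "\<xi> (n - 2) + int n"] by (simp only:)
  show ?thesis
  proof (cases "\<xi> n > \<xi> (n - 2)")
    case True
    then show ?thesis using o e unfolding position_last[OF n h] by (simp only: if_True)
  next
    case False
    then show ?thesis using o unfolding position_last[OF n h] by (simp only: if_False)
  qed
qed

lemma sum_filter_insert:
  fixes f :: "nat \<Rightarrow> vect"
  assumes "finite A" "a \<notin> A"
  shows "(\<Sum>j\<in>{j\<in>insert a A. P j}. f j) = (if P a then f a else 0) + (\<Sum>j\<in>{j\<in>A. P j}. f j)"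
proof (cases "P a")
  case True
  then have "{j\<in>insert a A. P j} = insert a {j\<in>A. P j}" by auto
  then show ?thesis using assms True by simp
next
  case False
  then have "{j\<in>insert a A. P j} = {j\<in>A. P j}" by auto
  then show ?thesis using False by simp
qed

text \<open>The mirror image of \<open>eta_left\<close>, by induction from the fork downwards. At the fork itself the four
orientations are checked separately.\<close>

lemma eta_right:
  assumes n: "n \<ge> 4" and h: "heights n \<xi>" and i: "1 \<le> i" "i \<le> n - 2"
  shows "(\<Sum>j\<in>{j\<in>{Suc i..n}. \<xi> j - \<xi> i = tree_dist n j i}. simple_root n j)
    = eps (Suc i) - orbit n \<xi> (\<xi> i - int i)"
proof -
  obtain m where m: "n = Suc (Suc m)" "m \<ge> 2" using nat_minus_two[OF n] .
  note h' = h[unfolded m(1)]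
  have "i \<le> m" using i m by simp
  then have "(\<Sum>j\<in>{j\<in>{Suc i..n}. \<xi> j - \<xi> i = tree_dist n j i}. simple_root n j)
    = eps (Suc i) - orbit n \<xi> (\<xi> i - int i)" using i(1)
  proof (induction i rule: inc_induct)
    case base
    have s: "{Suc m..n} = insert n (insert (Suc m) {})" using m by auto
    have r: "simple_root n (Suc m) = eps (Suc m) - eps n" "simple_root n n = eps (Suc m) + eps n"
      using m by (simp_all add: simple_root_def)
    have t: "tree_dist n (Suc m) m = 1" "tree_dist n n m = 1" using m by (simp_all add: tree_dist_Suc)
    have e: "\<xi> m - int m = \<xi> m - int n + 2" "n - 1 = Suc m" "n - 2 = m" "Suc m \<noteq> n"
      using m by auto
    have "\<bar>\<xi> n - \<xi> m\<bar> = 1" "\<bar>\<xi> (Suc m) - \<xi> m\<bar> = 1"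
      using heights_fork[OF n h] e(2,3) by simp_all
    then have f: "\<xi> n = \<xi> m + 1 \<or> \<xi> n = \<xi> m - 1" "\<xi> (Suc m) = \<xi> m + 1 \<or> \<xi> (Suc m) = \<xi> m - 1"
      by linarith+
    have ti: "t_index n \<xi> = (if \<xi> (Suc m) = \<xi> n then n else Suc m)"
      using f unfolding t_index_def e(2) by (elim disjE) simp_all
    have "(\<Sum>j\<in>{j\<in>{Suc m..n}. \<xi> j - \<xi> m = tree_dist n j m}. simple_root n j)
      = (if \<xi> n = \<xi> m + 1 then simple_root n n else 0) + (if \<xi> (Suc m) = \<xi> m + 1 then simple_root n (Suc m) else 0)"
      unfolding s using e(4)
      by (subst sum_filter_insert, simp, simp, subst sum_filter_insert, simp, simp) (simp add: t algebra_simps)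
    also have "\<dots> = eps (Suc m) - orbit n \<xi> (\<xi> m - int m)"
      unfolding e(1) orbit_fork_value[OF n h, unfolded e(2,3)] slot_coordinate_def e(2) ti r
      using f e(4) by (elim disjE) (simp_all add: fun_eq_iff)
    finally show ?case .
  next
    case (step i)
    have im: "Suc i \<le> m" using step.hyps by simp
    have r: "simple_root n (Suc i) = eps (Suc i) - eps (Suc (Suc i))"
      using m im by (simp add: simple_root_def)
    have s: "{Suc i..n} = insert (Suc i) {Suc (Suc i)..n}" using m im by auto
    have td: "tree_dist n j i = tree_dist n j (Suc i) + 1" if "j \<in> {Suc (Suc i)..n}" for j
      using that m im by (cases "j = n") (simp_all add: tree_dist_Suc)
    have td1: "tree_dist n (Suc i) i = 1" using m im by (simp add: tree_dist_Suc)
    have "\<bar>\<xi> (Suc i) - \<xi> i\<bar> = 1" by (rule heights_step[OF n h]) (use step m in auto)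
    then consider "\<xi> (Suc i) = \<xi> i - 1" | "\<xi> (Suc i) = \<xi> i + 1" by linarith
    then show ?case
    proof cases
      case 1
      have "\<xi> j - \<xi> i \<noteq> tree_dist n j i" if "j \<in> {Suc (Suc i)..n}" for j
        using heights_lipschitz[OF n h, of "Suc i" j] td[OF that] that 1 im m by auto
      then have z: "{j\<in>{Suc (Suc i)..n}. \<xi> j - \<xi> i = tree_dist n j i} = {}" by auto
      have "\<xi> i - int i = position \<xi> (Suc i)" using 1 step by (simp add: position_def)
      then have "orbit n \<xi> (\<xi> i - int i) = eps (Suc i)"
        using orbit_position_trunk[OF n h, of "Suc i"] im m by simp
      moreover have "(\<Sum>j\<in>{j\<in>{Suc i..n}. \<xi> j - \<xi> i = tree_dist n j i}. simple_root n j) = 0"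
        unfolding s by (subst sum_filter_insert, simp, simp, unfold z) (use 1 td1 in simp)
      ultimately show ?thesis by simp
    next
      case 2
      have z: "{j\<in>{Suc (Suc i)..n}. \<xi> j - \<xi> i = tree_dist n j i} = {j\<in>{Suc (Suc i)..n}. \<xi> j - \<xi> (Suc i) = tree_dist n j (Suc i)}"
        using td 2 by auto
      have "\<xi> i - int i = \<xi> (Suc i) - int (Suc i)" using 2 by simp
      moreover have "(\<Sum>j\<in>{j\<in>{Suc i..n}. \<xi> j - \<xi> i = tree_dist n j i}. simple_root n j)
          = simple_root n (Suc i) + (eps (Suc (Suc i)) - orbit n \<xi> (\<xi> (Suc i) - int (Suc i)))"
        unfolding s by (subst sum_filter_insert, simp, simp, unfold z, subst step.IH) (use 2 td1 in simp_all)
      ultimately show ?thesis unfolding r by (simp only:) (simp add: fun_eq_iff)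
    qed
  qed
  then show ?thesis .
qed

lemma eta_trunk:
  assumes n: "n \<ge> 4" and h: "heights n \<xi>" and i: "1 \<le> i" "i \<le> n - 2"
  shows "eta n (quiver_of n \<xi>) i = orbit n \<xi> (\<xi> i + int i) - orbit n \<xi> (\<xi> i - int i)"
proof -
  have "i \<le> n" using i by simp
  have l: "\<xi> j - \<xi> i = tree_dist n j i \<longleftrightarrow> \<xi> j + int j = \<xi> i + int i"
    if "j \<le> i" for j
  proof -
    obtain m where m: "n = Suc (Suc m)" "m \<ge> 2" using nat_minus_two[OF n] .
    show ?thesis using that i m by (auto simp: tree_dist_Suc)
  qed
  have "{j\<in>{1..n}. \<xi> j - \<xi> i = tree_dist n j i}
    = {j\<in>{1..i}. \<xi> j + int j = \<xi> i + int i} \<union> {j\<in>{Suc i..n}. \<xi> j - \<xi> i = tree_dist n j i}"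
    using l \<open>i \<le> n\<close> by (auto simp: not_less_eq_eq)
  then have "eta n (quiver_of n \<xi>) i = (\<Sum>j\<in>{j\<in>{1..i}. \<xi> j + int j = \<xi> i + int i}. simple_root n j)
     + (\<Sum>j\<in>{j\<in>{Suc i..n}. \<xi> j - \<xi> i = tree_dist n j i}. simple_root n j)"
    unfolding eta_quiver_of[OF n h i(1) \<open>i \<le> n\<close>]
      by (simp only:) (rule sum.union_disjoint; auto)
  then show ?thesis unfolding eta_left[OF n h i] eta_right[OF n h i] by simp
qed

text \<open>The sign is chosen to match \<open>coxeter_power_orbit_eps_t\<close>. It differs between the two fork levels
exactly when they have the same height; otherwise the roots over a common \<open>u\<close> belong to powers
of the Coxeter element of different parity, and the difference in sign arises from there.\<close>

lemma eta_fork: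
  assumes n: "n \<ge> 4" and h: "heights n \<xi>" and i: "i = n - 1 \<or> i = n"
  shows "eta n (quiver_of n \<xi>) i = orbit n \<xi> (\<xi> i + int n - 1)
    - (\<lambda>x. (if i = n - 1 \<and> t_index n \<xi> = n then 1 else -1) * eps (t_index n \<xi>) x)"
proof -
  obtain m where m: "n = Suc (Suc m)" "m \<ge> 2" using nat_minus_two[OF n] .
  have e: "n - 1 = Suc m" "n - 2 = m" "Suc m \<noteq> n" "m \<noteq> n" using m by auto
  have "\<bar>\<xi> n - \<xi> m\<bar> = 1" "\<bar>\<xi> (Suc m) - \<xi> m\<bar> = 1"
    using heights_fork[OF n h] e(1,2) by simp_all
  then have f: "\<xi> n = \<xi> m + 1 \<or> \<xi> n = \<xi> m - 1" "\<xi> (Suc m) = \<xi> m + 1 \<or> \<xi> (Suc m) = \<xi> m - 1"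
    by linarith+
  have ti: "t_index n \<xi> = (if \<xi> (Suc m) = \<xi> n then n else Suc m)"
    using f unfolding t_index_def e(1) by (elim disjE) simp_all
  have r: "simple_root n (Suc m) = eps (Suc m) - eps n" "simple_root n n = eps (Suc m) + eps n"
    using m by (simp_all add: simple_root_def)
  have s: "{1..n} = insert n (insert (Suc m) {1..m})" using m by auto
  have td: "tree_dist n (Suc m) (Suc m) = 0" "tree_dist n n n = 0" "tree_dist n n (Suc m) = 2" "tree_dist n (Suc m) n = 2"
    using m by (simp_all add: tree_dist_Suc)
  have tm: "tree_dist n j i = int (Suc m) - int j" if "j \<le> m" for j
    using i that m unfolding e by (auto simp: tree_dist_Suc)
  have B: "\<xi> j + int j \<le> \<xi> m + int m" if "1 \<le> j" "j \<le> m" for j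
    using unit_steps_lipschitz[OF heights_unit_steps[OF n h] that] e by simp
  have low: "(\<Sum>j\<in>{j\<in>{1..m}. \<xi> j - \<xi> i = tree_dist n j i}. simple_root n j)
    = (if \<xi> i = \<xi> m - 1 then orbit n \<xi> (\<xi> m + int m) - eps (Suc m) else 0)"
  proof (cases "\<xi> i = \<xi> m - 1")
    case True
    have "{j\<in>{1..m}. \<xi> j - \<xi> i = tree_dist n j i} = {j\<in>{1..m}. \<xi> j + int j = \<xi> m + int m}"
      using True tm by auto
    then show ?thesis using eta_left[OF n h, of m] True m by simp
  next
    case False
    then have "\<xi> i = \<xi> m + 1" using i f unfolding e by auto
    then have z: "{j\<in>{1..m}. \<xi> j - \<xi> i = tree_dist n j i} = {}"
      using tm B by fastforce
    show ?thesis using False unfolding z by simp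
  qed
  have "1 \<le> i" "i \<le> n" using i m by auto
  have nn: "n \<notin> insert (Suc m) {1..m}" "Suc m \<notin> {1..m}" using m by auto
  have eta: "eta n (quiver_of n \<xi>) i = (if \<xi> n - \<xi> i = tree_dist n n i then simple_root n n else 0)
    + ((if \<xi> (Suc m) - \<xi> i = tree_dist n (Suc m) i then simple_root n (Suc m) else 0)
    + (if \<xi> i = \<xi> m - 1 then orbit n \<xi> (\<xi> m + int m) - eps (Suc m) else 0))"
    unfolding eta_quiver_of[OF n h \<open>1 \<le> i\<close> \<open>i \<le> n\<close>] s
    by (simp only: sum_filter_insert nn finite_insert finite_atLeastAtMost low not_False_eq_True)
  have o1: "orbit n \<xi> (\<xi> i + int n - 1) = orbit n \<xi> (\<xi> m + int m)" if "\<xi> i = \<xi> m - 1"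
  proof -
    have "\<xi> i + int n - 1 = \<xi> m + int m" using that m by simp
    then show ?thesis by (simp only:)
  qed
  have o2: "orbit n \<xi> (\<xi> i + int n - 1) = (if \<xi> n > \<xi> m then eps (slot_coordinate n \<xi> (Suc m)) else - eps (slot_coordinate n \<xi> (Suc m)))"
    if "\<xi> i = \<xi> m + 1"
  proof -
    have "\<xi> i + int n - 1 = \<xi> m - int n + 2 + (2 * int n - 2)" using that by simp
    then have "orbit n \<xi> (\<xi> i + int n - 1) = - orbit n \<xi> (\<xi> m - int n + 2)"
      using orbit_antiperiodic[OF n, of \<xi> "\<xi> m - int n + 2"] by (simp only:)
    then show ?thesis
      using orbit_fork_value[OF n h, unfolded e(1,2)] by (simp only: if_distrib[of uminus] minus_minus)
  qed
  from i show ?thesis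
  proof
    assume i: "i = n - 1"
    then have i': "i = Suc m" using e by simp
    show ?thesis unfolding i' eta[unfolded i']
      using f o1[unfolded i'] o2[unfolded i'] ti td e
      by (elim disjE) (simp_all add: r slot_coordinate_def fun_eq_iff)
  next
    assume i: "i = n"
    show ?thesis unfolding i eta[unfolded i]
      using f o1[unfolded i] o2[unfolded i] ti td e
      by (elim disjE) (simp_all add: r slot_coordinate_def fun_eq_iff)
  qed
qed

section \<open>Positive roots on the trunk levels\<close>

lemma slot_coordinate_less:
  assumes "n \<ge> 4" "1 \<le> x" "x < y" "y \<le> n - 1"
  shows "1 \<le> slot_coordinate n \<xi> x" "slot_coordinate n \<xi> x < slot_coordinate n \<xi> y" "slot_coordinate n \<xi> y \<le> n"
proof -
  have "x \<noteq> n - 1" "x < n - 1" "n - 1 < n" using assms by linarith+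
  then show "1 \<le> slot_coordinate n \<xi> x" "slot_coordinate n \<xi> x < slot_coordinate n \<xi> y" "slot_coordinate n \<xi> y \<le> n"
    using assms(2-4) by (auto simp: slot_coordinate_def simp del: One_nat_def)
qed

lemma pos_roots_slot_diff:
  assumes "n \<ge> 4" "1 \<le> x" "x < y" "y \<le> n - 1"
  shows "eps (slot_coordinate n \<xi> x) - eps (slot_coordinate n \<xi> y) \<in> pos_roots n"
  using slot_coordinate_less[OF assms, of \<xi>] unfolding pos_roots_def by blast

lemma pos_roots_slot_sum:
  assumes "n \<ge> 4" "1 \<le> x" "x \<le> n - 1" "1 \<le> y" "y \<le> n - 1" "x \<noteq> y"
  shows "eps (slot_coordinate n \<xi> x) + eps (slot_coordinate n \<xi> y) \<in> pos_roots n"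
proof (cases "x < y")
  case True
  then show ?thesis using slot_coordinate_less[OF assms(1,2) True assms(5), of \<xi>]
    unfolding pos_roots_def by blast
next
  case False
  then have "y < x" using assms by simp
  then have "eps (slot_coordinate n \<xi> y) + eps (slot_coordinate n \<xi> x) \<in> pos_roots n"
    using slot_coordinate_less[OF assms(1,4) _ assms(3), of \<xi>] unfolding pos_roots_def by blast
  then show ?thesis by (simp add: add.commute)
qed

lemma pos_roots_first_coordinate:
  assumes "v \<in> pos_roots n"
  shows "\<exists>a. v a = 1 \<and> (\<forall>x<a. v x = 0)"
proof -
  obtain a b where "a < b" "v = eps a + eps b \<or> v = eps a - eps b"
    using assms unfolding pos_roots_def by blast
  then show ?thesis by (intro exI[of _ a]) (auto simp: eps_def)
qed

lemma pos_roots_uminus: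
  assumes "v \<in> pos_roots n"
  shows "- v \<notin> pos_roots n"
proof
  assume "- v \<in> pos_roots n"
  then obtain c where "(- v) c = 1" "\<forall>x<c. (- v) x = 0"
    using pos_roots_first_coordinate by blast
  then have c: "v c = -1" "\<forall>x<c. v x = 0" by (simp_all add: uminus_apply minus_equation_iff)
  obtain a where "v a = 1" "\<forall>x<a. v x = 0"
    using pos_roots_first_coordinate[OF assms] by blast
  then show False using c by (cases a c rule: linorder_cases) force+
qed

lemma summands_coordinate:
  assumes "v \<in> pos_roots n" "v k = 1"
  shows "eps k \<in> summands n v"
proof -
  obtain a b where ab: "1 \<le> a" "a < b" "b \<le> n" "v = eps a + eps b \<or> v = eps a - eps b"
    using assms(1) unfolding pos_roots_def by blast
  then have "k = a \<or> (k = b \<and> v = eps a + eps b)"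
    using assms(2) by (auto simp: eps_def split: if_splits)
  then show ?thesis using ab unfolding summands_def by blast
qed

lemma orbit_window:
  assumes n: "n \<ge> 4" and h: "heights n \<xi>" and i: "1 \<le> i" "i \<le> n - 2"
    and m: "even (m - (\<xi> i + int i))"
    "trunk n \<xi> (n - 1) - int n + 3 \<le> m" "m \<le> trunk n \<xi> (n - 1) + int n - 1"
  obtains x where "1 \<le> x" "x \<le> n - 1" "position (trunk n \<xi>) x = m" "orbit n \<xi> m = eps (slot_coordinate n \<xi> x)"
proof -
  note u = trunk_unit_steps[OF n h]
  have N: "1 \<le> n - 1" "n - 1 \<le> n - 1" "int (n - 1) = int n - 1" "i \<le> n - 1" "i \<noteq> n - 1"
    using n i by auto
  have "trunk n \<xi> i = \<xi> i" using N(5) by (simp add: trunk_def)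
  then have "even (m - (trunk n \<xi> (n - 1) + int (n - 1)))"
    using unit_steps_parity[OF u i(1) N(4) N(1,2)] m(1) by presburger
  then obtain x where x: "1 \<le> x" "x \<le> n - 1" "position (trunk n \<xi>) x = m"
    using position_surj[OF u N(1,2), of m] m N(3) by auto
  then show ?thesis using that orbit_position[OF n h x(1,2)] by blast
qed

text \<open>Together with \<open>m_ind_trunk\<close> this shows that a trunk level has \<open>n - 1\<close> vertices. Modulo the antiperiod both
indices can be moved into the last window, where \<open>g\<close> takes each of \<open>n - 1\<close> coordinate vectors
once. If only the second index has to be moved, the root is a sum. Otherwise it is a difference,
and its positivity means that the slots are in the right order. This is decided by the window of
\<open>i\<close>: the slot of an index outside this window exceeds \<open>i\<close>, and on
either side of the window slots grow with the distance from it.\<close>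

lemma pos_roots_orbit:
  assumes n: "n \<ge> 4" and h: "heights n \<xi>" and i: "1 \<le> i" "i \<le> n - 2" and j: "j \<le> n - 2"
  shows "orbit n \<xi> (\<xi> i + int i - 2 * int j) - orbit n \<xi> (\<xi> i - int i - 2 * int j) \<in> pos_roots n"
proof -
  note u = trunk_unit_steps[OF n h]
  let ?T = "trunk n \<xi>"
  define a b where "a = \<xi> i + int i - 2 * int j" and "b = \<xi> i - int i - 2 * int j"
  have N: "n - 1 \<le> n - 1" "int (n - 1) = int n - 1" "i \<le> n - 1" "i \<noteq> n - 1"
    using n i by auto
  have ij: "int i \<ge> 1" "int i \<le> int n - 2" "int j \<le> int n - 2" using i j n by auto
  have Ti: "?T i = \<xi> i" using N(4) by (simp add: trunk_def)
  have B: "?T x + int x \<le> ?T y + int y" "?T y - int y \<le> ?T x - int x"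
    if "1 \<le> x" "x \<le> y" "y \<le> n - 1" for x y
    using unit_steps_lipschitz[OF u that] by auto
  note Bn = B[OF i(1) N(3,1), unfolded Ti N(2)]
  have win: "\<xi> i - int i + 2 \<le> position ?T y \<and> position ?T y \<le> \<xi> i + int i \<longleftrightarrow> y \<le> i"
    if "1 \<le> y" "y \<le> n - 1" for y
    using position_window_iff[OF u i(1) N(3) that] Ti by simp
  have par: "even (a - (\<xi> i + int i))" "even (b - (\<xi> i + int i))"
    "even (a + (2 * int n - 2) - (\<xi> i + int i))" "even (b + (2 * int n - 2) - (\<xi> i + int i))"
    unfolding a_def b_def by auto
  have ap: "orbit n \<xi> m = - orbit n \<xi> (m + (2 * int n - 2))" for m
    unfolding orbit_antiperiodic[OF n] by simp
  let ?lo = "?T (n - 1) - int n + 3"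
  have "1 \<le> n - 1" using n by simp
  then have "even (\<xi> i + int i - (?T (n - 1) + (int n - 1)))"
    using unit_steps_parity[OF u i(1) N(3) _ N(1)] Ti N(2) by simp
  then have "even (a - ?lo)" "even (b - ?lo)" using par(1,2) by presburger+
  \<comment> \<open>the only integer between two consecutive translates of the window has the wrong parity\<close>
  then have odd: "a \<noteq> ?lo - 1" "b \<noteq> ?lo - 1" by auto
  \<comment> \<open>neither index, one index or both indices lie below the last window\<close>
  consider "b \<ge> ?lo" | "b < ?lo" "a \<ge> ?lo" | "a < ?lo" by linarith
  then have "orbit n \<xi> a - orbit n \<xi> b \<in> pos_roots n"
  proof cases
    case 1
    have bd1: "?lo \<le> a" "a \<le> ?T (n - 1) + int n - 1"
      using 1 Bn ij odd a_def b_def by linarith+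
    have bd2: "?lo \<le> b" "b \<le> ?T (n - 1) + int n - 1"
      using 1 Bn ij odd a_def b_def by linarith+
    obtain x where x: "1 \<le> x" "x \<le> n - 1" "position ?T x = a" "orbit n \<xi> a = eps (slot_coordinate n \<xi> x)"
      using orbit_window[OF n h i par(1)] bd1 by blast
    obtain y where y: "1 \<le> y" "y \<le> n - 1" "position ?T y = b" "orbit n \<xi> b = eps (slot_coordinate n \<xi> y)"
      using orbit_window[OF n h i par(2)] bd2 by blast
    have "x < y"
    proof (rule ccontr)
      assume "\<not> x < y"
      then have "y \<le> x" by simp
      have "\<not> y \<le> i" using win[OF y(1,2)] y(3) ij unfolding b_def by simp
      then have "\<not> x \<le> i" "i \<le> x" using \<open>y \<le> x\<close> by auto
      then have "a < \<xi> i - int i + 2" using win[OF x(1,2)] x(3) ij unfolding a_def by simp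
      moreover have "?T x + int x \<ge> \<xi> i + int i"
        using B(1)[OF i(1) \<open>i \<le> x\<close> x(2)] Ti by simp
      ultimately have "position ?T x = ?T x - int x + 2" using position_cases[of ?T x] x(3) ij by auto
      moreover have "?T x - int x \<le> ?T y - int y" using B(2)[OF y(1) \<open>y \<le> x\<close> x(2)] .
      ultimately show False using position_in_window(1)[OF y(1), of ?T] x(3) y(3) ij
        unfolding a_def b_def by simp
    qed
    then show ?thesis using pos_roots_slot_diff[OF n x(1) _ y(2)] x(4) y(4) by simp
  next
    case 2
    have bd1: "?lo \<le> a" "a \<le> ?T (n - 1) + int n - 1"
      using 2 Bn ij odd a_def b_def by linarith+
    have bd4: "?lo \<le> b + (2 * int n - 2)" "b + (2 * int n - 2) \<le> ?T (n - 1) + int n - 1"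
      using 2 Bn ij odd a_def b_def by linarith+
    obtain x where x: "1 \<le> x" "x \<le> n - 1" "position ?T x = a" "orbit n \<xi> a = eps (slot_coordinate n \<xi> x)"
      using orbit_window[OF n h i par(1)] bd1 by blast
    obtain y where y: "1 \<le> y" "y \<le> n - 1" "position ?T y = b + (2 * int n - 2)"
        "orbit n \<xi> (b + (2 * int n - 2)) = eps (slot_coordinate n \<xi> y)"
      using orbit_window[OF n h i par(4)] bd4 by blast
    have "x \<noteq> y" using x(3) y(3) ij unfolding a_def b_def by auto
    then show ?thesis using pos_roots_slot_sum[OF n x(1,2) y(1,2), of \<xi>] x(4) y(4) ap[of b] by simp
  next
    case 3
    have bd3: "?lo \<le> a + (2 * int n - 2)" "a + (2 * int n - 2) \<le> ?T (n - 1) + int n - 1"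
      using 3 Bn ij odd a_def b_def by linarith+
    have bd4: "?lo \<le> b + (2 * int n - 2)" "b + (2 * int n - 2) \<le> ?T (n - 1) + int n - 1"
      using 3 Bn ij odd a_def b_def by linarith+
    obtain x where x: "1 \<le> x" "x \<le> n - 1" "position ?T x = a + (2 * int n - 2)"
        "orbit n \<xi> (a + (2 * int n - 2)) = eps (slot_coordinate n \<xi> x)"
      using orbit_window[OF n h i par(3)] bd3 by blast
    obtain y where y: "1 \<le> y" "y \<le> n - 1" "position ?T y = b + (2 * int n - 2)"
        "orbit n \<xi> (b + (2 * int n - 2)) = eps (slot_coordinate n \<xi> y)"
      using orbit_window[OF n h i par(4)] bd4 by blast
    have "y < x"
    proof (rule ccontr)
      assume "\<not> y < x"
      then have "x \<le> y" by simp
      have "\<not> x \<le> i" using win[OF x(1,2)] x(3) ij unfolding a_def by simp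
      then have "\<not> y \<le> i" "i \<le> x" using \<open>x \<le> y\<close> by auto
      then have "b + (2 * int n - 2) > \<xi> i + int i" using win[OF y(1,2)] y(3) ij unfolding b_def by simp
      moreover have "?T y - int y \<le> \<xi> i - int i"
        using B(2)[OF i(1) _ y(2)] \<open>i \<le> x\<close> \<open>x \<le> y\<close> Ti by simp
      ultimately have "position ?T y = ?T y + int y" using position_cases[of ?T y] y(3) ij by auto
      moreover have "?T x + int x \<le> ?T y + int y" using B(1)[OF x(1) \<open>x \<le> y\<close> y(2)] .
      ultimately show False using position_in_window(2)[OF x(1), of ?T] x(3) y(3) ij
        unfolding a_def b_def by simp
    qed
    then show ?thesis using pos_roots_slot_diff[OF n y(1) _ x(2), of \<xi>] x(4) y(4) ap[of a] ap[of b] by simp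
  qed
  then show ?thesis unfolding a_def b_def .
qed

section \<open>Roots on the Auslander-Reiten quiver\<close>

locale adapted_D_quiver =
  fixes n :: nat and \<xi> :: "nat \<Rightarrow> int" and w :: "nat list"
  assumes n: "n \<ge> 4" and h: "heights n \<xi>" and w: "adapted_word n (quiver_of n \<xi>) w"
begin

abbreviation "vertices \<equiv> AR_vertices n (quiver_of n \<xi>) \<xi> w"
abbreviation "ar_root \<equiv> root_at n (quiver_of n \<xi>) \<xi> w"

lemma coxeter_power_eta:
  assumes i: "1 \<le> i" "i \<le> n - 2"
  shows "(coxeter_element n w ^^ j) (eta n (quiver_of n \<xi>) i)
    = orbit n \<xi> (\<xi> i + int i - 2 * int j) - orbit n \<xi> (\<xi> i - int i - 2 * int j)"
  unfolding eta_trunk[OF n h i] coxeter_power_orbit_diff[OF n h w] ..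

text \<open>The run of positive roots ends at \<open>k = n - 1\<close>, where \<open>\<tau>\<^sup>k\<close> has shifted both indices by the antiperiod
and the root has become \<open>-\<eta>\<^sub>i\<close>.\<close>

lemma m_ind_trunk:
  assumes i: "1 \<le> i" "i \<le> n - 2"
  shows "m_ind n (quiver_of n \<xi>) w i = n - 2"
proof -
  let ?r = "\<lambda>j. (coxeter_element n w ^^ j) (eta n (quiver_of n \<xi>) i)"
  have p: "?r j \<in> pos_roots n" if "j \<le> n - 2" for j
    unfolding coxeter_power_eta[OF i] by (rule pos_roots_orbit[OF n h i that])
  have e: "m - 2 * int (n - 1) = m - (2 * int n - 2)" "m = m - 2 * int 0" for m using n by auto
  have "?r (n - 1) = - ?r 0"
    unfolding coxeter_power_eta[OF i] e(1) orbit_antiperiodic'[OF n] by (simp only: e(2)[symmetric]) simp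
  then have q: "?r (n - 1) \<notin> pos_roots n" using pos_roots_uminus[OF p[of 0]] by simp
  have "{k. \<forall>j\<le>k. ?r j \<in> pos_roots n} = {..n - 2}"
  proof (rule antisym; rule subsetI)
    fix k assume "k \<in> {k. \<forall>j\<le>k. ?r j \<in> pos_roots n}"
    then have "\<not> n - 1 \<le> k" using q by blast
    then show "k \<in> {..n - 2}" by simp
  qed (use p in auto)
  then show ?thesis unfolding m_ind_def by (simp add: Max_eq_iff)
qed

lemma vertices_trunk:
  assumes i: "1 \<le> i" "i \<le> n - 2"
  shows "(i, p) \<in> vertices \<longleftrightarrow> (\<exists>j\<le>n - 2. p = \<xi> i - 2 * int j)"
proof -
  have "i \<in> {1..n}" using i by simp
  then have "(i, p) \<in> vertices \<longleftrightarrow> (\<exists>j\<le>m_ind n (quiver_of n \<xi>) w i. p = \<xi> i - 2 * int j)"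
    unfolding AR_vertices_def by blast
  then show ?thesis unfolding m_ind_trunk[OF i] .
qed

lemma vertices_depth:
  assumes "(i, p) \<in> vertices"
  obtains j where "p = \<xi> i - 2 * int j"
  using assms unfolding AR_vertices_def by blast

lemma root_power: "ar_root (i, \<xi> i - 2 * int j) = (coxeter_element n w ^^ j) (eta n (quiver_of n \<xi>) i)"
  by (simp add: root_at_def)

lemma root_trunk:
  assumes i: "1 \<le> i" "i \<le> n - 2" and v: "(i, p) \<in> vertices"
  shows "ar_root (i, p) = orbit n \<xi> (p + int i) - orbit n \<xi> (p - int i)" "ar_root (i, p) \<in> pos_roots n"
proof -
  obtain j where j: "j \<le> n - 2" "p = \<xi> i - 2 * int j" using v vertices_trunk[OF i] by auto
  have e: "\<xi> i + int i - 2 * int j = p + int i" "\<xi> i - int i - 2 * int j = p - int i"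
    using j(2) by auto
  have r: "ar_root (i, p) = orbit n \<xi> (\<xi> i + int i - 2 * int j) - orbit n \<xi> (\<xi> i - int i - 2 * int j)"
    unfolding j(2) root_power coxeter_power_eta[OF i] ..
  show "ar_root (i, p) = orbit n \<xi> (p + int i) - orbit n \<xi> (p - int i)" unfolding r e ..
  show "ar_root (i, p) \<in> pos_roots n" unfolding r by (rule pos_roots_orbit[OF n h i j(1)])
qed

lemma roots_fork:
  assumes "(n - 1, u) \<in> vertices" "(n, u) \<in> vertices"
  shows "{ar_root (n - 1, u), ar_root (n, u)}
    = {orbit n \<xi> (u + int n - 1) + eps (t_index n \<xi>), orbit n \<xi> (u + int n - 1) - eps (t_index n \<xi>)}"
proof -
  obtain a where a: "u = \<xi> (n - 1) - 2 * int a" using vertices_depth[OF assms(1)] .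
  obtain b where b: "u = \<xi> n - 2 * int b" using vertices_depth[OF assms(2)] .
  let ?t = "t_index n \<xi>"
  have e: "\<xi> (n - 1) + int n - 1 - 2 * int a = u + int n - 1" "\<xi> n + int n - 1 - 2 * int b = u + int n - 1"
    using a b by auto
  have "n - 1 \<noteq> n" using n by linarith
  have r: "ar_root (n - 1, u) = orbit n \<xi> (u + int n - 1) - (\<lambda>x. (-1) ^ a * (if ?t = n then 1 else -1) * eps ?t x)"
    "ar_root (n, u) = orbit n \<xi> (u + int n - 1) - (\<lambda>x. (-1) ^ b * (-1) * eps ?t x)"
  proof -
    have "ar_root (n - 1, u) = orbit n \<xi> (\<xi> (n - 1) + int n - 1 - 2 * int a)
        - (\<lambda>x. (-1) ^ a * (if ?t = n then 1 else -1) * eps ?t x)"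
      unfolding a root_power using eta_fork[OF n h, of "n - 1"]
      by (simp only: coxeter_power_orbit_eps_t[OF n h w] simp_thms)
    then show "ar_root (n - 1, u) = orbit n \<xi> (u + int n - 1) - (\<lambda>x. (-1) ^ a * (if ?t = n then 1 else -1) * eps ?t x)"
      unfolding e .
    have "ar_root (n, u) = orbit n \<xi> (\<xi> n + int n - 1 - 2 * int b) - (\<lambda>x. (-1) ^ b * (-1) * eps ?t x)"
      unfolding b root_power using eta_fork[OF n h, of n] \<open>n - 1 \<noteq> n\<close>
      by (simp only: coxeter_power_orbit_eps_t[OF n h w] simp_thms if_False not_sym[OF \<open>n - 1 \<noteq> n\<close>])
    then show "ar_root (n, u) = orbit n \<xi> (u + int n - 1) - (\<lambda>x. (-1) ^ b * (-1) * eps ?t x)"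
      unfolding e .
  qed
  have s: "((-1::real) ^ a * (if ?t = n then 1 else -1) = 1 \<and> (-1::real) ^ b * (-1) = -1)
    \<or> ((-1::real) ^ a * (if ?t = n then 1 else -1) = -1 \<and> (-1::real) ^ b * (-1) = 1)"
  proof -
    consider "?t = n" "a = b" | "?t = n - 1" "a = Suc b" | "?t = n - 1" "b = Suc a"
      using t_index_cases[OF n h] a b by linarith
    then show ?thesis
    proof cases
      case 1
      then show ?thesis by (cases "even b") simp_all
    next
      case 2
      then have "?t \<noteq> n" using \<open>n - 1 \<noteq> n\<close> by simp
      then show ?thesis using 2(2) by (cases "even b") simp_all
    next
      case 3
      then have "?t \<noteq> n" using \<open>n - 1 \<noteq> n\<close> by simp
      then show ?thesis using 3(2) by (cases "even a") simp_all
    qed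
  qed
  have m: "(\<lambda>x. 1 * eps ?t x) = eps ?t" "v - (\<lambda>x. (-1) * eps ?t x) = v + eps ?t" for v
    by (auto simp: fun_eq_iff)
  from s show ?thesis
  proof
    assume "(-1::real) ^ a * (if ?t = n then 1 else -1) = 1 \<and> (-1::real) ^ b * (-1) = -1"
    then show ?thesis unfolding r by (simp only: m insert_commute)
  next
    assume "(-1::real) ^ a * (if ?t = n then 1 else -1) = -1 \<and> (-1::real) ^ b * (-1) = 1"
    then show ?thesis unfolding r by (simp only: m)
  qed
qed

end

section \<open>Projective covers and injective envelopes\<close>

text \<open>If \<open>A\<close> is injective then so is \<open>A\<^sup>* A\<close>, since \<open>A\<^sup>* A v = 0\<close> implies \<open>\<bar>A v\<bar>\<^sup>2 = 0\<close>. Thus \<open>A\<^sup>* A\<close> is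
invertible, and \<open>(A\<^sup>* A)\<^sup>-\<^sup>1 A\<^sup>*\<close> is a left inverse.\<close>

lemma injective_mat_left_inverse:
  fixes A :: "complex mat"
  assumes A: "A \<in> carrier_mat r c" and inj: "inj_on (\<lambda>u. A *\<^sub>v u) (carrier_vec c)"
  shows "\<exists>L\<in>carrier_mat c r. L * A = 1\<^sub>m c"
proof -
  define H where "H = mat c r (\<lambda>(i, j). conjugate (A $$ (j, i)))"
  have H: "H \<in> carrier_mat c r" by (simp add: H_def)
  have HA: "H * A \<in> carrier_mat c c" using H A by simp
  have "det (H * A) \<noteq> 0"
  proof
    assume "det (H * A) = 0"
    then obtain v where v: "v \<in> carrier_vec c" "v \<noteq> 0\<^sub>v c" "(H * A) *\<^sub>v v = 0\<^sub>v c"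
      using det_0_iff_vec_prod_zero_field[OF HA] by auto
    define x where "x = A *\<^sub>v v"
    have x: "x \<in> carrier_vec r" using A v unfolding x_def by simp
    have Hx: "H *\<^sub>v x = 0\<^sub>v c" using v H A unfolding x_def by (metis assoc_mult_mat_vec)
    have z: "(\<Sum>j<r. conjugate (A $$ (j, i)) * x $ j) = 0" if "i < c" for i
    proof -
      have "(H *\<^sub>v x) $ i = (\<Sum>j<r. conjugate (A $$ (j, i)) * x $ j)"
        using that H x by (simp add: H_def scalar_prod_def lessThan_atLeast0)
      then show ?thesis using Hx that by simp
    qed
    have xj: "x $ j = (\<Sum>i<c. A $$ (j, i) * v $ i)" if "j < r" for j
      using that A v unfolding x_def by (simp add: scalar_prod_def lessThan_atLeast0)
    have "x \<bullet>c x = (\<Sum>j<r. x $ j * conjugate (x $ j))"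
      using x by (simp add: scalar_prod_def lessThan_atLeast0)
    also have "\<dots> = (\<Sum>j<r. x $ j * (\<Sum>i<c. conjugate (A $$ (j, i)) * conjugate (v $ i)))"
      by (rule sum.cong) (simp_all add: xj conjugate_complex_def)
    also have "\<dots> = (\<Sum>j<r. \<Sum>i<c. conjugate (v $ i) * (conjugate (A $$ (j, i)) * x $ j))"
      by (simp add: sum_distrib_left algebra_simps)
    also have "\<dots> = (\<Sum>i<c. conjugate (v $ i) * (\<Sum>j<r. conjugate (A $$ (j, i)) * x $ j))"
      by (subst sum.swap) (simp add: sum_distrib_left)
    also have "\<dots> = 0" using z by simp
    finally have "x = 0\<^sub>v r" using conjugate_square_eq_0_vec[OF x] by simp
    then have "A *\<^sub>v v = A *\<^sub>v 0\<^sub>v c" using A unfolding x_def by auto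
    then have "v = 0\<^sub>v c" using inj v(1) unfolding inj_on_def by auto
    then show False using v(2) by simp
  qed
  then have "H * A \<in> Units (ring_mat TYPE(complex) c ())"
    by (rule det_non_zero_imp_unit[OF HA])
  then obtain D where "D \<in> carrier_mat c c" "D * (H * A) = 1\<^sub>m c"
    unfolding Units_def ring_mat_def by auto
  then show ?thesis using H A by (intro bexI[of _ "D * H"]) auto
qed

text \<open>If every vertex reachable from \<open>k\<close> has only one reachable predecessor, then data at \<open>k\<close> propagate along
the arrows to all reachable vertices without any compatibility condition. The height function
supplies the recursion. This is the Yoneda lemma behind the freeness of \<open>P(k)\<close>; with all arrows
reversed it serves for \<open>I(k)\<close>.\<close>

lemma transport_along_tree:
  assumes h: "height_function Q \<xi>"
    and uniq: "\<And>a a' b. (k, a) \<in> Q\<^sup>* \<Longrightarrow> (k, a') \<in> Q\<^sup>* \<Longrightarrow> (a, b) \<in> Q \<Longrightarrow> (a', b) \<in> Q \<Longrightarrow> a = a'"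
  shows "\<exists>X. X k = x0 \<and> (\<forall>a b. (k, a) \<in> Q\<^sup>* \<longrightarrow> (a, b) \<in> Q \<longrightarrow> X b = F a b (X a))"
proof -
  define pr where "pr b = (THE a. (k, a) \<in> Q\<^sup>* \<and> (a, b) \<in> Q)" for b
  define fam where "fam = rec_nat (\<lambda>_. x0) (\<lambda>_ X b. F (pr b) b (X (pr b)))"
  have fam: "fam 0 j = x0" "fam (Suc d) b = F (pr b) b (fam d (pr b))" for d j b
    by (simp_all add: fam_def)
  have pr: "pr b = a" if "(k, a) \<in> Q\<^sup>*" "(a, b) \<in> Q" for a b
    unfolding pr_def by (rule the_equality) (use that uniq in auto)
  have down: "\<xi> a \<le> \<xi> k" if "(k, a) \<in> Q\<^sup>*" for a
    using that by (induction rule: rtrancl_induct) (use h in \<open>auto simp: height_function_def\<close>)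
  have "fam (nat (\<xi> k - \<xi> b)) b = F a b (fam (nat (\<xi> k - \<xi> a)) a)"
    if "(k, a) \<in> Q\<^sup>*" "(a, b) \<in> Q" for a b
  proof -
    have "\<xi> b = \<xi> a - 1" using h that(2) by (auto simp: height_function_def)
    then have "nat (\<xi> k - \<xi> b) = Suc (nat (\<xi> k - \<xi> a))" using down[OF that(1)] by simp
    then show ?thesis by (simp add: fam pr[OF that])
  qed
  then show ?thesis by (intro exI[of _ "\<lambda>j. fam (nat (\<xi> k - \<xi> j)) j"]) (simp add: fam)
qed

text \<open>The representation with a line at each vertex of \<open>R\<close> and identity maps between these lines; the maps
to and from zero spaces are empty matrices, so the all-ones matrix describes every arrow.\<close>

definition thin_rep :: "nat set \<Rightarrow> quiver_rep" where
  "thin_rep R = (let d = (\<lambda>j. if j \<in> R then 1 else 0)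
     in \<lparr>rep_dim = d, rep_map = (\<lambda>(a, b). mat (d b) (d a) (\<lambda>_. 1))\<rparr>)"

definition ones :: "nat \<Rightarrow> nat \<Rightarrow> complex mat" where
  "ones r c = mat r c (\<lambda>_. 1)"

lemma ones_carrier [simp]: "ones r c \<in> carrier_mat r c"
  by (simp add: ones_def)

lemma ones_1_1 [simp]: "ones 1 1 = 1\<^sub>m 1" "ones (Suc 0) (Suc 0) = 1\<^sub>m (Suc 0)"
  by (auto simp: ones_def)

lemma thin_rep_simps [simp]:
  "rep_dim (thin_rep R) j = (if j \<in> R then 1 else 0)"
  "rep_map (thin_rep R) (a, b) = ones (if b \<in> R then 1 else 0) (if a \<in> R then 1 else 0)"
  by (simp_all add: thin_rep_def Let_def ones_def)

lemma simple_rep_simps [simp]: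
  "rep_dim (simple_rep i) j = (if j = i then 1 else 0)"
  "rep_map (simple_rep i) (a, b) = 0\<^sub>m (if b = i then 1 else 0) (if a = i then 1 else 0)"
  by (simp_all add: simple_rep_def Let_def)

lemma is_rep_thin_rep: "is_rep Q (thin_rep R)"
  by (auto simp: is_rep_def)

lemma mat_eq_no_cols:
  assumes "A \<in> carrier_mat r 0" "B \<in> carrier_mat r 0"
  shows "A = B"
  using assms by (intro eq_matI) auto

lemma mat_eq_no_rows:
  assumes "A \<in> carrier_mat 0 c" "B \<in> carrier_mat 0 c"
  shows "A = B"
  using assms by (intro eq_matI) auto

lemma vec_eq_dim_0: "u \<in> carrier_vec 0 \<Longrightarrow> v \<in> carrier_vec 0 \<Longrightarrow> u = v"
  by (intro eq_vecI) auto

lemma dimension_vector_thin_rep: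
  "dimension_vector n (thin_rep R) = (\<Sum>j\<in>{j\<in>{1..n}. j \<in> R}. simple_root n j)"
proof -
  have "dimension_vector n (thin_rep R) = (\<Sum>j\<in>{1..n}. if j \<in> R then simple_root n j else 0)"
    unfolding dimension_vector_def by (rule sum.cong) (auto simp: fun_eq_iff)
  then show ?thesis by (simp only: sum.inter_filter finite_atLeastAtMost)
qed

locale graded_quiver =
  fixes n :: nat and Q :: quiver and \<xi> :: "nat \<Rightarrow> int" and k :: nat
  assumes Q_range: "(a, b) \<in> Q \<Longrightarrow> a \<in> {1..n} \<and> b \<in> {1..n}"
    and ht: "height_function Q \<xi>" and k: "k \<in> {1..n}"
begin

lemma no_cycle: "(a, b) \<in> Q \<Longrightarrow> (b, a) \<notin> Q\<^sup>*"
proof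
  assume ab: "(a, b) \<in> Q" "(b, a) \<in> Q\<^sup>*"
  have "\<xi> x \<ge> \<xi> y" if "(x, y) \<in> Q\<^sup>*" for x y
    using that by (induction rule: rtrancl_induct) (use ht in \<open>auto simp: height_function_def\<close>)
  from this[OF ab(2)] show False using ab(1) ht by (auto simp: height_function_def)
qed

end

locale projective_tree = graded_quiver +
  assumes uniq: "\<And>a a' b. (k, a) \<in> Q\<^sup>* \<Longrightarrow> (k, a') \<in> Q\<^sup>* \<Longrightarrow> (a, b) \<in> Q \<Longrightarrow> (a', b) \<in> Q \<Longrightarrow> a = a'"
begin

abbreviation "R \<equiv> {j. (k, j) \<in> Q\<^sup>*}"
abbreviation "P \<equiv> thin_rep R"

lemma R_step: "a \<in> R \<Longrightarrow> (a, b) \<in> Q \<Longrightarrow> b \<in> R"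
  by (auto intro: rtrancl_into_rtrancl)

text \<open>A morphism from \<open>P(k)\<close> is determined by a vector at \<open>k\<close>. Lifting this vector through the
epimorphism and transporting the lift along the tree gives the required factorisation.\<close>

lemma projective_rep_P: "projective_rep n Q P"
  unfolding projective_rep_def
proof (intro conjI allI impI)
  fix M N g f
  assume a: "is_rep Q M \<and> is_rep Q N \<and> rep_hom n Q M N g \<and> rep_surj n M N g \<and> rep_hom n Q P N f"
  have M: "rep_map M (i, j) \<in> carrier_mat (rep_dim M j) (rep_dim M i)" if "(i, j) \<in> Q" for i j
    using a that unfolding is_rep_def by auto
  have N: "rep_map N (i, j) \<in> carrier_mat (rep_dim N j) (rep_dim N i)" if "(i, j) \<in> Q" for i j
    using a that unfolding is_rep_def by auto
  have g: "g i \<in> carrier_mat (rep_dim N i) (rep_dim M i)" if "i \<in> {1..n}" for i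
    using a that unfolding rep_hom_def by blast
  have gQ: "g j * rep_map M (i, j) = rep_map N (i, j) * g i" if "(i, j) \<in> Q" for i j
    using a that unfolding rep_hom_def by blast
  have f: "f i \<in> carrier_mat (rep_dim N i) (rep_dim P i)" if "i \<in> {1..n}" for i
    using a that unfolding rep_hom_def by blast
  have fQ: "f j * rep_map P (i, j) = rep_map N (i, j) * f i" if "(i, j) \<in> Q" for i j
    using a that unfolding rep_hom_def by blast
  have fk: "f k \<in> carrier_mat (rep_dim N k) 1" using f[OF k] by simp
  have "col (f k) 0 \<in> carrier_vec (rep_dim N k)" by (rule carrier_vecI) (use fk in auto)
  then obtain u where u: "u \<in> carrier_vec (rep_dim M k)" "g k *\<^sub>v u = col (f k) 0"
    using a k unfolding rep_surj_def by blast
  define U where "U = mat_of_cols (rep_dim M k) [u]"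
  have U: "U \<in> carrier_mat (rep_dim M k) 1"
    using mat_of_cols_carrier(1)[of "rep_dim M k" "[u]"] by (simp add: U_def)
  have gU: "g k * U = f k"
  proof (rule eq_matI)
    fix i j assume "i < dim_row (f k)" "j < dim_col (f k)"
    then have ij: "i < rep_dim N k" "j = 0" using fk by auto
    have "(g k * U) $$ (i, 0) = row (g k) i \<bullet> col U 0" using ij g[OF k] U by simp
    also have "col U 0 = u" using u by (simp add: U_def)
    also have "row (g k) i \<bullet> u = (g k *\<^sub>v u) $ i" using ij g[OF k] by simp
    finally show "(g k * U) $$ (i, j) = f k $$ (i, j)" using u(2) ij fk by simp
  qed (use g[OF k] U fk in auto)
  have "\<exists>X. X k = U \<and> (\<forall>a b. (k, a) \<in> Q\<^sup>* \<longrightarrow> (a, b) \<in> Q \<longrightarrow> X b = rep_map M (a, b) * X a)"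
    by (rule transport_along_tree[OF ht]) (rule uniq)
  then obtain X where X: "X k = U" "\<And>a b. (k, a) \<in> Q\<^sup>* \<Longrightarrow> (a, b) \<in> Q \<Longrightarrow> X b = rep_map M (a, b) * X a"
    by auto
  have XR: "X j \<in> carrier_mat (rep_dim M j) 1 \<and> g j * X j = f j" if "(k, j) \<in> Q\<^sup>*" for j
    using that
  proof (induction rule: rtrancl_induct)
    case base
    then show ?case using X(1) U gU by simp
  next
    case (step a b)
    have ab: "a \<in> {1..n}" "b \<in> {1..n}" using Q_range[OF step(2)] by auto
    have m: "rep_map P (a, b) = 1\<^sub>m 1" using step R_step[of a b] by simp
    have Xa: "X a \<in> carrier_mat (rep_dim M a) 1" using step by simp
    have fb: "f b \<in> carrier_mat (rep_dim N b) 1" using f[OF ab(2)] step R_step[of a b] by simp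
    have "g b * X b = (g b * rep_map M (a, b)) * X a"
      unfolding X(2)[OF step(1,2)] using assoc_mult_mat[OF g[OF ab(2)] M[OF step(2)] Xa] by simp
    also have "\<dots> = rep_map N (a, b) * (g a * X a)"
      unfolding gQ[OF step(2)] by (rule assoc_mult_mat[OF N[OF step(2)] g[OF ab(1)] Xa])
    also have "\<dots> = f b * rep_map P (a, b)" using step fQ[OF step(2)] by simp
    also have "\<dots> = f b" using fb unfolding m by simp
    finally show ?case using X(2)[OF step(1,2)] M[OF step(2)] Xa by simp
  qed
  define H where "H j = (if j \<in> R then X j else 0\<^sub>m (rep_dim M j) 0)" for j
  have "rep_hom n Q P M H"
    unfolding rep_hom_def
  proof (intro conjI ballI)
    fix i assume "i \<in> {1..n}"
    show "H i \<in> carrier_mat (rep_dim M i) (rep_dim P i)" using XR[of i] by (simp add: H_def)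
  next
    fix e assume "e \<in> Q"
    obtain a b where e: "e = (a, b)" by force
    then have ab: "(a, b) \<in> Q" using \<open>e \<in> Q\<close> by simp
    have "H b * rep_map P (a, b) = rep_map M (a, b) * H a"
    proof (cases "a \<in> R")
      case True
      then have "b \<in> R" using R_step ab by blast
      then have Xb: "X b \<in> carrier_mat (rep_dim M b) 1" using XR[of b] by simp
      have "rep_map P (a, b) = 1\<^sub>m 1" using True \<open>b \<in> R\<close> by simp
      moreover have "X b = rep_map M (a, b) * X a" using True ab by (intro X(2)) simp_all
      ultimately show ?thesis using True \<open>b \<in> R\<close> right_mult_one_mat[OF Xb]
        by (simp only: H_def if_True)
    next
      case False
      have "H b \<in> carrier_mat (rep_dim M b) (rep_dim P b)" using XR[of b] by (simp add: H_def)
      then have "H b * rep_map P (a, b) \<in> carrier_mat (rep_dim M b) 0" using False by auto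
      moreover have "rep_map M (a, b) * H a \<in> carrier_mat (rep_dim M b) 0"
        using False M[OF ab] by (simp add: H_def)
      ultimately show ?thesis by (rule mat_eq_no_cols)
    qed
    then show "case e of (i, j) \<Rightarrow> H j * rep_map P (i, j) = rep_map M (i, j) * H i" using e by simp
  qed
  moreover have "\<forall>i\<in>{1..n}. rep_comp g H i = f i"
  proof
    fix i assume i: "i \<in> {1..n}"
    show "rep_comp g H i = f i"
    proof (cases "i \<in> R")
      case True
      then show ?thesis using XR[of i] by (simp add: rep_comp_def H_def)
    next
      case False
      have "g i * H i \<in> carrier_mat (rep_dim N i) 0" using False g[OF i] by (simp add: H_def)
      moreover have "f i \<in> carrier_mat (rep_dim N i) 0" using False f[OF i] by simp
      ultimately show ?thesis unfolding rep_comp_def by (rule mat_eq_no_cols)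
    qed
  qed
  ultimately show "\<exists>h. rep_hom n Q P M h \<and> (\<forall>i\<in>{1..n}. rep_comp g h i = f i)" by blast
qed (rule is_rep_thin_rep)

text \<open>The projection is essential because \<open>P(k)\<close> is generated at \<open>k\<close>: surjectivity at \<open>k\<close> spreads along
all paths from \<open>k\<close>.\<close>

lemma projective_cover_P: "projective_cover n Q (simple_rep k) P"
  unfolding projective_cover_def
proof (intro conjI)
  define \<pi> where "\<pi> j = ones (rep_dim (simple_rep k) j) (rep_dim P j)" for j
  have \<pi>: "\<pi> j \<in> carrier_mat (rep_dim (simple_rep k) j) (rep_dim P j)" for j
    unfolding \<pi>_def by (rule ones_carrier)
  have \<pi>k: "\<pi> k = 1\<^sub>m 1" by (simp add: \<pi>_def)
  have hom: "rep_hom n Q P (simple_rep k) \<pi>"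
    unfolding rep_hom_def
  proof (intro conjI ballI)
    fix e assume "e \<in> Q"
    obtain a b where e: "e = (a, b)" by force
    then have ab: "(a, b) \<in> Q" using \<open>e \<in> Q\<close> by simp
    have c: "\<pi> b * rep_map P (a, b) \<in> carrier_mat (rep_dim (simple_rep k) b) (rep_dim P a)"
      "rep_map (simple_rep k) (a, b) * \<pi> a \<in> carrier_mat (rep_dim (simple_rep k) b) (rep_dim P a)"
      using \<pi>[of a] \<pi>[of b] by auto
    have "\<pi> b * rep_map P (a, b) = rep_map (simple_rep k) (a, b) * \<pi> a"
    proof (cases "b = k")
      case True
      then have "a \<notin> R" using no_cycle ab by auto
      then have "rep_dim P a = 0" by simp
      show ?thesis by (rule mat_eq_no_cols[OF c[unfolded \<open>rep_dim P a = 0\<close>]])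
    next
      case False
      then have "rep_dim (simple_rep k) b = 0" by simp
      show ?thesis by (rule mat_eq_no_rows[OF c[unfolded \<open>rep_dim (simple_rep k) b = 0\<close>]])
    qed
    then show "case e of (i, j) \<Rightarrow> \<pi> j * rep_map P (i, j) = rep_map (simple_rep k) (i, j) * \<pi> i"
      using e by simp
  qed (rule \<pi>)
  moreover have "rep_surj n P (simple_rep k) \<pi>"
    unfolding rep_surj_def
  proof (intro ballI)
    fix i and v :: "complex vec" assume i: "i \<in> {1..n}" and v: "v \<in> carrier_vec (rep_dim (simple_rep k) i)"
    show "\<exists>u\<in>carrier_vec (rep_dim P i). \<pi> i *\<^sub>v u = v"
    proof (cases "i = k")
      case True
      then show ?thesis using v \<pi>k by (intro bexI[of _ v]) auto
    next
      case False
      then have "v \<in> carrier_vec 0" "\<pi> i *\<^sub>v 0\<^sub>v (rep_dim P i) \<in> carrier_vec 0"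
        using v \<pi>[of i] by auto
      then show ?thesis by (intro bexI[of _ "0\<^sub>v (rep_dim P i)"] vec_eq_dim_0) auto
    qed
  qed
  moreover have "rep_surj n X P g"
    if X: "is_rep Q X" and g: "rep_hom n Q X P g" and s: "rep_surj n X (simple_rep k) (rep_comp \<pi> g)" for X g
  proof -
    have gc: "g i \<in> carrier_mat (rep_dim P i) (rep_dim X i)" if "i \<in> {1..n}" for i
      using g that unfolding rep_hom_def by blast
    have gQ: "g j * rep_map X (i, j) = rep_map P (i, j) * g i" if "(i, j) \<in> Q" for i j
      using g that unfolding rep_hom_def by blast
    have XQ: "rep_map X (i, j) \<in> carrier_mat (rep_dim X j) (rep_dim X i)" if "(i, j) \<in> Q" for i j
      using X that unfolding is_rep_def by auto
    have "\<forall>v\<in>carrier_vec 1. \<exists>u\<in>carrier_vec (rep_dim X j). g j *\<^sub>v u = v"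
      if "(k, j) \<in> Q\<^sup>*" for j
      using that
    proof (induction rule: rtrancl_induct)
      case base
      have "rep_comp \<pi> g k = g k" using gc[OF k] \<pi>k by (simp add: rep_comp_def)
      then show ?case using s k unfolding rep_surj_def by fastforce
    next
      case (step a b)
      have ab: "a \<in> {1..n}" "b \<in> {1..n}" using Q_range[OF step(2)] by auto
      have m: "rep_map P (a, b) = 1\<^sub>m 1" using step R_step[of a b] by simp
      have ga: "g a \<in> carrier_mat 1 (rep_dim X a)" using gc[OF ab(1)] step by simp
      show ?case
      proof
        fix v :: "complex vec" assume "v \<in> carrier_vec 1"
        then obtain u where u: "u \<in> carrier_vec (rep_dim X a)" "g a *\<^sub>v u = v" using step by blast
        have "g b *\<^sub>v (rep_map X (a, b) *\<^sub>v u) = (g b * rep_map X (a, b)) *\<^sub>v u"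
          using assoc_mult_mat_vec[OF gc[OF ab(2)] XQ[OF step(2)] u(1)] by simp
        also have "\<dots> = v" unfolding gQ[OF step(2)] m using ga u by simp
        finally show "\<exists>u\<in>carrier_vec (rep_dim X b). g b *\<^sub>v u = v"
          using XQ[OF step(2)] u(1) by (intro bexI[of _ "rep_map X (a, b) *\<^sub>v u"]) auto
      qed
    qed
    then show ?thesis unfolding rep_surj_def
    proof (intro ballI)
      fix i and v :: "complex vec" assume i: "i \<in> {1..n}" and v: "v \<in> carrier_vec (rep_dim P i)"
      show "\<exists>u\<in>carrier_vec (rep_dim X i). g i *\<^sub>v u = v"
      proof (cases "i \<in> R")
        case True
        then show ?thesis
          using \<open>\<And>j. (k, j) \<in> Q\<^sup>* \<Longrightarrow> \<forall>v\<in>carrier_vec 1. \<exists>u\<in>carrier_vec (rep_dim X j). g j *\<^sub>v u = v\<close> v by simp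
      next
        case False
        then have "v \<in> carrier_vec 0" "g i *\<^sub>v 0\<^sub>v (rep_dim X i) \<in> carrier_vec 0"
          using v gc[OF i] by auto
        then show ?thesis by (intro bexI[of _ "0\<^sub>v (rep_dim X i)"] vec_eq_dim_0) auto
      qed
    qed
  qed
  ultimately show "\<exists>\<pi>. rep_hom n Q P (simple_rep k) \<pi> \<and> rep_surj n P (simple_rep k) \<pi> \<and>
       (\<forall>X g. is_rep Q X \<and> rep_hom n Q X P g \<and> rep_surj n X (simple_rep k) (rep_comp \<pi> g)
          \<longrightarrow> rep_surj n X P g)" by blast
qed (rule projective_rep_P)

end

locale injective_tree = graded_quiver +
  assumes uniq: "\<And>b b' a. (b, k) \<in> Q\<^sup>* \<Longrightarrow> (b', k) \<in> Q\<^sup>* \<Longrightarrow> (a, b) \<in> Q \<Longrightarrow> (a, b') \<in> Q \<Longrightarrow> b = b'"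
begin

abbreviation "R \<equiv> {j. (j, k) \<in> Q\<^sup>*}"
abbreviation "I \<equiv> thin_rep R"

lemma R_step: "b \<in> R \<Longrightarrow> (a, b) \<in> Q \<Longrightarrow> a \<in> R"
  by (auto intro: converse_rtrancl_into_rtrancl)

text \<open>Dually, a morphism to \<open>I(k)\<close> is determined by a linear form at \<open>k\<close>. A left inverse of the
monomorphism at \<open>k\<close> extends the form, and the extension is transported along the reversed tree.\<close>

lemma injective_rep_I: "injective_rep n Q I"
  unfolding injective_rep_def
proof (intro conjI allI impI)
  fix M N g f
  assume a: "is_rep Q M \<and> is_rep Q N \<and> rep_hom n Q M N g \<and> rep_inj n M g \<and> rep_hom n Q M I f"
  have M: "rep_map M (i, j) \<in> carrier_mat (rep_dim M j) (rep_dim M i)" if "(i, j) \<in> Q" for i j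
    using a that unfolding is_rep_def by auto
  have N: "rep_map N (i, j) \<in> carrier_mat (rep_dim N j) (rep_dim N i)" if "(i, j) \<in> Q" for i j
    using a that unfolding is_rep_def by auto
  have g: "g i \<in> carrier_mat (rep_dim N i) (rep_dim M i)" if "i \<in> {1..n}" for i
    using a that unfolding rep_hom_def by blast
  have gQ: "g j * rep_map M (i, j) = rep_map N (i, j) * g i" if "(i, j) \<in> Q" for i j
    using a that unfolding rep_hom_def by blast
  have f: "f i \<in> carrier_mat (rep_dim I i) (rep_dim M i)" if "i \<in> {1..n}" for i
    using a that unfolding rep_hom_def by blast
  have fQ: "f j * rep_map M (i, j) = rep_map I (i, j) * f i" if "(i, j) \<in> Q" for i j
    using a that unfolding rep_hom_def by blast
  have fk: "f k \<in> carrier_mat 1 (rep_dim M k)" using f[OF k] by simp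
  have "inj_on (\<lambda>u. g k *\<^sub>v u) (carrier_vec (rep_dim M k))"
    using a k unfolding rep_inj_def by blast
  then obtain L where L: "L \<in> carrier_mat (rep_dim M k) (rep_dim N k)" "L * g k = 1\<^sub>m (rep_dim M k)"
    using injective_mat_left_inverse[OF g[OF k]] by blast
  define U where "U = f k * L"
  have U: "U \<in> carrier_mat 1 (rep_dim N k)" using fk L by (simp add: U_def)
  have Ug: "U * g k = f k"
    unfolding U_def using assoc_mult_mat[OF fk L(1) g[OF k]] L(2) fk by simp
  have ht': "height_function (Q\<inverse>) (\<lambda>i. - \<xi> i)"
    using ht by (auto simp: height_function_def)
  have "\<exists>X. X k = U \<and> (\<forall>b a. (k, b) \<in> (Q\<inverse>)\<^sup>* \<longrightarrow> (b, a) \<in> Q\<inverse> \<longrightarrow> X a = X b * rep_map N (a, b))"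
    by (rule transport_along_tree[OF ht']) (use uniq in \<open>auto simp: rtrancl_converse\<close>)
  then obtain X where X: "X k = U" "\<And>a b. (b, k) \<in> Q\<^sup>* \<Longrightarrow> (a, b) \<in> Q \<Longrightarrow> X a = X b * rep_map N (a, b)"
    by (auto simp: rtrancl_converse)
  have XR: "X j \<in> carrier_mat 1 (rep_dim N j) \<and> X j * g j = f j" if "(j, k) \<in> Q\<^sup>*" for j
    using that
  proof (induction rule: converse_rtrancl_induct)
    case base
    then show ?case using X(1) U Ug by simp
  next
    case (step a b)
    have ab: "a \<in> {1..n}" "b \<in> {1..n}" using Q_range[OF step(1)] by auto
    have aR: "a \<in> R" using step R_step[of b a] by simp
    have m: "rep_map I (a, b) = 1\<^sub>m 1" using step aR by simp
    have Xb: "X b \<in> carrier_mat 1 (rep_dim N b)" using step by simp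
    have fa: "f a \<in> carrier_mat 1 (rep_dim M a)" using f[OF ab(1)] aR by simp
    have "X a * g a = X b * (rep_map N (a, b) * g a)"
      unfolding X(2)[OF step(2,1)] by (rule assoc_mult_mat[OF Xb N[OF step(1)] g[OF ab(1)]])
    also have "\<dots> = (X b * g b) * rep_map M (a, b)"
      unfolding gQ[OF step(1), symmetric] using assoc_mult_mat[OF Xb g[OF ab(2)] M[OF step(1)]] by simp
    also have "\<dots> = rep_map I (a, b) * f a" using step fQ[OF step(1)] by simp
    also have "\<dots> = f a" using fa unfolding m by simp
    finally show ?case using X(2)[OF step(2,1)] N[OF step(1)] Xb by simp
  qed
  define H where "H j = (if j \<in> R then X j else 0\<^sub>m 0 (rep_dim N j))" for j
  have Hc: "H j \<in> carrier_mat (rep_dim I j) (rep_dim N j)" for j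
    using XR[of j] by (simp add: H_def)
  have "rep_hom n Q N I H"
    unfolding rep_hom_def
  proof (intro conjI ballI)
    fix e assume "e \<in> Q"
    obtain a b where e: "e = (a, b)" by force
    then have ab: "(a, b) \<in> Q" using \<open>e \<in> Q\<close> by simp
    have "H b * rep_map N (a, b) = rep_map I (a, b) * H a"
    proof (cases "b \<in> R")
      case True
      then have "a \<in> R" using R_step ab by blast
      then have Xa: "X a \<in> carrier_mat 1 (rep_dim N a)" using XR[of a] by simp
      have "rep_map I (a, b) = 1\<^sub>m 1" using True \<open>a \<in> R\<close> by simp
      moreover have "X a = X b * rep_map N (a, b)" using True ab by (intro X(2)) simp_all
      ultimately show ?thesis using True \<open>a \<in> R\<close> left_mult_one_mat[OF Xa]
        by (simp only: H_def if_True)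
    next
      case False
      have "H b * rep_map N (a, b) \<in> carrier_mat 0 (rep_dim N a)"
        using False N[OF ab] by (simp add: H_def)
      moreover have "rep_map I (a, b) * H a \<in> carrier_mat 0 (rep_dim N a)"
      proof -
        have "rep_map I (a, b) \<in> carrier_mat 0 (rep_dim I a)" using False by simp
        then show ?thesis using Hc[of a] by (rule mult_carrier_mat)
      qed
      ultimately show ?thesis by (rule mat_eq_no_rows)
    qed
    then show "case e of (i, j) \<Rightarrow> H j * rep_map N (i, j) = rep_map I (i, j) * H i" using e by simp
  qed (rule Hc)
  moreover have "\<forall>i\<in>{1..n}. rep_comp H g i = f i"
  proof
    fix i assume i: "i \<in> {1..n}"
    show "rep_comp H g i = f i"
    proof (cases "i \<in> R")
      case True
      then show ?thesis using XR[of i] by (simp add: rep_comp_def H_def)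
    next
      case False
      have "H i * g i \<in> carrier_mat 0 (rep_dim M i)" using False g[OF i] by (simp add: H_def)
      moreover have "f i \<in> carrier_mat 0 (rep_dim M i)" using False f[OF i] by simp
      ultimately show ?thesis unfolding rep_comp_def by (rule mat_eq_no_rows)
    qed
  qed
  ultimately show "\<exists>h. rep_hom n Q N I h \<and> (\<forall>i\<in>{1..n}. rep_comp h g i = f i)" by blast
qed (rule is_rep_thin_rep)

text \<open>The inclusion is essential because injectivity at \<open>k\<close> spreads backwards along all paths to \<open>k\<close>.\<close>

lemma injective_envelope_I: "injective_envelope n Q (simple_rep k) I"
  unfolding injective_envelope_def
proof (intro conjI)
  define \<iota> where "\<iota> j = ones (rep_dim I j) (rep_dim (simple_rep k) j)" for j
  have \<iota>: "\<iota> j \<in> carrier_mat (rep_dim I j) (rep_dim (simple_rep k) j)" for j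
    unfolding \<iota>_def by (rule ones_carrier)
  have \<iota>k: "\<iota> k = 1\<^sub>m 1" by (simp add: \<iota>_def)
  have hom: "rep_hom n Q (simple_rep k) I \<iota>"
    unfolding rep_hom_def
  proof (intro conjI ballI)
    fix e assume "e \<in> Q"
    obtain a b where e: "e = (a, b)" by force
    then have ab: "(a, b) \<in> Q" using \<open>e \<in> Q\<close> by simp
    have c: "\<iota> b * rep_map (simple_rep k) (a, b) \<in> carrier_mat (rep_dim I b) (rep_dim (simple_rep k) a)"
      "rep_map I (a, b) * \<iota> a \<in> carrier_mat (rep_dim I b) (rep_dim (simple_rep k) a)"
    proof -
      have "rep_map I (a, b) \<in> carrier_mat (rep_dim I b) (rep_dim I a)"
        "rep_map (simple_rep k) (a, b) \<in> carrier_mat (rep_dim (simple_rep k) b) (rep_dim (simple_rep k) a)"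
        by simp_all
      then show "\<iota> b * rep_map (simple_rep k) (a, b) \<in> carrier_mat (rep_dim I b) (rep_dim (simple_rep k) a)"
        "rep_map I (a, b) * \<iota> a \<in> carrier_mat (rep_dim I b) (rep_dim (simple_rep k) a)"
        using \<iota>[of a] \<iota>[of b] by (blast intro: mult_carrier_mat)+
    qed
    have "\<iota> b * rep_map (simple_rep k) (a, b) = rep_map I (a, b) * \<iota> a"
    proof (cases "a = k")
      case True
      then have "b \<notin> R" using no_cycle ab by auto
      then have "rep_dim I b = 0" by simp
      show ?thesis by (rule mat_eq_no_rows[OF c[unfolded \<open>rep_dim I b = 0\<close>]])
    next
      case False
      then have "rep_dim (simple_rep k) a = 0" by simp
      show ?thesis by (rule mat_eq_no_cols[OF c[unfolded \<open>rep_dim (simple_rep k) a = 0\<close>]])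
    qed
    then show "case e of (i, j) \<Rightarrow> \<iota> j * rep_map (simple_rep k) (i, j) = rep_map I (i, j) * \<iota> i"
      using e by simp
  qed (rule \<iota>)
  moreover have "rep_inj n (simple_rep k) \<iota>"
    unfolding rep_inj_def
  proof (intro ballI inj_onI)
    fix i and u v :: "complex vec" assume i: "i \<in> {1..n}"
      and uv: "u \<in> carrier_vec (rep_dim (simple_rep k) i)" "v \<in> carrier_vec (rep_dim (simple_rep k) i)"
        "\<iota> i *\<^sub>v u = \<iota> i *\<^sub>v v"
    show "u = v"
    proof (cases "i = k")
      case True
      then show ?thesis using uv \<iota>k by simp
    next
      case False
      then show ?thesis using uv(1,2) by (intro vec_eq_dim_0) auto
    qed
  qed
  moreover have "rep_inj n I g"
    if X: "is_rep Q X" and g: "rep_hom n Q I X g" and s: "rep_inj n (simple_rep k) (rep_comp g \<iota>)" for X g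
  proof -
    have gc: "g i \<in> carrier_mat (rep_dim X i) (rep_dim I i)" if "i \<in> {1..n}" for i
      using g that unfolding rep_hom_def by blast
    have gQ: "g j * rep_map I (i, j) = rep_map X (i, j) * g i" if "(i, j) \<in> Q" for i j
      using g that unfolding rep_hom_def by blast
    have XQ: "rep_map X (i, j) \<in> carrier_mat (rep_dim X j) (rep_dim X i)" if "(i, j) \<in> Q" for i j
      using X that unfolding is_rep_def by auto
    have inj: "inj_on (\<lambda>u. g j *\<^sub>v u) (carrier_vec 1)" if "(j, k) \<in> Q\<^sup>*" for j
      using that
    proof (induction rule: converse_rtrancl_induct)
      case base
      have "rep_comp g \<iota> k = g k" using gc[OF k] \<iota>k by (simp add: rep_comp_def)
      then show ?case using s k unfolding rep_inj_def by fastforce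
    next
      case (step a b)
      have ab: "a \<in> {1..n}" "b \<in> {1..n}" using Q_range[OF step(1)] by auto
      have aR: "a \<in> R" using step R_step[of b a] by simp
      have m: "rep_map I (a, b) = 1\<^sub>m 1" using step aR by simp
      have ga: "g a \<in> carrier_mat (rep_dim X a) 1" using gc[OF ab(1)] aR by simp
      have gb: "g b \<in> carrier_mat (rep_dim X b) 1" using gc[OF ab(2)] step by simp
      have e: "rep_map X (a, b) * g a = g b" using gQ[OF step(1)] gb unfolding m by simp
      show ?case
      proof (rule inj_onI)
        fix u v :: "complex vec" assume uv: "u \<in> carrier_vec 1" "v \<in> carrier_vec 1" "g a *\<^sub>v u = g a *\<^sub>v v"
        have "g b *\<^sub>v u = g b *\<^sub>v v"
          using assoc_mult_mat_vec[OF XQ[OF step(1)] ga uv(1)] assoc_mult_mat_vec[OF XQ[OF step(1)] ga uv(2)]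
            uv(3) by (simp add: e)
        then show "u = v" using step.IH uv(1,2) by (auto dest: inj_onD)
      qed
    qed
    show ?thesis unfolding rep_inj_def
    proof
      fix i assume i: "i \<in> {1..n}"
      show "inj_on (\<lambda>u. g i *\<^sub>v u) (carrier_vec (rep_dim I i))"
      proof (cases "i \<in> R")
        case True
        then show ?thesis using inj by simp
      next
        case False
        then show ?thesis by (intro inj_onI vec_eq_dim_0) auto
      qed
    qed
  qed
  ultimately show "\<exists>\<iota>. rep_hom n Q (simple_rep k) I \<iota> \<and> rep_inj n (simple_rep k) \<iota> \<and>
       (\<forall>X g. is_rep Q X \<and> rep_hom n Q I X g \<and> rep_inj n (simple_rep k) (rep_comp g \<iota>)
          \<longrightarrow> rep_inj n I g)" by blast
qed (rule injective_rep_I)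

end

lemma graded_quiver_of:
  assumes n: "n \<ge> 4" and k: "1 \<le> k" "k \<le> n"
  shows "graded_quiver n (quiver_of n \<xi>) \<xi> k"
proof
  show "a \<in> {1..n} \<and> b \<in> {1..n}" if "(a, b) \<in> quiver_of n \<xi>" for a b
    using that edge_range[OF n, of a b] by (auto simp: quiver_of_def)
  show "height_function (quiver_of n \<xi>) \<xi>" by (auto simp: height_function_def quiver_of_def)
  show "k \<in> {1..n}" using k by simp
qed

lemma quiver_of_unique_successor:
  assumes n: "n \<ge> 4" and h: "heights n \<xi>" and k: "1 \<le> k" "k \<le> n"
    and r: "(b, k) \<in> (quiver_of n \<xi>)\<^sup>*" and ab: "(a, b) \<in> quiver_of n \<xi>"
  shows "b = toward n k a"
proof -
  have e: "{a, b} \<in> dynkin_edges n" "\<xi> b = \<xi> a - 1" using ab by (auto simp: quiver_of_def)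
  note rg = edge_range[OF n e(1)]
  have "(a, k) \<in> (quiver_of n \<xi>)\<^sup>*" using r ab by (rule converse_rtrancl_into_rtrancl[rotated])
  then have "\<xi> a - \<xi> k = tree_dist n a k" "\<xi> b - \<xi> k = tree_dist n b k"
    using quiver_of_rtrancl_iff[OF n h k] rg r by auto
  then show ?thesis using tree_dist_edge[OF n k e(1)] e(2) by auto
qed

lemma is_dim_I_eta:
  assumes n: "n \<ge> 4" and h: "heights n \<xi>" and k: "1 \<le> k" "k \<le> n"
  shows "is_dim_I n (quiver_of n \<xi>) k (eta n (quiver_of n \<xi>) k)"
proof -
  interpret graded_quiver n "quiver_of n \<xi>" \<xi> k by (rule graded_quiver_of[OF n k])
  interpret injective_tree n "quiver_of n \<xi>" \<xi> k
    by unfold_locales (metis quiver_of_unique_successor[OF n h assms(3,4)])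
  show ?thesis
    unfolding is_dim_I_def
  proof (intro exI conjI)
    show "injective_envelope n (quiver_of n \<xi>) (simple_rep k) I" by (rule injective_envelope_I)
    show "eta n (quiver_of n \<xi>) k = dimension_vector n I"
      unfolding eta_def dimension_vector_thin_rep by simp
  qed
qed

lemma quiver_of_uminus: "quiver_of n (\<lambda>i. - \<xi> i) = (quiver_of n \<xi>)\<inverse>"
  by (auto simp: quiver_of_def insert_commute)

lemma heights_uminus: "heights n \<xi> \<Longrightarrow> heights n (\<lambda>i. - \<xi> i)"
  by (simp add: heights_def abs_minus_commute)

lemma is_dim_P_eta:
  assumes n: "n \<ge> 4" and h: "heights n \<xi>" and k: "1 \<le> k" "k \<le> n"
  shows "is_dim_P n (quiver_of n \<xi>) k (eta n (quiver_of n (\<lambda>i. - \<xi> i)) k)"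
proof -
  interpret graded_quiver n "quiver_of n \<xi>" \<xi> k by (rule graded_quiver_of[OF n k])
  interpret projective_tree n "quiver_of n \<xi>" \<xi> k
  proof
    fix a a' b
    assume "(k, a) \<in> (quiver_of n \<xi>)\<^sup>*" "(k, a') \<in> (quiver_of n \<xi>)\<^sup>*"
      "(a, b) \<in> quiver_of n \<xi>" "(a', b) \<in> quiver_of n \<xi>"
    then show "a = a'"
      using quiver_of_unique_successor[OF n heights_uminus[OF h] assms(3,4), of a b]
        quiver_of_unique_successor[OF n heights_uminus[OF h] assms(3,4), of a' b]
      by (simp add: quiver_of_uminus rtrancl_converse)
  qed
  show ?thesis
    unfolding is_dim_P_def
  proof (intro exI conjI)
    show "projective_cover n (quiver_of n \<xi>) (simple_rep k) P" by (rule projective_cover_P)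
    show "eta n (quiver_of n (\<lambda>i. - \<xi> i)) k = dimension_vector n P"
      unfolding eta_def dimension_vector_thin_rep quiver_of_uminus rtrancl_converse by simp
  qed
qed

section \<open>Maximal swings\<close>

text \<open>Passing to the opposite quiver reflects all positions at 1. It turns the formula for the
injectives into one for the projectives.\<close>

lemma orbit_uminus:
  assumes n: "n \<ge> 4" and h: "heights n \<xi>"
  shows "orbit n (\<lambda>i. - \<xi> i) m = orbit n \<xi> (2 - m)"
proof -
  let ?\<xi> = "\<lambda>i. - \<xi> i"
  note u = trunk_unit_steps[OF n h]
  have t: "t_index n ?\<xi> = t_index n \<xi>"
    unfolding t_index_def by (simp add: abs_minus_commute)
  have tr: "trunk n ?\<xi> x = - trunk n \<xi> x" for x by (simp add: trunk_def)
  have p: "position (trunk n ?\<xi>) x = 2 - position (trunk n \<xi>) x" if "1 \<le> x" "x \<le> n - 1" for x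
  proof (cases "x = 1")
    case True
    then show ?thesis by (simp add: position_def tr)
  next
    case False
    then obtain y where y: "x = Suc y" "1 \<le> y" "y < n - 1"
      using \<open>1 \<le> x\<close> \<open>x \<le> n - 1\<close> by (cases x) auto
    have "\<bar>trunk n \<xi> (Suc y) - trunk n \<xi> y\<bar> = 1" using u y unfolding unit_steps_def by blast
    then have "trunk n \<xi> (Suc y) = trunk n \<xi> y + 1 \<or> trunk n \<xi> (Suc y) = trunk n \<xi> y - 1" by linarith
    then show ?thesis using False y by (auto simp: position_def tr)
  qed
  show ?thesis
  proof
    fix c
    show "orbit n ?\<xi> m c = orbit n \<xi> (2 - m) c"
    proof (cases "1 \<le> c \<and> c \<le> n")
      case True
      then have "1 \<le> min c (n - 1)" "min c (n - 1) \<le> n - 1" using n by auto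
      note q = p[OF this]
      have e: "m - (2 - position (trunk n \<xi>) (min c (n - 1))) = - (2 - m - position (trunk n \<xi>) (min c (n - 1)))" by simp
      show ?thesis unfolding orbit_def t q e antiperiodic_sign_minus ..
    next
      case False
      then have "c = 0 \<or> c > n" by auto
      then show ?thesis by (simp only: orbit_outside)
    qed
  qed
qed

lemma eta_uminus:
  assumes n: "n \<ge> 4" and h: "heights n \<xi>" and i: "1 \<le> i" "i \<le> n - 2"
  shows "eta n (quiver_of n (\<lambda>i. - \<xi> i)) i
    = orbit n \<xi> (\<xi> i - int i + 2) - orbit n \<xi> (\<xi> i + int i + 2)"
proof -
  have "2 - (- \<xi> i + int i) = \<xi> i - int i + 2" "2 - (- \<xi> i - int i) = \<xi> i + int i + 2" by auto
  then show ?thesis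
    unfolding eta_trunk[OF n heights_uminus[OF h] i] orbit_uminus[OF n h] by (simp only:)
qed

lemma orbit_shifted_position:
  assumes n: "n \<ge> 4" and h: "heights n \<xi>" and k: "1 \<le> k" "k \<le> n - 2"
    and d: "\<bar>d\<bar> < 2 * int n - 2" "d \<noteq> 0"
  shows "orbit n \<xi> (position \<xi> k + d) k = 0"
  using d by (simp add: orbit_trunk[OF n h k] position_trunk[OF n k(2)] antiperiodic_sign_small)

context adapted_D_quiver
begin

abbreviation "swing \<equiv> swing_with n (quiver_of n \<xi>) \<xi> w"

lemma swing_vertices:
  assumes sw: "swing r S u s N \<rho>"
  shows "1 \<le> r" "r \<le> n - 2" "1 \<le> s" "s \<le> n - 2"
    and "(n - 1, u) \<in> vertices" "(n, u) \<in> vertices"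
    and "\<And>l. r \<le> l \<Longrightarrow> l \<le> n - 2 \<Longrightarrow> S l = (l, u - int n + 1 + int l) \<and> S l \<in> vertices"
    and "\<And>l. s \<le> l \<Longrightarrow> l \<le> n - 2 \<Longrightarrow> N l = (l, u + int n - 1 - int l) \<and> N l \<in> vertices"
    and "fst \<rho> = S ` {r..n - 2} \<union> {(n - 1, u), (n, u)} \<union> N ` {s..n - 2}"
proof -
  have rs: "1 \<le> r" "r \<le> n - 2" "1 \<le> s" "s \<le> n - 2"
    and fS: "\<And>l. r \<le> l \<Longrightarrow> l \<le> n - 2 \<Longrightarrow> fst (S l) = l"
    and fN: "\<And>l. s \<le> l \<Longrightarrow> l \<le> n - 2 \<Longrightarrow> fst (N l) = l"
    and aS: "\<And>l. r \<le> l \<Longrightarrow> l < n - 2 \<Longrightarrow> (S l, S (l + 1)) \<in> S_arrows n (quiver_of n \<xi>) \<xi> w"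
    and aS1: "(S (n - 2), (n - 1, u)) \<in> S_arrows n (quiver_of n \<xi>) \<xi> w"
    and aS2: "(S (n - 2), (n, u)) \<in> S_arrows n (quiver_of n \<xi>) \<xi> w"
    and aN: "\<And>l. s \<le> l \<Longrightarrow> l < n - 2 \<Longrightarrow> (N (l + 1), N l) \<in> N_arrows n (quiver_of n \<xi>) \<xi> w"
    and aN1: "((n - 1, u), N (n - 2)) \<in> N_arrows n (quiver_of n \<xi>) \<xi> w"
    and \<rho>: "fst \<rho> = S ` {r..n - 2} \<union> {(n - 1, u), (n, u)} \<union> N ` {s..n - 2}"
    using sw unfolding swing_with_def Let_def by auto
  have AS: "x \<in> vertices \<and> y \<in> vertices \<and> snd y = snd x + 1"
    if "(x, y) \<in> S_arrows n (quiver_of n \<xi>) \<xi> w" for x y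
    using that unfolding S_arrows_def AR_arrows_def by auto
  have AN: "x \<in> vertices \<and> y \<in> vertices \<and> snd y = snd x + 1"
    if "(x, y) \<in> N_arrows n (quiver_of n \<xi>) \<xi> w" for x y
    using that unfolding N_arrows_def AR_arrows_def by auto
  show "1 \<le> r" "r \<le> n - 2" "1 \<le> s" "s \<le> n - 2" by (fact rs)+
  show "(n - 1, u) \<in> vertices" "(n, u) \<in> vertices" using AS[OF aS1] AS[OF aS2] by auto
  have n2: "int (n - 2) = int n - 2" using n by simp
  show "S l = (l, u - int n + 1 + int l) \<and> S l \<in> vertices" if l: "r \<le> l" "l \<le> n - 2" for l
    using l(2,1)
  proof (induction l rule: inc_induct)
    case base
    then show ?case using AS[OF aS1] fS[OF base order_refl] n2 by (auto simp: prod_eq_iff)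
  next
    case (step l)
    have "S (Suc l) = (Suc l, u - int n + 1 + int (Suc l)) \<and> S (Suc l) \<in> vertices"
      by (rule step.IH) (use step.prems in simp)
    moreover have "S l \<in> vertices \<and> S (l + 1) \<in> vertices \<and> snd (S (l + 1)) = snd (S l) + 1"
      by (rule AS[OF aS]) (use step in simp_all)
    moreover have "fst (S l) = l" by (rule fS) (use step in simp_all)
    ultimately show ?case by (auto simp: prod_eq_iff)
  qed
  show "N l = (l, u + int n - 1 - int l) \<and> N l \<in> vertices" if l: "s \<le> l" "l \<le> n - 2" for l
    using l(2,1)
  proof (induction l rule: inc_induct)
    case base
    then show ?case using AN[OF aN1] fN[OF base order_refl] n2 by (auto simp: prod_eq_iff)
  next
    case (step l)
    have "N (Suc l) = (Suc l, u + int n - 1 - int (Suc l)) \<and> N (Suc l) \<in> vertices"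
      by (rule step.IH) (use step.prems in simp)
    moreover have "N (l + 1) \<in> vertices \<and> N l \<in> vertices \<and> snd (N l) = snd (N (l + 1)) + 1"
      by (rule AN[OF aN]) (use step in simp_all)
    moreover have "fst (N l) = l" by (rule fN) (use step in simp_all)
    ultimately show ?case by (auto simp: prod_eq_iff)
  qed
  show "fst \<rho> = S ` {r..n - 2} \<union> {(n - 1, u), (n, u)} \<union> N ` {s..n - 2}" by (rule \<rho>)
qed

text \<open>A swing is determined by its turning height and its two end levels, so it exists as soon as all
vertices on the two diagonals belong to the quiver.\<close>

lemma swing_exists:
  assumes rs: "1 \<le> r" "r \<le> n - 2" "1 \<le> s" "s \<le> n - 2"
    and f: "(n - 1, u) \<in> vertices" "(n, u) \<in> vertices"
    and S: "\<And>l. r \<le> l \<Longrightarrow> l \<le> n - 2 \<Longrightarrow> (l, u - int n + 1 + int l) \<in> vertices"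
    and N: "\<And>l. s \<le> l \<Longrightarrow> l \<le> n - 2 \<Longrightarrow> (l, u + int n - 1 - int l) \<in> vertices"
  shows "\<exists>\<rho>. swing r (\<lambda>l. (l, u - int n + 1 + int l)) u s (\<lambda>l. (l, u + int n - 1 - int l)) \<rho>"
proof -
  have n2: "int (n - 2) = int n - 2" "n - 2 + 1 = n - 1" using n by auto
  have ed: "{l, l + 1} \<in> dynkin_edges n" "{l + 1, l} \<in> dynkin_edges n"
    if "1 \<le> l" "l \<le> n - 2" for l
    using that edge_iff[OF n] by simp_all
  have ed2: "{n - 2, n} \<in> dynkin_edges n" "{n, n - 2} \<in> dynkin_edges n"
    using edge_iff[OF n] by simp_all
  have Sa: "((i, p), (j, p + 1)) \<in> S_arrows n (quiver_of n \<xi>) \<xi> w"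
    if "(i, p) \<in> vertices" "(j, p + 1) \<in> vertices" "{i, j} \<in> dynkin_edges n"
      "1 \<le> i \<and> i \<le> n - 2 \<and> j = i + 1 \<or> i = n - 2 \<and> j = n" for i j p
    using that unfolding S_arrows_def AR_arrows_def by blast
  have Na: "((i, p), (j, p + 1)) \<in> N_arrows n (quiver_of n \<xi>) \<xi> w"
    if "(i, p) \<in> vertices" "(j, p + 1) \<in> vertices" "{i, j} \<in> dynkin_edges n"
      "2 \<le> i \<and> i \<le> n - 1 \<and> j = i - 1 \<or> i = n \<and> j = n - 2" for i j p
    using that unfolding N_arrows_def AR_arrows_def by blast
  have Sl: "((l, u - int n + 1 + int l), (l + 1, u - int n + 1 + int (l + 1))) \<in> S_arrows n (quiver_of n \<xi>) \<xi> w"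
    if l: "r \<le> l" "l < n - 2" for l
  proof -
    have e: "u - int n + 1 + int (l + 1) = u - int n + 1 + int l + 1" by simp
    show ?thesis unfolding e
    proof (rule Sa)
      show "(l + 1, u - int n + 1 + int l + 1) \<in> vertices" using S[of "l + 1"] l unfolding e by simp
    qed (use S[of l] l rs ed[of l] in auto)
  qed
  have Nl: "((l + 1, u + int n - 1 - int (l + 1)), (l, u + int n - 1 - int l)) \<in> N_arrows n (quiver_of n \<xi>) \<xi> w"
    if l: "s \<le> l" "l < n - 2" for l
  proof -
    have e: "u + int n - 1 - int l = u + int n - 1 - int (l + 1) + 1" by simp
    show ?thesis unfolding e
    proof (rule Na)
      show "(l, u + int n - 1 - int (l + 1) + 1) \<in> vertices" using N[of l] l unfolding e by simp
    qed (use N[of "l + 1"] l rs ed[of l] in auto)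
  qed
  have eS: "u - int n + 1 + int (n - 2) = u - 1" and eN: "u + int n - 1 - int (n - 2) = u + 1"
    using n2 by auto
  have v: "(n - 2, u - 1) \<in> vertices" "(n - 2, u + 1) \<in> vertices"
    using S[OF rs(2) order_refl] N[OF rs(4) order_refl] unfolding eS eN by auto
  have n21: "1 \<le> n - 2" "n - 1 = n - 2 + 1" using n by auto
  have Sf: "((n - 2, u - 1), (n - 1, u)) \<in> S_arrows n (quiver_of n \<xi>) \<xi> w"
    "((n - 2, u - 1), (n, u)) \<in> S_arrows n (quiver_of n \<xi>) \<xi> w"
    using Sa[of "n - 2" "u - 1" "n - 1"] Sa[of "n - 2" "u - 1" n] v f ed(1)[OF n21(1) order_refl] ed2 n21
    unfolding n2(2) by auto
  have Nf: "((n - 1, u), (n - 2, u + 1)) \<in> N_arrows n (quiver_of n \<xi>) \<xi> w"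
    "((n, u), (n - 2, u + 1)) \<in> N_arrows n (quiver_of n \<xi>) \<xi> w"
  proof -
    have "n - 2 = n - 1 - 1" "2 \<le> n - 1" using n by auto
    then show "((n - 1, u), (n - 2, u + 1)) \<in> N_arrows n (quiver_of n \<xi>) \<xi> w"
      using v f ed(2)[OF n21(1) order_refl] unfolding n2(2) by (intro Na) auto
    show "((n, u), (n - 2, u + 1)) \<in> N_arrows n (quiver_of n \<xi>) \<xi> w"
      using v f ed2 by (intro Na) auto
  qed
  show ?thesis
    unfolding swing_with_def Let_def eS eN
    by (intro exI conjI) (use rs Sl Nl Sf Nf in auto)
qed

text \<open>A branch that could be continued by one vertex would give a swing with more vertices. The new
vertex is not on the other branch, as the two diagonals cross only at level \<open>n - 1\<close>.\<close>

lemma maximal_swing_ends: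
  assumes mx: "maximal_swing n (quiver_of n \<xi>) \<xi> w \<rho>" and sw: "swing r S u s N \<rho>"
  shows "r = 1 \<or> (r - 1, u - int n + 1 + int (r - 1)) \<notin> vertices"
    and "s = 1 \<or> (s - 1, u + int n - 1 - int (s - 1)) \<notin> vertices"
proof -
  note sv = swing_vertices[OF sw]
  let ?S = "\<lambda>l. (l, u - int n + 1 + int l)" and ?N = "\<lambda>l. (l, u + int n - 1 - int l)"
  have Sv: "?S l \<in> vertices" if "r \<le> l" "l \<le> n - 2" for l using sv(7)[OF that] by metis
  have Nv: "?N l \<in> vertices" if "s \<le> l" "l \<le> n - 2" for l using sv(8)[OF that] by metis
  have "S ` {r..n - 2} = ?S ` {r..n - 2}" "N ` {s..n - 2} = ?N ` {s..n - 2}"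
    using sv(7,8) by (auto intro!: image_cong)
  then have fst\<rho>: "fst \<rho> = ?S ` {r..n - 2} \<union> {(n - 1, u), (n, u)} \<union> ?N ` {s..n - 2}"
    using sv(9) by simp
  have grow: False
    if g: "1 \<le> r'" "r' \<le> r" "1 \<le> s'" "s' \<le> s" "\<And>l. r' \<le> l \<Longrightarrow> l \<le> n - 2 \<Longrightarrow> ?S l \<in> vertices"
      "\<And>l. s' \<le> l \<Longrightarrow> l \<le> n - 2 \<Longrightarrow> ?N l \<in> vertices"
      "x \<in> ?S ` {r'..n - 2} \<union> ?N ` {s'..n - 2}" "x \<notin> fst \<rho>" for r' s' x
  proof -
    have "r' \<le> n - 2" "s' \<le> n - 2" using g sv by auto
    then obtain \<rho>' where \<rho>': "swing r' ?S u s' ?N \<rho>'"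
      using swing_exists[OF g(1) _ g(3) _ sv(5,6) g(5,6)] by blast
    have f\<rho>': "fst \<rho>' = ?S ` {r'..n - 2} \<union> {(n - 1, u), (n, u)} \<union> ?N ` {s'..n - 2}"
      by (rule swing_vertices(9)[OF \<rho>'])
    have "?S ` {r..n - 2} \<subseteq> ?S ` {r'..n - 2}" "?N ` {s..n - 2} \<subseteq> ?N ` {s'..n - 2}"
      by (intro image_mono; use g(2,4) in simp)+
    then have "fst \<rho> \<subseteq> fst \<rho>'" unfolding fst\<rho> f\<rho>' by blast
    moreover have "x \<in> fst \<rho>'" unfolding f\<rho>' using g(7) by blast
    ultimately have "fst \<rho> \<subset> fst \<rho>'" using g(8) by blast
    moreover have "is_swing n (quiver_of n \<xi>) \<xi> w \<rho>'" using \<rho>'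
      unfolding is_swing_def by blast
    ultimately show False using mx unfolding maximal_swing_def by blast
  qed
  show "r = 1 \<or> (r - 1, u - int n + 1 + int (r - 1)) \<notin> vertices"
  proof (rule ccontr)
    assume a: "\<not> (r = 1 \<or> (r - 1, u - int n + 1 + int (r - 1)) \<notin> vertices)"
    then have r: "1 \<le> r - 1" "r - 1 \<le> r" "r - 1 < r" using sv(1) by auto
    have "?S l \<in> vertices" if "r - 1 \<le> l" "l \<le> n - 2" for l
      using a Sv[of l] that by (cases "l = r - 1") auto
    moreover have "?S (r - 1) \<in> ?S ` {r - 1..n - 2} \<union> ?N ` {s..n - 2}" using sv(2) by auto
    moreover have "?S (r - 1) \<notin> fst \<rho>"
    proof -
      have "r - 1 \<noteq> n - 1" "r - 1 \<noteq> n" "int (r - 1) < int n - 1" using sv(2) r n by auto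
      then show ?thesis using r(3) unfolding fst\<rho> by auto
    qed
    ultimately show False using grow[OF r(1,2) sv(3) order_refl] Nv by blast
  qed
  show "s = 1 \<or> (s - 1, u + int n - 1 - int (s - 1)) \<notin> vertices"
  proof (rule ccontr)
    assume a: "\<not> (s = 1 \<or> (s - 1, u + int n - 1 - int (s - 1)) \<notin> vertices)"
    then have s: "1 \<le> s - 1" "s - 1 \<le> s" "s - 1 < s" using sv(3) by auto
    have "?N l \<in> vertices" if "s - 1 \<le> l" "l \<le> n - 2" for l
      using a Nv[of l] that by (cases "l = s - 1") auto
    moreover have "?N (s - 1) \<in> ?S ` {r..n - 2} \<union> ?N ` {s - 1..n - 2}" using sv(4) by auto
    moreover have "?N (s - 1) \<notin> fst \<rho>"
    proof -
      have "s - 1 \<noteq> n - 1" "s - 1 \<noteq> n" "int (s - 1) < int n - 1" using sv(4) s n by auto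
      then show ?thesis using s(3) unfolding fst\<rho> by auto
    qed
    ultimately show False using grow[OF sv(1) order_refl s(1,2)] Sv by blast
  qed
qed

text \<open>Going down the S-branch one level keeps the distance from the right boundary when \<open>\<xi>\<close> falls
with the level and increases it by 2 when \<open>\<xi>\<close> rises. So the branch stops at level \<open>r > 1\<close> only if
its vertex there is the leftmost one and \<open>\<xi> (r - 1) > \<xi> r\<close>. In that case \<open>u + n - 1\<close> is the position
of \<open>r\<close>. For the N-branch the roles of the two boundaries are exchanged. If neither branch stops
early, both reach level 1 and \<open>u + n - 1 = \<xi> 1 + 1\<close>.\<close>

lemma maximal_swing_turning_point:
  assumes mx: "maximal_swing n (quiver_of n \<xi>) \<xi> w \<rho>" and sw: "swing r S u s N \<rho>"
  obtains k where "1 \<le> k" "k \<le> n - 2" "position \<xi> k = u + int n - 1"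
    "(r = k \<and> s = 1 \<and> u + int n - 1 = \<xi> k - int k + 2) \<or> (r = 1 \<and> s = k \<and> u + int n - 1 = \<xi> k + int k)"
proof -
  note sv = swing_vertices[OF sw] and me = maximal_swing_ends[OF mx sw]
  have n2: "int (n - 2) = int n - 2" using n by simp
  obtain i where i: "i \<le> n - 2" "u - int n + 1 + int r = \<xi> r - 2 * int i"
    using sv(7)[OF order_refl sv(2)] vertices_trunk[OF sv(1,2)] by auto
  obtain j where j: "j \<le> n - 2" "u + int n - 1 - int s = \<xi> s - 2 * int j"
    using sv(8)[OF order_refl sv(4)] vertices_trunk[OF sv(3,4)] by auto
  have R: "i = n - 2 \<and> \<xi> (r - 1) = \<xi> r + 1" if "r \<noteq> 1"
  proof -
    have r: "1 \<le> r - 1" "r - 1 \<le> n - 2" "Suc (r - 1) = r" "int (r - 1) = int r - 1"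
      using that sv(1,2) by auto
    have no: "\<nexists>j. j \<le> n - 2 \<and> u - int n + 1 + int (r - 1) = \<xi> (r - 1) - 2 * int j"
      using me(1) that vertices_trunk[OF r(1,2)] by blast
    have "\<bar>\<xi> r - \<xi> (r - 1)\<bar> = 1" using heights_step[OF n h r(1,2)] r(3) by simp
    then consider "\<xi> (r - 1) = \<xi> r - 1" | "\<xi> (r - 1) = \<xi> r + 1" by linarith
    then show ?thesis
    proof cases
      case 1
      then have "u - int n + 1 + int (r - 1) = \<xi> (r - 1) - 2 * int i" using i(2) r(4) by simp
      then show ?thesis using no i(1) by blast
    next
      case 2
      then have "u - int n + 1 + int (r - 1) = \<xi> (r - 1) - 2 * int (Suc i)" using i(2) r(4) by simp
      then have "\<not> Suc i \<le> n - 2" using no by blast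
      then show ?thesis using i(1) 2 by simp
    qed
  qed
  have L: "j = 0 \<and> \<xi> (s - 1) = \<xi> s - 1" if "s \<noteq> 1"
  proof -
    have s: "1 \<le> s - 1" "s - 1 \<le> n - 2" "Suc (s - 1) = s" "int (s - 1) = int s - 1"
      using that sv(3,4) by auto
    have no: "\<nexists>j. j \<le> n - 2 \<and> u + int n - 1 - int (s - 1) = \<xi> (s - 1) - 2 * int j"
      using me(2) that vertices_trunk[OF s(1,2)] by blast
    have "\<bar>\<xi> s - \<xi> (s - 1)\<bar> = 1" using heights_step[OF n h s(1,2)] s(3) by simp
    then consider "\<xi> (s - 1) = \<xi> s + 1" | "\<xi> (s - 1) = \<xi> s - 1" by linarith
    then show ?thesis
    proof cases
      case 1
      then have "u + int n - 1 - int (s - 1) = \<xi> (s - 1) - 2 * int j" using j(2) s(4) by simp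
      then show ?thesis using no j(1) by blast
    next
      case 2
      have "j = 0"
      proof (rule ccontr)
        assume "j \<noteq> 0"
        then obtain j' where j': "j = Suc j'" by (cases j) auto
        then have "u + int n - 1 - int (s - 1) = \<xi> (s - 1) - 2 * int j'" using 2 j(2) s(4) by simp
        then show False using no j(1) j' by (metis Suc_leD)
      qed
      then show ?thesis using 2 by simp
    qed
  qed
  have pr: "position \<xi> r = u + int n - 1 \<and> u + int n - 1 = \<xi> r - int r + 2" if "r \<noteq> 1"
    using R[OF that] i(2) that n2 by (simp add: position_def)
  have ps: "position \<xi> s = u + int n - 1 \<and> u + int n - 1 = \<xi> s + int s" if "s \<noteq> 1"
    using L[OF that] j(2) that by (simp add: position_def)
  have p1: "\<xi> 1 + 1 = position \<xi> 1" by (simp add: position_def)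
  consider "r \<noteq> 1" "s \<noteq> 1" | "r \<noteq> 1" "s = 1" | "r = 1" "s \<noteq> 1" | "r = 1" "s = 1" by blast
  then show ?thesis
  proof cases
    case 1
    have "r = s"
      by (rule position_inj[OF heights_unit_steps[OF n h]]) (use 1 pr ps sv n in auto)
    then show ?thesis using R[OF 1(1)] L[OF 1(2)] by simp
  next
    case 2
    then show ?thesis using that[of r] pr sv(1,2) by simp
  next
    case 3
    then show ?thesis using that[of s] ps sv(3,4) by simp
  next
    case 4
    have "u + int n - 1 = \<xi> 1 + 1" using i j 4 n2 by auto
    then show ?thesis using that[of 1] 4 p1 sv(1,2) by simp
  qed
qed

lemma swing_root_values:
  assumes sw: "swing r S u s N \<rho>" and k: "1 \<le> k" "k \<le> n - 2" and p: "position \<xi> k = u + int n - 1"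
  shows "\<And>l. r \<le> l \<Longrightarrow> l \<le> n - 2 \<Longrightarrow> ar_root (S l) = eps k - orbit n \<xi> (u + int n - 1 + 2 * int l)"
    and "\<And>l. s \<le> l \<Longrightarrow> l \<le> n - 2 \<Longrightarrow> ar_root (N l) = eps k - orbit n \<xi> (u + int n - 1 - 2 * int l)"
    and "{ar_root (n - 1, u), ar_root (n, u)} = {eps k + eps (t_index n \<xi>), eps k - eps (t_index n \<xi>)}"
proof -
  note sv = swing_vertices[OF sw]
  have o: "orbit n \<xi> (u + int n - 1) = eps k" using orbit_position_trunk[OF n h k] p by simp
  show "ar_root (S l) = eps k - orbit n \<xi> (u + int n - 1 + 2 * int l)" if l: "r \<le> l" "l \<le> n - 2" for l
  proof -
    have l1: "1 \<le> l" using sv(1) l by simp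
    have e: "u - int n + 1 + int l + int l = u + int n - 1 + 2 * int l - (2 * int n - 2)"
      "u - int n + 1 + int l - int l = u + int n - 1 - (2 * int n - 2)" by auto
    have "(l, u - int n + 1 + int l) \<in> vertices" "S l = (l, u - int n + 1 + int l)"
      using sv(7)[OF l] by auto
    then have "ar_root (S l) = orbit n \<xi> (u - int n + 1 + int l + int l) - orbit n \<xi> (u - int n + 1 + int l - int l)"
      by (simp only: root_trunk(1)[OF l1 l(2)])
    then have "ar_root (S l) = - orbit n \<xi> (u + int n - 1 + 2 * int l) - - orbit n \<xi> (u + int n - 1)"
      unfolding e orbit_antiperiodic'[OF n] .
    then show ?thesis unfolding o by simp
  qed
  show "ar_root (N l) = eps k - orbit n \<xi> (u + int n - 1 - 2 * int l)" if l: "s \<le> l" "l \<le> n - 2" for l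
  proof -
    have l1: "1 \<le> l" using sv(3) l by simp
    have e: "u + int n - 1 - int l + int l = u + int n - 1"
      "u + int n - 1 - int l - int l = u + int n - 1 - 2 * int l" by auto
    have "(l, u + int n - 1 - int l) \<in> vertices" "N l = (l, u + int n - 1 - int l)"
      using sv(8)[OF l] by auto
    then have "ar_root (N l) = orbit n \<xi> (u + int n - 1 - int l + int l) - orbit n \<xi> (u + int n - 1 - int l - int l)"
      by (simp only: root_trunk(1)[OF l1 l(2)])
    then show ?thesis unfolding e o .
  qed
  show "{ar_root (n - 1, u), ar_root (n, u)} = {eps k + eps (t_index n \<xi>), eps k - eps (t_index n \<xi>)}"
    using roots_fork[OF sv(5,6)] unfolding o .
qed

text \<open>The second term of a root on one of the branches is \<open>g\<close> at an index that differs from the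
position of \<open>k\<close> by a nonzero amount less than the antiperiod, so it does not involve \<open>\<epsilon>\<^sub>k\<close> and the coefficient of
\<open>\<epsilon>\<^sub>k\<close> is 1.\<close>

lemma swing_common_summand:
  assumes sw: "swing r S u s N \<rho>" and k: "1 \<le> k" "k \<le> n - 2" and p: "position \<xi> k = u + int n - 1"
    and \<beta>: "\<beta> \<in> swing_roots n (quiver_of n \<xi>) \<xi> w \<rho>"
  shows "eps k \<in> summands n \<beta>"
proof -
  note sv = swing_vertices[OF sw] and rv = swing_root_values[OF sw k p]
  have z: "orbit n \<xi> (u + int n - 1 + d) k = 0" if "\<bar>d\<bar> < 2 * int n - 2" "d \<noteq> 0" for d
    using orbit_shifted_position[OF n h k that] p by simp
  obtain x where x: "x \<in> fst \<rho>" "\<beta> = ar_root x" using \<beta> unfolding swing_roots_def by auto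
  have bd: "\<bar>2 * int l\<bar> < 2 * int n - 2 \<and> 2 * int l \<noteq> 0"
    if "1 \<le> l" "l \<le> n - 2" for l using that n by auto
  consider (S) l where "r \<le> l" "l \<le> n - 2" "x = S l" | (N) l where "s \<le> l" "l \<le> n - 2" "x = N l"
    | (F) "\<beta> \<in> {ar_root (n - 1, u), ar_root (n, u)}"
    using x sv(9) by auto
  then show ?thesis
  proof cases
    case S
    have l: "1 \<le> l" using S sv(1) by simp
    have "\<beta> k = 1" using z[of "2 * int l"] bd[OF l S(2)] unfolding x(2) S(3) rv(1)[OF S(1,2)]
      by (simp add: eps_def)
    moreover have "\<beta> \<in> pos_roots n"
      using root_trunk(2)[OF l S(2)] sv(7)[OF S(1,2)] x(2) S(3) by metis
    ultimately show ?thesis by (rule summands_coordinate[rotated])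
  next
    case N
    have l: "1 \<le> l" using N sv(3) by simp
    have "\<beta> k = 1" using z[of "- (2 * int l)"] bd[OF l N(2)] unfolding x(2) N(3) rv(2)[OF N(1,2)]
      by (simp add: eps_def)
    moreover have "\<beta> \<in> pos_roots n"
      using root_trunk(2)[OF l N(2)] sv(8)[OF N(1,2)] x(2) N(3) by metis
    ultimately show ?thesis by (rule summands_coordinate[rotated])
  next
    case F
    have "n - 1 < n" "k < n - 1" using k n by auto
    then have "k < t_index n \<xi>" "t_index n \<xi> \<le> n" using t_index_cases[OF n h] by auto
    then show ?thesis using F k(1) unfolding rv(3) summands_def by blast
  qed
qed

text \<open>The position of \<open>k + 1\<close> is one of the two points next to the window of \<open>k\<close>. These points are the
indices of the second term in \<open>swing_root_values\<close> at level \<open>k\<close> or 1 of the appropriate branch. The exception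
is \<open>k + 1 = n - 1 = t\<close>, where \<open>\<alpha>\<^sub>k = \<epsilon>\<^sub>k - \<epsilon>\<^sub>t\<close> is one of the two roots at the fork.\<close>

lemma swing_contains_simple_root:
  assumes sw: "swing r S u s N \<rho>" and k: "1 \<le> k" "k \<le> n - 2" and p: "position \<xi> k = u + int n - 1"
    and form: "(r = k \<and> s = 1 \<and> u + int n - 1 = \<xi> k - int k + 2) \<or> (r = 1 \<and> s = k \<and> u + int n - 1 = \<xi> k + int k)"
  shows "simple_root n k \<in> swing_roots n (quiver_of n \<xi>) \<xi> w \<rho>"
proof -
  note sv = swing_vertices[OF sw] and rv = swing_root_values[OF sw k p]
  have kn: "k \<noteq> n" "1 \<le> n - 2" "k + 1 \<le> n - 1" "k < n - 1" using k n by auto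
  have a: "simple_root n k = eps k - eps (k + 1)" using kn(1) by (simp add: simple_root_def)
  have inS: "ar_root (S l) \<in> swing_roots n (quiver_of n \<xi>) \<xi> w \<rho>"
    if "r \<le> l" "l \<le> n - 2" for l
    using sv(9) that unfolding swing_roots_def by auto
  have inN: "ar_root (N l) \<in> swing_roots n (quiver_of n \<xi>) \<xi> w \<rho>"
    if "s \<le> l" "l \<le> n - 2" for l
    using sv(9) that unfolding swing_roots_def by auto
  have inF: "{ar_root (n - 1, u), ar_root (n, u)} \<subseteq> swing_roots n (quiver_of n \<xi>) \<xi> w \<rho>"
    using sv(9) unfolding swing_roots_def by auto
  show ?thesis
  proof (cases "slot_coordinate n \<xi> (k + 1) = k + 1")
    case False
    then have "k + 1 = n - 1" "t_index n \<xi> \<noteq> n" unfolding slot_coordinate_def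
      by (auto split: if_splits)
    then have "t_index n \<xi> = k + 1" using t_index_cases[OF n h] by auto
    then show ?thesis using rv(3) inF a by auto
  next
    case True
    let ?T = "trunk n \<xi>"
    have o: "orbit n \<xi> (position ?T (k + 1)) = eps (k + 1)"
      using orbit_position[OF n h _ kn(3)] True by simp
    have T: "?T k = \<xi> k" using kn(4) by (simp add: trunk_def)
    have "\<bar>?T (Suc k) - ?T k\<bar> = 1" using trunk_unit_steps[OF n h] k(1) kn(4)
      unfolding unit_steps_def by blast
    then consider "?T (k + 1) = \<xi> k - 1" | "?T (k + 1) = \<xi> k + 1" using T by fastforce
    then show ?thesis
    proof cases
      case 1
      then have "position ?T (k + 1) = \<xi> k - int k" using T k(1) by (simp add: position_def)
      then have e: "eps (k + 1) = orbit n \<xi> (\<xi> k - int k)" using o by simp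
      from form show ?thesis
      proof
        assume f: "r = k \<and> s = 1 \<and> u + int n - 1 = \<xi> k - int k + 2"
        then have e': "u + int n - 1 - 2 * int 1 = \<xi> k - int k" by simp
        have le: "s \<le> 1" using f by simp
        show ?thesis using inN[OF le kn(2)] unfolding rv(2)[OF le kn(2)] e' a e .
      next
        assume f: "r = 1 \<and> s = k \<and> u + int n - 1 = \<xi> k + int k"
        then have e': "u + int n - 1 - 2 * int k = \<xi> k - int k" by simp
        have le: "s \<le> k" using f by simp
        show ?thesis using inN[OF le k(2)] unfolding rv(2)[OF le k(2)] e' a e .
      qed
    next
      case 2
      then have "position ?T (k + 1) = \<xi> k + int k + 2" using T k(1) by (simp add: position_def)
      then have e: "eps (k + 1) = orbit n \<xi> (\<xi> k + int k + 2)" using o by simp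
      from form show ?thesis
      proof
        assume f: "r = k \<and> s = 1 \<and> u + int n - 1 = \<xi> k - int k + 2"
        then have e': "u + int n - 1 + 2 * int k = \<xi> k + int k + 2" by simp
        have le: "r \<le> k" using f by simp
        show ?thesis using inS[OF le k(2)] unfolding rv(1)[OF le k(2)] e' a e .
      next
        assume f: "r = 1 \<and> s = k \<and> u + int n - 1 = \<xi> k + int k"
        then have e': "u + int n - 1 + 2 * int 1 = \<xi> k + int k + 2" by simp
        have le: "r \<le> 1" using f by simp
        show ?thesis using inS[OF le kn(2)] unfolding rv(1)[OF le kn(2)] e' a e .
      qed
    qed
  qed
qed

lemma is_dim_P_left_end:
  assumes sw: "swing k S u s N \<rho>" and k: "1 \<le> k" "k \<le> n - 2" and p: "position \<xi> k = u + int n - 1"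
    and e: "u + int n - 1 = \<xi> k - int k + 2"
  shows "is_dim_P n (quiver_of n \<xi>) k (ar_root (S k))"
proof -
  have "k \<le> n" using k by simp
  have "u + int n - 1 + 2 * int k = \<xi> k + int k + 2" using e by simp
  moreover have "eps k = orbit n \<xi> (\<xi> k - int k + 2)" using orbit_position_trunk[OF n h k] p e by simp
  ultimately have "ar_root (S k) = eta n (quiver_of n (\<lambda>i. - \<xi> i)) k"
    using swing_root_values(1)[OF sw k p order_refl k(2)] eta_uminus[OF n h k] by (simp only:)
  then show ?thesis using is_dim_P_eta[OF n h k(1) \<open>k \<le> n\<close>] by simp
qed

lemma is_dim_I_right_end:
  assumes sw: "swing r S u k N \<rho>" and k: "1 \<le> k" "k \<le> n - 2" and p: "position \<xi> k = u + int n - 1"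
    and e: "u + int n - 1 = \<xi> k + int k"
  shows "is_dim_I n (quiver_of n \<xi>) k (ar_root (N k))"
proof -
  have "k \<le> n" using k by simp
  have "u + int n - 1 - 2 * int k = \<xi> k - int k" using e by simp
  moreover have "eps k = orbit n \<xi> (\<xi> k + int k)" using orbit_position_trunk[OF n h k] p e by simp
  ultimately have "ar_root (N k) = eta n (quiver_of n \<xi>) k"
    using swing_root_values(2)[OF sw k p order_refl k(2)] eta_trunk[OF n h k] by (simp only:)
  then show ?thesis using is_dim_I_eta[OF n h k(1) \<open>k \<le> n\<close>] by simp
qed

end

theorem theorem1p20:
  fixes n :: nat and Q :: quiver and \<xi> :: "nat \<Rightarrow> int" and w :: "nat list" and \<rho> :: subquiver
  assumes "n \<ge> 4"
    and "dynkin_quiver n Q"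
    and "height_function Q \<xi>"
    and "adapted_word n Q w"
    and "maximal_swing n Q \<xi> w \<rho>"
  shows "\<exists>k. 1 \<le> k \<and> k \<le> n - 2 \<and>
    (\<forall>\<beta>\<in>swing_roots n Q \<xi> w \<rho>. eps k \<in> summands n \<beta>) \<and>
    simple_root n k \<in> swing_roots n Q \<xi> w \<rho> \<and>
    ((\<exists>S u N. swing_with n Q \<xi> w k S u 1 N \<rho> \<and>
        is_dim_P n Q k (root_at n Q \<xi> w (S k)) \<and>
        {root_at n Q \<xi> w (n - 1, u), root_at n Q \<xi> w (n, u)}
          = {eps k + eps (t_index n \<xi>), eps k - eps (t_index n \<xi>)}) \<or>
     (\<exists>S u N. swing_with n Q \<xi> w 1 S u k N \<rho> \<and>
        is_dim_I n Q k (root_at n Q \<xi> w (N k)) \<and>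
        {root_at n Q \<xi> w (n - 1, u), root_at n Q \<xi> w (n, u)}
          = {eps k + eps (t_index n \<xi>), eps k - eps (t_index n \<xi>)}))"
proof -
  have h: "heights n \<xi>" and Q: "Q = quiver_of n \<xi>"
    using dynkin_quiver_heights[OF assms(2,3)] by auto
  interpret adapted_D_quiver n \<xi> w
    using assms(1,4) h unfolding Q by unfold_locales
  have mx: "maximal_swing n (quiver_of n \<xi>) \<xi> w \<rho>" using assms(5) unfolding Q .
  then obtain r S u s N where sw: "swing r S u s N \<rho>"
    unfolding maximal_swing_def is_swing_def by blast
  obtain k where k: "1 \<le> k" "k \<le> n - 2" and p: "position \<xi> k = u + int n - 1"
    and form: "(r = k \<and> s = 1 \<and> u + int n - 1 = \<xi> k - int k + 2) \<or> (r = 1 \<and> s = k \<and> u + int n - 1 = \<xi> k + int k)"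
    using maximal_swing_turning_point[OF mx sw] .
  note fork = swing_root_values(3)[OF sw k p]
  show ?thesis unfolding Q
  proof (intro exI[of _ k] conjI k ballI)
    show "eps k \<in> summands n \<beta>"
      if "\<beta> \<in> swing_roots n (quiver_of n \<xi>) \<xi> w \<rho>" for \<beta>
      by (rule swing_common_summand[OF sw k p that])
    show "simple_root n k \<in> swing_roots n (quiver_of n \<xi>) \<xi> w \<rho>"
      by (rule swing_contains_simple_root[OF sw k p form])
    from form show "(\<exists>S u N. swing k S u 1 N \<rho> \<and> is_dim_P n (quiver_of n \<xi>) k (ar_root (S k)) \<and>
        {ar_root (n - 1, u), ar_root (n, u)} = {eps k + eps (t_index n \<xi>), eps k - eps (t_index n \<xi>)}) \<or>
      (\<exists>S u N. swing 1 S u k N \<rho> \<and> is_dim_I n (quiver_of n \<xi>) k (ar_root (N k)) \<and>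
        {ar_root (n - 1, u), ar_root (n, u)} = {eps k + eps (t_index n \<xi>), eps k - eps (t_index n \<xi>)})"
    proof
      assume f: "r = k \<and> s = 1 \<and> u + int n - 1 = \<xi> k - int k + 2"
      then have sk: "swing k S u 1 N \<rho>" using sw by simp
      then show ?thesis using is_dim_P_left_end[OF sk k p] f fork by blast
    next
      assume f: "r = 1 \<and> s = k \<and> u + int n - 1 = \<xi> k + int k"
      then have sk: "swing 1 S u k N \<rho>" using sw by simp
      then show ?thesis using is_dim_I_right_end[OF sk k p] f fork by blast
    qed
  qed
qed

end
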